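(* Let $i_k\cdots i_1$ be a sequence of indices in $\{1,\dots,n\}$. (1) Any two bimodules associated to this sequence are isomorphic in $\bar R-\mathrm{mod}_{\mathbb Z}-\bar R$. (2) The bimodule $B_{i_k\cdots i_1}$ is free as a left module over $\mathcal{O}(W_{i_k\cdots i_1})$ and free as a right module over $\mathcal{O}(W_{i_1\cdots i_k})$.
   Context: **Weyl lines.** Let $n\ge 1$, $k$ a field of characteristic $0$, $\mathcal{W}=S_{n+1}$ (Coxeter group of type $A_n$) with simple reflections $s_i=(i,i+1)$, $1\le i\le n$; $T$ is the set of reflections (transpositions). $V$ is the $n$-dimensional geometric (reflection) representation of $\mathcal{W}$ over $k$ and $H_t\subset V$ the reflecting hyperplane of $t\in T$. A Weyl line is a one-dimensional subspace of $V$ that is an intersection of reflecting hyperplanes (for $n=1$, $V$ itself); it is transverse to $t\in T$ if it is not contained in $H_t$. $Z\subset V$ is the union of all Weyl lines; $V_t\subset Z$ is the union of the Weyl lines transverse to $t$; $V_i:=V_{s_i}$. For a nonempty sequence of indices in $\{1,\dots,n\}$ define inductively $W_i=V_i$ and $W_{i_1\cdots i_m}=V_{i_1}\cap(W_{i_2\cdots i_m}\cup s_{i_1}W_{i_2\cdots i_m})$. **Rings.** $\mathcal{O}(X)$ is the algebra of regular functions on a closed subvariety $X\subset V$. $\bar R=\mathcal{O}(Z)$, $R_i=\mathcal{O}(V_i)$, graded as quotients of $\mathcal{O}(V)$ with $V^*$ in degree $2$; $R_i^{s_i}$ is the subring of $s_i$-invariants. $\bar R-\mathrm{mod}_{\mathbb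 Z}-\bar R$ is the category of $\mathbb{Z}$-graded $(\bar R,\bar R)$-bimodules with morphisms homogeneous of degree $0$. Saying that a left (right) $\bar R$-module is free over a quotient $\mathcal{O}(W)$ of $\bar R$ means that the action factors through $\mathcal{O}(W)$ and the module is free over it. **Product.** For $B,B'$ in $\bar R-\mathrm{mod}_{\mathbb Z}-\bar R$, let $V_B^r\subset Z$ (resp. $V_{B'}^\ell\subset Z$) be the closed subvariety defined by the right annihilator of $B$ (resp. the left annihilator of $B'$) in $\bar R$, and set $B\ast B'=B\otimes_{\bar R}\mathcal{O}(V_B^r\cap V_{B'}^\ell)\otimes_{\bar R}B'$. Set $B_i=R_i\otimes_{R_i^{s_i}}R_i$. **Bimodules associated to a sequence.** For a sequence of length one, containing $j$, the bimodule is $B_j$; inductively $B_{i_k\cdots i_1}=B_{i_k}\ast B_{i_{k-1}\cdots i_1}$. A bimodule is associated to the sequence $i_k\cdots i_1$ if it is obtained from $B_{i_k},\dots,B_{i_1}$ by taking the $\ast$-product in this order with some choice of brackets. *)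

theory Defs
  imports
    "HOL-Algebra.Module"
    "HOL-Algebra.Generated_Groups"
    "HOL-Algebra.Free_Abelian_Groups"
    "HOL-Combinatorics.Transposition"
begin

section \<open>Weyl lines in type A\<close>

text \<open>
  The geometric representation of the symmetric group on \<open>{1..n+1}\<close> is realised on the vectors
  \<open>x\<close> of coordinate sum zero, with \<open>(w x)\<^sub>j = x\<^bsub>w\<^sup>-\<^sup>1(j)\<^esub>\<close>. With the simple roots
  \<open>e\<^sub>i - e\<^bsub>i+1\<^esub>\<close> as basis, \<open>s\<^sub>i\<close> acts by \<open>x \<mapsto> x - (x\<^sub>i - x\<^bsub>i+1\<^esub>)(e\<^sub>i - e\<^bsub>i+1\<^esub>)\<close>,
  which is the formula given by the Cartan matrix of type A.
\<close>

definition geom_rep :: "nat \<Rightarrow> (nat \<Rightarrow> 'k::field_char_0) set" where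
  "geom_rep n = {x. (\<forall>j. j \<notin> {1..n + 1} \<longrightarrow> x j = 0) \<and> (\<Sum>j = 1..n + 1. x j) = 0}"

definition perm_act :: "(nat \<Rightarrow> nat) \<Rightarrow> (nat \<Rightarrow> 'k) \<Rightarrow> nat \<Rightarrow> 'k" where
  "perm_act w x = x \<circ> inv_into UNIV w"

definition simple_refl :: "nat \<Rightarrow> nat \<Rightarrow> nat" where
  "simple_refl i = Transposition.transpose i (i + 1)"

definition reflections :: "nat \<Rightarrow> (nat \<Rightarrow> nat) set" where
  "reflections n = {Transposition.transpose i j | i j. 1 \<le> i \<and> i < j \<and> j \<le> n + 1}"

definition refl_hyperplane :: "nat \<Rightarrow> (nat \<Rightarrow> nat) \<Rightarrow> (nat \<Rightarrow> 'k::field_char_0) set" where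
  "refl_hyperplane n t = {x \<in> geom_rep n. perm_act t x = x}"

text \<open>
  The empty intersection of hyperplanes is the whole space; it is a line only for \<open>n = 1\<close>.
\<close>

definition weyl_line :: "nat \<Rightarrow> (nat \<Rightarrow> 'k::field_char_0) set \<Rightarrow> bool" where
  "weyl_line n L \<longleftrightarrow>
     (\<exists>v \<in> geom_rep n. v \<noteq> (\<lambda>_. 0) \<and> L = {\<lambda>j. c * v j | c. True}) \<and>
     (\<exists>A \<subseteq> reflections n. L = geom_rep n \<inter> (\<Inter>t\<in>A. refl_hyperplane n t))"

definition weyl_union :: "nat \<Rightarrow> (nat \<Rightarrow> 'k::field_char_0) set" where
  "weyl_union n = \<Union>{L. weyl_line n L}"

definition transverse_union :: "nat \<Rightarrow> (nat \<Rightarrow> nat) \<Rightarrow> (nat \<Rightarrow> 'k::field_char_0) set" where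
  "transverse_union n t = \<Union>{L. weyl_line n L \<and> \<not> L \<subseteq> refl_hyperplane n t}"

fun W_seq :: "nat \<Rightarrow> nat list \<Rightarrow> (nat \<Rightarrow> 'k::field_char_0) set" where
  "W_seq n [i] = transverse_union n (simple_refl i)"
| "W_seq n (i # j # js) = transverse_union n (simple_refl i) \<inter>
     (W_seq n (j # js) \<union> perm_act (simple_refl i) ` W_seq n (j # js))"


section \<open>Graded bimodules\<close>

text \<open>
  A bimodule extends the (left) module record by a right action and by homogeneous components.
  The same record type is used for graded commutative rings, regarded as bimodules over
  themselves. For bimodules that are not rings the fields \<open>mult\<close> and \<open>one\<close> are irrelevant.
\<close>

record ('r, 'm) gbimod = "('r, 'm) module" +
  rsmult :: "'m \<Rightarrow> 'r \<Rightarrow> 'm"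
  hcomp :: "int \<Rightarrow> 'm set"

definition swap_sides :: "('r, 'm) gbimod \<Rightarrow> ('r, 'm) gbimod" where
  "swap_sides M = M\<lparr>smult := (\<lambda>r m. rsmult M m r), rsmult := (\<lambda>m r. smult M r m)\<rparr>"

definition graded_bimodule :: "('r, 'r) gbimod \<Rightarrow> ('r, 'm) gbimod \<Rightarrow> bool" where
  "graded_bimodule R M \<longleftrightarrow>
     module R M \<and> module R (swap_sides M) \<and>
     (\<forall>r \<in> carrier R. \<forall>s \<in> carrier R. \<forall>m \<in> carrier M.
        rsmult M (smult M r m) s = smult M r (rsmult M m s)) \<and>
     (\<forall>d. subgroup (hcomp M d) (add_monoid M)) \<and>
     (\<forall>m \<in> carrier M. \<exists>!c :: int \<Rightarrow> 'm.
        (\<forall>d. c d \<in> hcomp M d) \<and> finite {d. c d \<noteq> \<zero>\<^bsub>M\<^esub>} \<and>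
        m = finsum M c {d. c d \<noteq> \<zero>\<^bsub>M\<^esub>}) \<and>
     (\<forall>a b. \<forall>r \<in> hcomp R a. \<forall>m \<in> hcomp M b.
        smult M r m \<in> hcomp M (a + b) \<and> rsmult M m r \<in> hcomp M (a + b))"

definition gbimod_hom ::
    "('r, 'r) gbimod \<Rightarrow> ('r, 'm) gbimod \<Rightarrow> ('r, 'n) gbimod \<Rightarrow> ('m \<Rightarrow> 'n) set" where
  "gbimod_hom R M N = {\<phi> \<in> carrier M \<rightarrow> carrier N.
     (\<forall>x \<in> carrier M. \<forall>y \<in> carrier M. \<phi> (x \<oplus>\<^bsub>M\<^esub> y) = \<phi> x \<oplus>\<^bsub>N\<^esub> \<phi> y) \<and>
     (\<forall>r \<in> carrier R. \<forall>x \<in> carrier M.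
        \<phi> (smult M r x) = smult N r (\<phi> x) \<and> \<phi> (rsmult M x r) = rsmult N (\<phi> x) r) \<and>
     (\<forall>d. \<phi> ` hcomp M d \<subseteq> hcomp N d)}"

definition gbimod_isomorphic ::
    "('r, 'r) gbimod \<Rightarrow> ('r, 'm) gbimod \<Rightarrow> ('r, 'n) gbimod \<Rightarrow> bool" where
  "gbimod_isomorphic R M N \<longleftrightarrow>
     graded_bimodule R M \<and> graded_bimodule R N \<and>
     (\<exists>\<phi> \<in> gbimod_hom R M N. \<exists>\<psi> \<in> gbimod_hom R N M.
        (\<forall>x \<in> carrier M. \<psi> (\<phi> x) = x) \<and> (\<forall>y \<in> carrier N. \<phi> (\<psi> y) = y))"

definition free_module :: "('r, 'r) gbimod \<Rightarrow> ('r, 'm) gbimod \<Rightarrow> bool" where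
  "free_module R M \<longleftrightarrow> module R M \<and>
     (\<exists>X \<subseteq> carrier M. \<forall>m \<in> carrier M. \<exists>!c :: 'm \<Rightarrow> 'r.
        (\<forall>x. c x \<in> carrier R) \<and> (\<forall>x. x \<notin> X \<longrightarrow> c x = \<zero>\<^bsub>R\<^esub>) \<and>
        finite {x. c x \<noteq> \<zero>\<^bsub>R\<^esub>} \<and>
        m = finsum M (\<lambda>x. smult M (c x) x) {x. c x \<noteq> \<zero>\<^bsub>R\<^esub>})"


section \<open>Tensor products\<close>

text \<open>
  \<open>M \<otimes>\<^sub>S N\<close> is the free abelian group on \<open>carrier M \<times> carrier N\<close> modulo the usual relations;
  only the carrier of the middle ring matters. The outer actions are the left one of \<open>M\<close> and the
  right one of \<open>N\<close>, and homogeneous degrees add.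
\<close>

definition tensor_rels ::
    "'r set \<Rightarrow> ('r, 'm) gbimod \<Rightarrow> ('r, 'n) gbimod \<Rightarrow> (('m \<times> 'n) \<Rightarrow>\<^sub>0 int) set" where
  "tensor_rels S M N =
     {frag_of (x \<oplus>\<^bsub>M\<^esub> x', y) - frag_of (x, y) - frag_of (x', y) | x x' y.
        x \<in> carrier M \<and> x' \<in> carrier M \<and> y \<in> carrier N} \<union>
     {frag_of (x, y \<oplus>\<^bsub>N\<^esub> y') - frag_of (x, y) - frag_of (x, y') | x y y'.
        x \<in> carrier M \<and> y \<in> carrier N \<and> y' \<in> carrier N} \<union>
     {frag_of (rsmult M x s, y) - frag_of (x, smult N s y) | x s y.
        x \<in> carrier M \<and> s \<in> S \<and> y \<in> carrier N}"

definition tensor_quot ::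
    "'r set \<Rightarrow> ('r, 'm) gbimod \<Rightarrow> ('r, 'n) gbimod \<Rightarrow> ('r, (('m \<times> 'n) \<Rightarrow>\<^sub>0 int) set) gbimod" where
  "tensor_quot S M N =
    (let G = free_Abelian_group (carrier M \<times> carrier N);
         K = generate G (tensor_rels S M N)
     in \<lparr>carrier = carrier (G Mod K), monoid.mult = undefined, monoid.one = undefined,
         ring.zero = \<one>\<^bsub>G Mod K\<^esub>, ring.add = monoid.mult (G Mod K),
         smult = (\<lambda>r C. K <#>\<^bsub>G\<^esub> (frag_extend (\<lambda>(x, y). frag_of (smult M r x, y)) ` C)),
         rsmult = (\<lambda>C r. K <#>\<^bsub>G\<^esub> (frag_extend (\<lambda>(x, y). frag_of (x, rsmult N y r)) ` C)),
         hcomp = (\<lambda>d. (\<lambda>z. K #>\<^bsub>G\<^esub> z) ` generate G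
            {frag_of (x, y) | x y a b. a + b = d \<and> x \<in> hcomp M a \<and> y \<in> hcomp N b})\<rparr>)"

definition transport :: "('m \<Rightarrow> 'n) \<Rightarrow> ('r, 'm) gbimod \<Rightarrow> ('r, 'n) gbimod" where
  "transport \<phi> M =
    (let \<psi> = inv_into (carrier M) \<phi>
     in \<lparr>carrier = \<phi> ` carrier M, monoid.mult = undefined, monoid.one = undefined,
         ring.zero = \<phi> \<zero>\<^bsub>M\<^esub>, ring.add = (\<lambda>x y. \<phi> (\<psi> x \<oplus>\<^bsub>M\<^esub> \<psi> y)),
         smult = (\<lambda>r x. \<phi> (smult M r (\<psi> x))), rsmult = (\<lambda>x r. \<phi> (rsmult M (\<psi> x) r)),
         hcomp = (\<lambda>d. \<phi> ` hcomp M d)\<rparr>)"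

text \<open>
  Iterated tensor products would live in ever larger types. All bimodules are therefore transported
  into one type: a coset in \<open>tensor_quot\<close> is named by a chosen formal integer combination of pairs
  that represents it. By \<open>inj_on_coset_name\<close> below the transport is an isomorphic copy.
\<close>

datatype 'a tens = Elt 'a | Formal "(int \<times> 'a tens \<times> 'a tens) list"

definition formal_sum :: "(int \<times> 'm \<times> 'n) list \<Rightarrow> ('m \<times> 'n) \<Rightarrow>\<^sub>0 int" where
  "formal_sum l = sum_list (map (\<lambda>(c, p). frag_cmul c (frag_of p)) l)"

definition coset_name :: "(('a tens \<times> 'a tens) \<Rightarrow>\<^sub>0 int) set \<Rightarrow> 'a tens" where
  "coset_name C = Formal (SOME l. formal_sum l \<in> C)"

definition tensor ::
    "'r set \<Rightarrow> ('r, 'a tens) gbimod \<Rightarrow> ('r, 'a tens) gbimod \<Rightarrow> ('r, 'a tens) gbimod" where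
  "tensor S M N = transport coset_name (tensor_quot S M N)"

lemma formal_sum_surj: "\<exists>l. formal_sum l = z"
proof (rule frag_induction[of z UNIV "\<lambda>z. \<exists>l. formal_sum l = z"])
  show "\<exists>l. formal_sum l = (0 :: ('a \<times> 'b) \<Rightarrow>\<^sub>0 int)"
    by (rule exI[of _ "[]"]) (simp add: formal_sum_def)
next
  fix p :: "'a \<times> 'b"
  show "\<exists>l. formal_sum l = frag_of p"
    by (rule exI[of _ "[(1, p)]"]) (simp add: formal_sum_def)
next
  fix a b :: "('a \<times> 'b) \<Rightarrow>\<^sub>0 int"
  assume "\<exists>l. formal_sum l = a" "\<exists>l. formal_sum l = b"
  then obtain k l where kl: "formal_sum k = a" "formal_sum l = b" by blast
  have "formal_sum (map (\<lambda>(c, p). (- c, p)) l) = - formal_sum l"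
    by (induction l) (auto simp: formal_sum_def)
  then have "formal_sum (k @ map (\<lambda>(c, p). (- c, p)) l) = a - b"
    using kl by (simp add: formal_sum_def)
  then show "\<exists>l. formal_sum l = a - b" by blast
qed simp

lemma inj_on_coset_name:
  assumes "tensor_rels S M N \<subseteq> carrier (free_Abelian_group (carrier M \<times> carrier N))"
  shows "inj_on coset_name (carrier (tensor_quot S M N))"
proof (rule inj_onI)
  define G where "G = free_Abelian_group (carrier M \<times> carrier N)"
  define K where "K = generate G (tensor_rels S M N)"
  interpret group G by (simp add: G_def)
  have K: "subgroup K G"
    using assms unfolding K_def G_def[symmetric] by (rule generate_is_subgroup)
  have car: "carrier (tensor_quot S M N) = rcosets\<^bsub>G\<^esub> K"
    by (simp add: tensor_quot_def Let_def G_def K_def FactGroup_def)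
  fix C D
  assume C: "C \<in> carrier (tensor_quot S M N)" and D: "D \<in> carrier (tensor_quot S M N)"
    and eq: "coset_name C = coset_name D"
  have *: "formal_sum (SOME l. formal_sum l \<in> A) \<in> A" if A: "A \<in> rcosets\<^bsub>G\<^esub> K" for A
  proof -
    obtain z where "z \<in> A"
      using A rcos_self[OF _ K] by (auto simp: RCOSETS_def)
    then show ?thesis
      using formal_sum_surj[of z] by (metis (mono_tags, lifting) someI_ex)
  qed
  have "C \<inter> D \<noteq> {}"
    using *[of C] *[of D] C D eq by (auto simp: car coset_name_def)
  then show "C = D"
    using rcos_disjoint[OF K] C D by (auto simp: car pairwise_def disjnt_def)
qed


section \<open>Coordinate rings\<close>

text \<open>
  Homogeneous polynomial functions of degree \<open>d\<close> in the coordinates; restricted to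
  \<open>geom_rep n\<close>, the coordinates span the dual space.
\<close>

inductive homog_poly :: "nat \<Rightarrow> nat \<Rightarrow> ((nat \<Rightarrow> 'k::field_char_0) \<Rightarrow> 'k) \<Rightarrow> bool" for n where
  const: "homog_poly n 0 (\<lambda>_. c)"
| coord: "homog_poly n d f \<Longrightarrow> j \<in> {1..n + 1} \<Longrightarrow> homog_poly n (Suc d) (\<lambda>x. x j * f x)"
| add: "homog_poly n d f \<Longrightarrow> homog_poly n d g \<Longrightarrow> homog_poly n d (\<lambda>x. f x + g x)"

inductive_set poly_fun :: "nat \<Rightarrow> ((nat \<Rightarrow> 'k::field_char_0) \<Rightarrow> 'k) set" for n where
  homog: "homog_poly n d f \<Longrightarrow> f \<in> poly_fun n"
| add: "f \<in> poly_fun n \<Longrightarrow> g \<in> poly_fun n \<Longrightarrow> (\<lambda>x. f x + g x) \<in> poly_fun n"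

text \<open>
  A regular function on \<open>X\<close> is represented by its extension by zero. With this convention, for
  \<open>X \<subseteq> Y\<close>, pointwise multiplication is the action of the coordinate ring of \<open>Y\<close> on that of \<open>X\<close>
  through restriction.
\<close>

definition restr :: "(nat \<Rightarrow> 'k::field_char_0) set \<Rightarrow> ((nat \<Rightarrow> 'k) \<Rightarrow> 'k) \<Rightarrow> (nat \<Rightarrow> 'k) \<Rightarrow> 'k" where
  "restr X f = (\<lambda>x. if x \<in> X then f x else 0)"

definition coord_ring ::
    "nat \<Rightarrow> (nat \<Rightarrow> 'k::field_char_0) set \<Rightarrow> ((nat \<Rightarrow> 'k) \<Rightarrow> 'k, (nat \<Rightarrow> 'k) \<Rightarrow> 'k) gbimod" where
  "coord_ring n X =
     \<lparr>carrier = restr X ` poly_fun n, monoid.mult = (\<lambda>f g x. f x * g x),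
      monoid.one = restr X (\<lambda>_. 1),
      ring.zero = (\<lambda>_. 0), ring.add = (\<lambda>f g x. f x + g x),
      smult = (\<lambda>f g x. f x * g x), rsmult = (\<lambda>f g x. f x * g x),
      hcomp = (\<lambda>m. {\<lambda>_. 0} \<union> {restr X f | f d. m = 2 * int d \<and> homog_poly n d f})\<rparr>"

abbreviation R_bar :: "nat \<Rightarrow> ((nat \<Rightarrow> 'k::field_char_0) \<Rightarrow> 'k, (nat \<Rightarrow> 'k) \<Rightarrow> 'k) gbimod" where
  "R_bar n \<equiv> coord_ring n (weyl_union n)"

definition invariants :: "nat \<Rightarrow> nat \<Rightarrow> ((nat \<Rightarrow> 'k::field_char_0) \<Rightarrow> 'k) set" where
  "invariants n i =
     {f \<in> carrier (coord_ring n (transverse_union n (simple_refl i))).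
        \<forall>x \<in> transverse_union n (simple_refl i). f (perm_act (simple_refl i) x) = f x}"


section \<open>The product and the bimodules of a sequence\<close>

type_synonym 'k weyl_bimod = "((nat \<Rightarrow> 'k) \<Rightarrow> 'k, ((nat \<Rightarrow> 'k) \<Rightarrow> 'k) tens) gbimod"

definition coord_bimod :: "nat \<Rightarrow> (nat \<Rightarrow> 'k::field_char_0) set \<Rightarrow> 'k weyl_bimod" where
  "coord_bimod n X = transport Elt (coord_ring n X)"

definition left_variety :: "nat \<Rightarrow> 'k::field_char_0 weyl_bimod \<Rightarrow> (nat \<Rightarrow> 'k) set" where
  "left_variety n B = {x \<in> weyl_union n. \<forall>f \<in> carrier (R_bar n).
     (\<forall>b \<in> carrier B. smult B f b = \<zero>\<^bsub>B\<^esub>) \<longrightarrow> f x = 0}"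

definition right_variety :: "nat \<Rightarrow> 'k::field_char_0 weyl_bimod \<Rightarrow> (nat \<Rightarrow> 'k) set" where
  "right_variety n B = {x \<in> weyl_union n. \<forall>f \<in> carrier (R_bar n).
     (\<forall>b \<in> carrier B. rsmult B b f = \<zero>\<^bsub>B\<^esub>) \<longrightarrow> f x = 0}"

definition star :: "nat \<Rightarrow> 'k::field_char_0 weyl_bimod \<Rightarrow> 'k weyl_bimod \<Rightarrow> 'k weyl_bimod" where
  "star n B B' =
     tensor (carrier (R_bar n))
       (tensor (carrier (R_bar n)) B (coord_bimod n (right_variety n B \<inter> left_variety n B')))
       B'"

definition B_simple :: "nat \<Rightarrow> nat \<Rightarrow> 'k::field_char_0 weyl_bimod" where
  "B_simple n i =
     tensor (invariants n i)
       (coord_bimod n (transverse_union n (simple_refl i)))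
       (coord_bimod n (transverse_union n (simple_refl i)))"

text \<open>A sequence \<open>i\<^sub>k \<cdots> i\<^sub>1\<close> is the list whose head is \<open>i\<^sub>k\<close>.\<close>

fun B_seq :: "nat \<Rightarrow> nat list \<Rightarrow> 'k::field_char_0 weyl_bimod" where
  "B_seq n [i] = B_simple n i"
| "B_seq n (i # j # js) = star n (B_simple n i) (B_seq n (j # js))"

inductive associated :: "nat \<Rightarrow> nat list \<Rightarrow> 'k::field_char_0 weyl_bimod \<Rightarrow> bool" for n where
  single: "associated n [i] (B_simple n i)"
| product: "associated n u B \<Longrightarrow> associated n v B' \<Longrightarrow> associated n (u @ v) (star n B B')"

text \<open>
  Freeness over \<open>\<O>(W)\<close> for \<open>W \<subseteq> Z\<close>: the action of \<open>\<O>(Z)\<close> is the pullback, along restriction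
  of functions, of an \<open>\<O>(W)\<close>-module structure on the same abelian group, and this module is free.
\<close>

definition left_free_over :: "nat \<Rightarrow> (nat \<Rightarrow> 'k::field_char_0) set \<Rightarrow> 'k weyl_bimod \<Rightarrow> bool" where
  "left_free_over n W B \<longleftrightarrow>
     (\<exists>act. (\<forall>f \<in> carrier (R_bar n). \<forall>b \<in> carrier B. smult B f b = act (restr W f) b) \<and>
        free_module (coord_ring n W) (B\<lparr>smult := act\<rparr>))"

definition right_free_over :: "nat \<Rightarrow> (nat \<Rightarrow> 'k::field_char_0) set \<Rightarrow> 'k weyl_bimod \<Rightarrow> bool" where
  "right_free_over n W B \<longleftrightarrow> left_free_over n W (swap_sides B)"

end

theory Submission
  imports "HOL-Library.Function_Algebras" "HOL-Computational_Algebra.Polynomial" Defs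
begin

text \<open>
  Away from the origin, \<open>Z\<close> consists of the vectors of coordinate sum zero that take exactly two values,
  and \<open>s\<^sub>i\<close> acts on them by exchanging two entries. A folded path for a sequence \<open>w\<close> is a list of such
  vectors, one more than \<open>w\<close> has letters, in which neighbours around a letter \<open>i\<close> are not fixed by \<open>s\<^sub>i\<close>
  and are equal or exchanged by \<open>s\<^sub>i\<close>. The polynomial functions in the coordinates of all vectors of
  a path form a graded bimodule \<open>path_bimod n w\<close>, on which functions on \<open>Z\<close> act through the first and
  through the last vector. The first vectors of the paths are the nonzero points of \<open>W_seq n w\<close>.

  Both claims follow once every bimodule associated to \<open>w\<close> is isomorphic to \<open>path_bimod n w\<close>
  (\<open>associated_iso\<close>). For a product this says that the tensor product of function modules is the
  function module on a fibre product: a path for \<open>u @ v\<close> is a path for \<open>u\<close> followed by a path for \<open>v\<close>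
  that starts where the first one ends. The evaluation map of the tensor product onto functions on
  the fibre product is onto, and it is injective as soon as one factor is generated over the functions
  of the common point by a finite family that is linearly independent at every single common point
  (\<open>kernel_left_basis\<close>, \<open>kernel_right_basis\<close>, \<open>tensor_iso\<close>).

  Such families are found by induction on \<open>w\<close> (\<open>left_basis_exists\<close>). The variety of \<open>w\<close> always consists of
  the lines that separate the pairs of some partial matching of the coordinates (\<open>starts_separated\<close>).
  Therefore the part of it that is transverse to \<open>s\<^sub>i\<close> is either stable under \<open>s\<^sub>i\<close>, or \<open>\<alpha>\<^sub>i\<close> agrees on
  it with an \<open>s\<^sub>i\<close>-invariant linear form (\<open>stable_or_invariant\<close>). In the first case a further factor \<open>B\<^sub>i\<close>
  doubles the family, by \<open>1\<close> and \<open>\<alpha>\<^sub>i\<close>; in the second case the family stays the same, over a larger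
  variety. The families also prove freeness on the left (\<open>left_free\<close>), and reversing paths gives
  freeness on the right.

  Independence at single points is only available away from the origin, so it matters that no variety
  degenerates to the origin: the vector whose values alternate between odd and even coordinates
  is transverse to every \<open>s\<^sub>i\<close> and lies in the varieties of all sequences.
\<close>

section \<open>The vectors on Weyl lines\<close>

definition two_valued :: "nat \<Rightarrow> (nat \<Rightarrow> 'k::field_char_0) set" where
  "two_valued n =
     {x \<in> geom_rep n. x \<noteq> (\<lambda>_. 0) \<and> (\<exists>p q. \<forall>j \<in> {1..n + 1}. x j = p \<or> x j = q)}"

lemma two_valuedD:
  assumes "x \<in> two_valued n" "a \<in> {1..n + 1}" "b \<in> {1..n + 1}" "c \<in> {1..n + 1}" "x a \<noteq> x b"
  shows "x c = x a \<or> x c = x b"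
proof -
  obtain p q where "\<forall>j \<in> {1..n + 1}. x j = p \<or> x j = q"
    using assms(1) by (auto simp: two_valued_def)
  then have "x a = p \<or> x a = q" "x b = p \<or> x b = q" "x c = p \<or> x c = q"
    using assms(2-4) by blast+
  then show ?thesis using assms(5) by auto
qed

lemma geom_rep_constant_zero:
  assumes "x \<in> geom_rep n" "\<And>j. j \<in> {1..n + 1} \<Longrightarrow> x j = m"
  shows "x = (\<lambda>_. 0)"
proof -
  have "(\<Sum>j = 1..n + 1. x j) = of_nat (n + 1) * m"
    using assms(2) by simp
  then have "of_nat (n + 1) * m = 0"
    using assms(1) by (simp add: geom_rep_def)
  then have "m = 0"
    by (simp del: of_nat_add of_nat_Suc)
  then show ?thesis
    using assms by (auto simp: geom_rep_def)
qed

lemma perm_act_transpose: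
  "perm_act (Transposition.transpose a b) x = x \<circ> Transposition.transpose a b"
  by (simp add: perm_act_def)

text \<open>
  The hyperplanes that contain a line \<open>k v\<close> are those of the transpositions of equal entries of \<open>v\<close>;
  they cut out the vectors that are constant on the level sets of \<open>v\<close>. With coordinate sum zero
  these form a space of dimension one less than the number of values of \<open>v\<close>.
\<close>

lemma weyl_line_iff:
  "weyl_line n L \<longleftrightarrow> (\<exists>v \<in> two_valued n. L = {\<lambda>j. c * v j | c. True})"
  (is "?l \<longleftrightarrow> ?r")
proof
  assume ?l
  then obtain v A where v: "v \<in> geom_rep n" "v \<noteq> (\<lambda>_. 0)" "L = {\<lambda>j. c * v j | c. True}"
    and A: "A \<subseteq> reflections n" "L = geom_rep n \<inter> (\<Inter>t\<in>A. refl_hyperplane n t)"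
    by (auto simp: weyl_line_def)
  have vL: "v \<in> L" unfolding v(3) by (rule CollectI, rule exI[of _ 1]) auto
  have "\<exists>p q. \<forall>j \<in> {1..n + 1}. v j = p \<or> v j = q"
  proof (rule ccontr)
    assume neg: "\<not> ?thesis"
    define a where "a = (1::nat)"
    have a: "a \<in> {1..n + 1}" by (simp add: a_def)
    from neg obtain b where b: "b \<in> {1..n + 1}" "v b \<noteq> v a" by blast
    from neg obtain c where c: "c \<in> {1..n + 1}" "v c \<noteq> v a" "v c \<noteq> v b" by blast
    \<comment> \<open>Applying a function to the entries of \<open>v\<close> keeps them fixed by every reflection that fixes \<open>v\<close>.
      The indicator of one value gives, after centring, a vector of \<open>L\<close> that takes equal values at
      \<open>b\<close> and \<open>c\<close> and another one at \<open>a\<close>, so it is not a multiple of \<open>v\<close>.\<close>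
    define g where "g j = (if v j = v a then 1 else 0 :: 'a)" for j
    define m where "m = (\<Sum>j = 1..n + 1. g j) / of_nat (n + 1)"
    define y where "y j = (if j \<in> {1..n + 1} then g j - m else 0)" for j
    have "(\<Sum>j = 1..n + 1. y j) = (\<Sum>j = 1..n + 1. g j) - of_nat (n + 1) * m"
      by (simp add: y_def sum_subtractf)
    also have "\<dots> = 0"
      unfolding m_def by (simp del: of_nat_add of_nat_Suc sum.cl_ivl_Suc)
    finally have y: "y \<in> geom_rep n" by (auto simp: geom_rep_def y_def)
    have "y \<in> refl_hyperplane n t" if "t \<in> A" for t
    proof -
      from that A(1) obtain i j where ij: "t = Transposition.transpose i j" "1 \<le> i" "i < j" "j \<le> n + 1"
        by (auto simp: reflections_def)
      have "v \<in> refl_hyperplane n t" using vL A(2) that by blast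
      then have "v \<circ> Transposition.transpose i j = v"
        by (simp add: refl_hyperplane_def ij perm_act_transpose)
      then have "v i = v j" by (metis comp_apply transpose_apply_first)
      then have "y i = y j" using ij by (simp add: y_def g_def)
      then have "y \<circ> Transposition.transpose i j = y"
        by (auto simp: fun_eq_iff transpose_def)
      then show ?thesis using y by (simp add: refl_hyperplane_def ij perm_act_transpose)
    qed
    then have "y \<in> L" using A(2) y by blast
    then obtain d where d: "y = (\<lambda>j. d * v j)" using v(3) by auto
    have e: "1 - m = d * v a" "- m = d * v b" "- m = d * v c"
      using fun_cong[OF d, of a] fun_cong[OF d, of b] fun_cong[OF d, of c] a b c
      by (auto simp: y_def g_def)
    then have "d * v b = d * v c" by metis
    then have "d = 0" using c(3) by (metis mult_cancel_left)
    with e show False by simp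
  qed
  then show ?r using v by (auto simp: two_valued_def)
next
  assume ?r
  then obtain v where v: "v \<in> two_valued n" "L = {\<lambda>j. c * v j | c. True}" by blast
  have vg: "v \<in> geom_rep n" "v \<noteq> (\<lambda>_. 0)" using v by (auto simp: two_valued_def)
  define A where "A = {t \<in> reflections n. v \<in> refl_hyperplane n t}"
  have "L \<subseteq> geom_rep n \<inter> (\<Inter>t\<in>A. refl_hyperplane n t)"
  proof
    fix y assume "y \<in> L"
    then obtain c where c: "y = (\<lambda>j. c * v j)" using v by auto
    have y: "y \<in> geom_rep n"
      using vg unfolding c geom_rep_def
      by (auto simp flip: sum_distrib_left simp del: sum.cl_ivl_Suc)
    then show "y \<in> geom_rep n \<inter> (\<Inter>t\<in>A. refl_hyperplane n t)"
      by (auto simp: A_def refl_hyperplane_def c perm_act_def fun_eq_iff)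
  qed
  moreover have "y \<in> L" if y: "y \<in> geom_rep n \<inter> (\<Inter>t\<in>A. refl_hyperplane n t)" for y
  proof -
    obtain a b where ab: "a \<in> {1..n + 1}" "b \<in> {1..n + 1}" "v a \<noteq> v b"
      using geom_rep_constant_zero[OF vg(1), of "v 1"] vg(2) by auto
    have const: "y i = y j" if "i \<in> {1..n + 1}" "j \<in> {1..n + 1}" "v i = v j" "i < j" for i j
    proof -
      let ?t = "Transposition.transpose i j"
      have "v \<circ> ?t = v" using that by (auto simp: fun_eq_iff transpose_def)
      then have "?t \<in> A"
        using that vg by (auto simp: A_def reflections_def refl_hyperplane_def perm_act_transpose)
      then have "y \<circ> ?t = y"
        using y by (auto simp: refl_hyperplane_def perm_act_transpose)
      then show ?thesis by (metis comp_apply transpose_apply_first)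
    qed
    have const: "y i = y j" if "i \<in> {1..n + 1}" "j \<in> {1..n + 1}" "v i = v j" for i j
      using const[OF that(1,2,3)] const[OF that(2,1) that(3)[symmetric]]
      by (metis linorder_neqE_nat)
    \<comment> \<open>The factor is chosen to make \<open>y - c v\<close> constant across the two blocks of \<open>v\<close>.\<close>
    define c where "c = (y a - y b) / (v a - v b)"
    define z where "z j = y j - c * v j" for j
    have zab: "z a = z b"
    proof -
      have "c * (v a - v b) = y a - y b" using ab by (simp add: c_def)
      then show ?thesis by (simp add: z_def algebra_simps)
    qed
    have "z \<in> geom_rep n"
      using y vg by (auto simp: geom_rep_def z_def sum_subtractf simp flip: sum_distrib_left
          simp del: sum.cl_ivl_Suc)
    moreover have "z j = z a" if "j \<in> {1..n + 1}" for j
    proof -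
      have "v j = v a \<or> v j = v b" using two_valuedD[OF v(1) ab(1,2) that ab(3)] .
      then consider "v j = v a" | "v j = v b" by blast
      then show ?thesis
      proof cases
        case 1 then show ?thesis using const[OF that ab(1) 1] by (simp add: z_def)
      next
        case 2
        then have "z j = z b" using const[OF that ab(2) 2] by (simp add: z_def)
        then show ?thesis using zab by simp
      qed
    qed
    ultimately have "z = (\<lambda>_. 0)" by (rule geom_rep_constant_zero)
    then have "y = (\<lambda>j. c * v j)" by (simp add: z_def fun_eq_iff)
    then show ?thesis using v(2) by auto
  qed
  ultimately have "L = geom_rep n \<inter> (\<Inter>t\<in>A. refl_hyperplane n t)" by blast
  moreover have "A \<subseteq> reflections n" by (auto simp: A_def)
  ultimately show ?l using v vg unfolding weyl_line_def by blast
qed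

lemma two_valued_scale:
  assumes "x \<in> two_valued n" "c \<noteq> 0"
  shows "(\<lambda>j. c * x j) \<in> two_valued n"
proof -
  have x: "x \<in> geom_rep n" "x \<noteq> (\<lambda>_. 0)" using assms by (auto simp: two_valued_def)
  obtain p q where "\<forall>j \<in> {1..n + 1}. x j = p \<or> x j = q" using assms by (auto simp: two_valued_def)
  then have "\<forall>j \<in> {1..n + 1}. c * x j = c * p \<or> c * x j = c * q" by auto
  then have "\<exists>p q. \<forall>j \<in> {1..n + 1}. c * x j = p \<or> c * x j = q" by blast
  moreover have "(\<lambda>j. c * x j) \<in> geom_rep n"
    using x(1) by (simp add: geom_rep_def flip: sum_distrib_left del: sum.cl_ivl_Suc)
  moreover have "(\<lambda>j. c * x j) \<noteq> (\<lambda>_. 0)" using x(2) assms(2) by (auto simp: fun_eq_iff)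
  ultimately show ?thesis unfolding two_valued_def by blast
qed

abbreviation simple_act :: "nat \<Rightarrow> (nat \<Rightarrow> 'k) \<Rightarrow> nat \<Rightarrow> 'k" where
  "simple_act i \<equiv> perm_act (simple_refl i)"

lemma simple_act_apply: "simple_act i x j = x (Transposition.transpose i (Suc i) j)"
  by (simp add: simple_refl_def perm_act_transpose)

lemma simple_act_i [simp]: "simple_act i x i = x (Suc i)"
  and simple_act_Suc [simp]: "simple_act i x (Suc i) = x i"
  and simple_act_other: "j \<noteq> i \<Longrightarrow> j \<noteq> Suc i \<Longrightarrow> simple_act i x j = x j"
  and simple_act_simple_act [simp]: "simple_act i (simple_act i x) = x"
  by (auto simp: simple_act_apply fun_eq_iff transpose_def)

lemma simple_act_scale: "simple_act i (\<lambda>j. c * x j) = (\<lambda>j. c * simple_act i x j)"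
  by (simp add: simple_act_apply fun_eq_iff)

lemma two_valued_simple_act:
  assumes "x \<in> two_valued n" "i \<in> {1..n}"
  shows "simple_act i x \<in> two_valued n"
proof -
  let ?t = "Transposition.transpose i (Suc i)"
  have t: "?t j \<in> {1..n + 1} \<longleftrightarrow> j \<in> {1..n + 1}" for j
    using assms(2) by (auto simp: transpose_def)
  have "bij_betw ?t {1..n + 1} {1..n + 1}"
    by (rule bij_betwI[where g = ?t]) (use t in auto)
  then have "(\<Sum>j = 1..n + 1. simple_act i x j) = (\<Sum>j = 1..n + 1. x j)"
    unfolding simple_act_apply by (rule sum.reindex_bij_betw)
  moreover obtain p q where "\<forall>j \<in> {1..n + 1}. x j = p \<or> x j = q"
    using assms by (auto simp: two_valued_def)
  then have "\<forall>j \<in> {1..n + 1}. simple_act i x j = p \<or> simple_act i x j = q"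
    unfolding simple_act_apply using t by blast
  moreover have "simple_act i x \<noteq> (\<lambda>_. 0)"
  proof
    assume *: "simple_act i x = (\<lambda>_. 0)"
    have "simple_act i (simple_act i x) = (\<lambda>_. 0)" unfolding * by (simp add: simple_act_apply fun_eq_iff)
    then show False using assms by (simp add: two_valued_def)
  qed
  moreover have "simple_act i x j = 0" if "j \<notin> {1..n + 1}" for j
    using assms(1) t[of j] that unfolding simple_act_apply two_valued_def geom_rep_def by blast
  moreover have "(\<Sum>j = 1..n + 1. x j) = 0" using assms(1) by (simp add: two_valued_def geom_rep_def)
  ultimately have "simple_act i x \<in> geom_rep n" "\<exists>p q. \<forall>j \<in> {1..n + 1}. simple_act i x j = p \<or> simple_act i x j = q"
    "simple_act i x \<noteq> (\<lambda>_. 0)"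
    unfolding geom_rep_def by auto
  then show ?thesis unfolding two_valued_def by blast
qed

lemma alternating_point:
  assumes "n \<ge> 1"
  obtains x :: "nat \<Rightarrow> 'k::field_char_0"
  where "x \<in> two_valued n" "\<And>i. i \<in> {1..n} \<Longrightarrow> x i \<noteq> x (Suc i)"
proof -
  define E where "E = {j \<in> {1..n + 1}. even j}"
  define O' where "O' = {j \<in> {1..n + 1}. odd j}"
  define p :: 'k where "p = of_nat (card E)"
  define q :: 'k where "q = - of_nat (card O')"
  define x where "x j = (if j \<in> O' then p else if j \<in> E then q else 0)" for j
  have fin: "finite E" "finite O'" by (auto simp: E_def O'_def)
  have "2 \<in> E" "1 \<in> O'" using assms by (auto simp: E_def O'_def)
  then have pos: "card E > 0" "card O' > 0" using fin by (auto simp: card_gt_0_iff)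
  have pq: "p \<noteq> q"
  proof
    assume "p = q"
    then have "of_nat (card E + card O') = (0 :: 'k)" by (simp add: p_def q_def)
    then show False using pos by (simp only: of_nat_eq_0_iff)
  qed
  have un: "{1..n + 1} = O' \<union> E" and dis: "O' \<inter> E = {}" by (auto simp: E_def O'_def)
  have "(\<Sum>j = 1..n + 1. x j) = (\<Sum>j \<in> O'. x j) + (\<Sum>j \<in> E. x j)"
    unfolding un using fin dis by (simp add: sum.union_disjoint)
  also have "(\<Sum>j \<in> O'. x j) = of_nat (card O') * p" by (simp add: x_def)
  also have "(\<Sum>j \<in> E. x j) = (\<Sum>j \<in> E. q)"
    by (rule sum.cong) (use dis in \<open>auto simp: x_def\<close>)
  also have "of_nat (card O') * p + (\<Sum>j \<in> E. q) = 0" by (simp add: p_def q_def)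
  finally have "(\<Sum>j = 1..n + 1. x j) = 0" .
  moreover have "x j = 0" if "j \<notin> {1..n + 1}" for j using that unfolding un by (simp add: x_def)
  ultimately have "x \<in> geom_rep n" unfolding geom_rep_def by blast
  moreover have "x 1 \<noteq> 0" using \<open>1 \<in> O'\<close> pos by (simp add: x_def p_def)
  then have "x \<noteq> (\<lambda>_. 0)" by auto
  moreover have "\<forall>j \<in> {1..n + 1}. x j = p \<or> x j = q" unfolding un by (auto simp: x_def)
  ultimately have "x \<in> two_valued n"
    unfolding two_valued_def by blast
  moreover have "x i \<noteq> x (Suc i)" if "i \<in> {1..n}" for i
    using that pq by (auto simp: x_def O'_def E_def)
  ultimately show ?thesis using that by blast
qed

lemma scalar_multiples:
  fixes S :: "(nat \<Rightarrow> 'k::field_char_0) set"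
  assumes "x \<in> S" "\<And>v c. v \<in> S \<Longrightarrow> c \<noteq> 0 \<Longrightarrow> (\<lambda>j. c * v j) \<in> S"
  shows "{\<lambda>j. c * v j | c v. v \<in> S} = insert (\<lambda>_. 0) S" (is "?A = ?B")
proof
  have "(\<lambda>j. c * v j) \<in> ?B" if "v \<in> S" for c v
    using assms(2)[OF that, of c] by (cases "c = 0") auto
  then show "?A \<subseteq> ?B" by (intro subsetI) (elim CollectE exE conjE, simp only:)
  have "(\<lambda>_. 0) \<in> ?A" by (intro CollectI exI[of _ 0] exI[of _ x] conjI) (use assms(1) in auto)
  moreover have "y \<in> ?A" if "y \<in> S" for y
    by (intro CollectI exI[of _ 1] exI[of _ y] conjI) (use that in auto)
  ultimately show "?B \<subseteq> ?A" by (intro subsetI) (elim insertE, simp_all only:)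
qed

lemma weyl_union_eq:
  assumes "n \<ge> 1"
  shows "weyl_union n = insert (\<lambda>_. 0) (two_valued n :: (nat \<Rightarrow> 'k::field_char_0) set)"
proof -
  obtain x :: "nat \<Rightarrow> 'k" where x: "x \<in> two_valued n" using alternating_point[OF assms] by metis
  define line :: "(nat \<Rightarrow> 'k) \<Rightarrow> (nat \<Rightarrow> 'k) set" where "line v = {\<lambda>j. c * v j | c. True}" for v
  have "{L. weyl_line n L} = line ` two_valued n"
    unfolding weyl_line_iff line_def[symmetric] by auto
  then have "weyl_union n = (\<Union>v \<in> two_valued n. line v)"
    unfolding weyl_union_def by simp
  also have "\<dots> = {\<lambda>j. c * v j | c v. v \<in> two_valued n}"
    unfolding line_def by auto
  also have "\<dots> = insert (\<lambda>_. 0) (two_valued n)"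
    by (rule scalar_multiples[OF x two_valued_scale])
  finally show ?thesis .
qed

lemma transverse_union_eq:
  assumes "i \<in> {1..n}"
  shows "transverse_union n (simple_refl i) =
    insert (\<lambda>_. 0) {x \<in> two_valued n. x i \<noteq> (x (Suc i) :: 'k::field_char_0)}"
proof -
  have n: "n \<ge> 1" using assms by auto
  obtain x :: "nat \<Rightarrow> 'k" where x: "x \<in> two_valued n" "x i \<noteq> x (Suc i)"
    using alternating_point[OF n] assms by metis
  have tr: "{\<lambda>j. c * v j | c. True} \<subseteq> refl_hyperplane n (simple_refl i) \<longleftrightarrow> v i = v (Suc i)"
    if "v \<in> two_valued n" for v :: "nat \<Rightarrow> 'k"
  proof
    assume *: "{\<lambda>j. c * v j | c. True} \<subseteq> refl_hyperplane n (simple_refl i)"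
    have "(\<lambda>j. 1 * v j) \<in> {\<lambda>j. c * v j | c. True}" by blast
    then have "v \<in> refl_hyperplane n (simple_refl i)" using * by auto
    then have "simple_act i v = v" by (simp add: refl_hyperplane_def)
    then show "v i = v (Suc i)" by (metis simple_act_i)
  next
    assume *: "v i = v (Suc i)"
    then have "simple_act i v = v" by (auto simp: fun_eq_iff simple_act_apply transpose_def)
    moreover have "(\<lambda>j. c * v j) \<in> geom_rep n" for c
      using that two_valued_scale[OF that, of c]
      by (cases "c = 0") (auto simp: two_valued_def geom_rep_def)
    ultimately show "{\<lambda>j. c * v j | c. True} \<subseteq> refl_hyperplane n (simple_refl i)"
      by (auto simp: refl_hyperplane_def simple_act_scale)
  qed
  define line :: "(nat \<Rightarrow> 'k) \<Rightarrow> (nat \<Rightarrow> 'k) set" where "line v = {\<lambda>j. c * v j | c. True}" for v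
  have "{L. weyl_line n L \<and> \<not> L \<subseteq> refl_hyperplane n (simple_refl i)}
      = line ` {v \<in> two_valued n. v i \<noteq> v (Suc i)}"
    unfolding weyl_line_iff line_def[symmetric] using tr[folded line_def] by auto
  then have "transverse_union n (simple_refl i) = (\<Union>v \<in> {v \<in> two_valued n. v i \<noteq> v (Suc i)}. line v)"
    unfolding transverse_union_def by simp
  also have "\<dots> = {\<lambda>j. c * v j | c v. v \<in> {v \<in> two_valued n. v i \<noteq> v (Suc i)}}"
    unfolding line_def by auto
  also have "\<dots> = insert (\<lambda>_. 0) {x \<in> two_valued n. x i \<noteq> (x (Suc i) :: 'k)}"
    by (rule scalar_multiples[of x]) (use x two_valued_scale in auto)
  finally show ?thesis .
qed

section \<open>Folded paths and their starting points\<close>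

definition fold_step :: "nat \<Rightarrow> (nat \<Rightarrow> 'k) \<Rightarrow> (nat \<Rightarrow> 'k) \<Rightarrow> bool" where
  "fold_step i x y \<longleftrightarrow> x i \<noteq> x (Suc i) \<and> (y = x \<or> y = simple_act i x)"

lemma fold_step_sym: "fold_step i x y \<longleftrightarrow> fold_step i y x"
  by (auto simp: fold_step_def)

text \<open>
  Paths avoid the origin. A polynomial function on a union of lines is determined away from the
  origin, and away from it a point and its image under a folding step are different, which
  independence of a basis along paths relies on.
\<close>

definition fold_paths :: "nat \<Rightarrow> nat list \<Rightarrow> (nat \<Rightarrow> 'k::field_char_0) list set" where
  "fold_paths n w = {P. length P = Suc (length w) \<and> set P \<subseteq> two_valued n \<and>
     (\<forall>l < length w. fold_step (w ! l) (P ! l) (P ! Suc l))}"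

lemma fold_paths_Nil: "fold_paths n [] = {[x] | x. x \<in> two_valued n}"
  by (auto simp: fold_paths_def length_Suc_conv)

lemma fold_paths_Cons:
  "x # P \<in> fold_paths n (i # w) \<longleftrightarrow>
     P \<in> fold_paths n w \<and> x \<in> two_valued n \<and> fold_step i x (hd P)"
  by (cases P) (auto simp: fold_paths_def All_less_Suc2)

lemma fold_paths_nonempty: "P \<in> fold_paths n w \<Longrightarrow> P \<noteq> []"
  by (auto simp: fold_paths_def)

lemma fold_paths_rev: "P \<in> fold_paths n w \<Longrightarrow> rev P \<in> fold_paths n (rev w)"
proof -
  assume P: "P \<in> fold_paths n w"
  have "fold_step (rev w ! l) (rev P ! l) (rev P ! Suc l)" if "l < length w" for l
  proof -
    let ?m = "length w - Suc l"
    have "fold_step (w ! ?m) (P ! ?m) (P ! Suc ?m)"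
      using P that by (simp add: fold_paths_def)
    moreover have "rev w ! l = w ! ?m" "rev P ! Suc l = P ! ?m" "rev P ! l = P ! Suc ?m"
      using P that by (auto simp: fold_paths_def rev_nth Suc_diff_Suc)
    ultimately show ?thesis by (simp add: fold_step_sym)
  qed
  then show ?thesis using P by (simp add: fold_paths_def)
qed

lemma fold_paths_append:
  assumes "P \<in> fold_paths n (u @ v)"
  shows "take (Suc (length u)) P \<in> fold_paths n u" "drop (length u) P \<in> fold_paths n v"
    "last (take (Suc (length u)) P) = hd (drop (length u) P)"
proof -
  have P: "length P = Suc (length u + length v)" "set P \<subseteq> two_valued n"
    "\<And>l. l < length u + length v \<Longrightarrow> fold_step ((u @ v) ! l) (P ! l) (P ! Suc l)"
    using assms by (auto simp: fold_paths_def)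
  have "fold_step (u ! l) (P ! l) (P ! Suc l)" if "l < length u" for l
    using P(3)[of l] that by (simp add: nth_append)
  then show "take (Suc (length u)) P \<in> fold_paths n u"
    using P(1,2) set_take_subset[of "Suc (length u)" P] by (auto simp: fold_paths_def)
  have "fold_step (v ! l) (P ! (length u + l)) (P ! Suc (length u + l))" if "l < length v" for l
    using P(3)[of "length u + l"] that by (simp add: nth_append)
  then show "drop (length u) P \<in> fold_paths n v"
    using P(1,2) set_drop_subset[of "length u" P] by (auto simp: fold_paths_def)
  show "last (take (Suc (length u)) P) = hd (drop (length u) P)"
    using P(1) by (simp add: take_Suc_conv_app_nth hd_drop_conv_nth)
qed

lemma fold_paths_join:
  assumes "P \<in> fold_paths n u" "Q \<in> fold_paths n v" "last P = hd Q"
  shows "P @ tl Q \<in> fold_paths n (u @ v)" "take (Suc (length u)) (P @ tl Q) = P"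
    "drop (length u) (P @ tl Q) = Q"
proof -
  have P: "length P = Suc (length u)" and Q: "length Q = Suc (length v)"
    using assms by (auto simp: fold_paths_def)
  show t: "take (Suc (length u)) (P @ tl Q) = P" using P by simp
  have "drop (length u) P = [last P]"
    using P by (cases P rule: rev_cases) auto
  then show d: "drop (length u) (P @ tl Q) = Q"
    using P Q assms(3) by (cases Q) auto
  have "fold_step ((u @ v) ! l) ((P @ tl Q) ! l) ((P @ tl Q) ! Suc l)"
    if l: "l < length u + length v" for l
  proof (cases "l < length u")
    case True
    then show ?thesis using assms(1) P by (auto simp: fold_paths_def nth_append)
  next
    case False
    define m where "m = l - length u"
    have m: "l = length u + m" "m < length v" using False l by (auto simp: m_def)
    have "(P @ tl Q) ! (length u + k) = Q ! k" for k
      by (metis d nth_drop P le_add1 length_append lessI less_imp_le_nat trans_le_add1)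
    from this[of m] this[of "Suc m"] show ?thesis
      using assms(2) m by (simp add: fold_paths_def nth_append)
  qed
  moreover have "set (tl Q) \<subseteq> two_valued n"
    using assms(2) Q by (cases Q) (auto simp: fold_paths_def)
  ultimately show "P @ tl Q \<in> fold_paths n (u @ v)"
    using assms P Q by (auto simp: fold_paths_def)
qed

lemma fold_paths_scale:
  assumes "P \<in> fold_paths n w" "c \<noteq> 0"
  shows "map (\<lambda>x j. c * x j) P \<in> fold_paths n w"
  using assms two_valued_scale[of _ n c] unfolding fold_paths_def
  by (auto simp: fold_step_def simple_act_scale)

definition starts :: "nat \<Rightarrow> nat list \<Rightarrow> (nat \<Rightarrow> 'k::field_char_0) set" where
  "starts n w = hd ` fold_paths n w"

lemma starts_subset: "starts n w \<subseteq> two_valued n"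
  unfolding starts_def by (auto simp: fold_paths_def length_Suc_conv)

lemma starts_Nil: "starts n [] = two_valued n"
  by (auto simp: starts_def fold_paths_Nil image_def)

text \<open>
  Unfolding one step reproduces the recursion of \<open>W_seq\<close>, since the part of a variety transverse to
  \<open>s\<^sub>i\<close> may equally be taken before or after applying \<open>s\<^sub>i\<close>.
\<close>

lemma starts_Cons:
  assumes "i \<in> {1..n}"
  shows "starts n (i # w) =
    {x \<in> two_valued n. x i \<noteq> x (Suc i) \<and> (x \<in> starts n w \<or> simple_act i x \<in> starts n w)}"
  (is "?l = ?r")
proof
  show "?l \<subseteq> ?r"
  proof
    fix x assume "x \<in> ?l"
    then obtain R where R: "x = hd R" "R \<in> fold_paths n (i # w)" by (auto simp: starts_def)
    then obtain P where "R = x # P" using fold_paths_nonempty by (metis list.collapse)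
    with R have *: "P \<in> fold_paths n w" "x \<in> two_valued n" "fold_step i x (hd P)"
      by (auto simp: fold_paths_Cons)
    then show "x \<in> ?r" by (auto simp: starts_def fold_step_def intro: rev_image_eqI)
  qed
  show "?r \<subseteq> ?l"
  proof
    fix x assume x: "x \<in> ?r"
    then obtain P where P: "P \<in> fold_paths n w" "hd P = x \<or> hd P = simple_act i x"
      unfolding starts_def by force
    then have "x # P \<in> fold_paths n (i # w)" using x by (auto simp: fold_paths_Cons fold_step_def)
    then show "x \<in> ?l" unfolding starts_def by (metis imageI list.sel(1))
  qed
qed

lemma ends_eq_starts_rev: "last ` fold_paths n w = starts n (rev w)"
proof
  show "last ` fold_paths n w \<subseteq> starts n (rev w)"
    using fold_paths_rev unfolding starts_def by (force simp: hd_rev intro: rev_image_eqI)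
  show "starts n (rev w) \<subseteq> last ` fold_paths n w"
    using fold_paths_rev[of _ n "rev w"] unfolding starts_def
    by (force simp: last_rev intro: rev_image_eqI)
qed

lemma starts_scale: "x \<in> starts n w \<Longrightarrow> c \<noteq> 0 \<Longrightarrow> (\<lambda>j. c * x j) \<in> starts n w"
proof -
  assume "x \<in> starts n w" "c \<noteq> 0"
  then obtain P where P: "P \<in> fold_paths n w" "x = hd P" by (auto simp: starts_def)
  then have "hd (map (\<lambda>x j. c * x j) P) = (\<lambda>j. c * x j)"
    using fold_paths_nonempty[OF P(1)] by (simp add: hd_map)
  then show ?thesis
    using fold_paths_scale[OF P(1) \<open>c \<noteq> 0\<close>] unfolding starts_def by (metis imageI)
qed

lemma alternating_in_starts:
  assumes "x \<in> two_valued n" "\<And>i. i \<in> {1..n} \<Longrightarrow> x i \<noteq> x (Suc i)" "set w \<subseteq> {1..n}"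
  shows "x \<in> starts n w"
  using assms(3) by (induction w) (use assms(1,2) in \<open>auto simp: starts_Nil starts_Cons\<close>)

lemma W_seq_eq:
  assumes "w \<noteq> []" "set w \<subseteq> {1..n}"
  shows "W_seq n w = insert (\<lambda>_. 0) (starts n w :: (nat \<Rightarrow> 'k::field_char_0) set)"
  using assms
proof (induction w rule: induct_list012)
  case (2 i)
  then have i: "i \<in> {1..n}" by simp
  show ?case using two_valued_simple_act[OF _ i]
    by (auto simp: transverse_union_eq[OF i] starts_Cons[OF i] starts_Nil)
next
  case (3 i j js)
  then have i: "i \<in> {1..n}" by simp
  have IH: "W_seq n (j # js) = insert (\<lambda>_. 0) (starts n (j # js) :: (nat \<Rightarrow> 'k) set)"
    using "3.IH"(2) "3.prems" by simp
  have zero: "simple_act i (\<lambda>_. 0) = (\<lambda>_. 0)" by (simp add: simple_act_apply fun_eq_iff)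
  have img: "x \<in> simple_act i ` S \<longleftrightarrow> simple_act i x \<in> S" for x :: "nat \<Rightarrow> 'k" and S
    by (metis image_iff simple_act_simple_act)
  have *: "x \<in> W_seq n (i # j # js) \<longleftrightarrow> x \<in> insert (\<lambda>_. 0) (starts n (i # j # js))" for x :: "nat \<Rightarrow> 'k"
  proof (cases "x = (\<lambda>_. 0)")
    case True
    then show ?thesis
      by (simp only: W_seq.simps IH transverse_union_eq[OF i]) simp
  next
    case False
    then have "simple_act i x \<noteq> (\<lambda>_. 0)" using zero simple_act_simple_act by metis
    with False show ?thesis
      by (simp only: W_seq.simps IH transverse_union_eq[OF i] starts_Cons[OF i] Un_iff Int_iff img) simp
  qed
  show ?case by (rule Set.set_eqI) (rule *)
qed simp

section \<open>Separated pairs\<close>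

definition matching :: "nat \<Rightarrow> (nat \<times> nat) set \<Rightarrow> bool" where
  "matching n M \<longleftrightarrow> M \<subseteq> {1..n + 1} \<times> {1..n + 1} \<and> irrefl M \<and> sym M \<and> single_valued M"

definition separated :: "nat \<Rightarrow> (nat \<times> nat) set \<Rightarrow> (nat \<Rightarrow> 'k::field_char_0) set" where
  "separated n M = {x \<in> two_valued n. \<forall>(a, b) \<in> M. x a \<noteq> x b}"

text \<open>
  For the matchings of sequences this is multiplication of Temperley-Lieb diagrams, of which only the
  upper half is recorded: after stacking the generator of \<open>i\<close> on top, \<open>i\<close> and \<open>i + 1\<close> become matched, and their old partners, if both exist, are
  matched with each other.
\<close>

definition cup :: "nat \<Rightarrow> (nat \<times> nat) set \<Rightarrow> (nat \<times> nat) set" where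
  "cup i M = {(i, Suc i), (Suc i, i)} \<union>
     {(a, b). a \<notin> {i, Suc i} \<and> b \<notin> {i, Suc i} \<and>
        ((a, b) \<in> M \<or> (a, i) \<in> M \<and> (b, Suc i) \<in> M \<or> (a, Suc i) \<in> M \<and> (b, i) \<in> M)}"

lemma matching_cup:
  assumes "matching n M" "i \<in> {1..n}"
  shows "matching n (cup i M)"
proof -
  have sub: "M \<subseteq> {1..n + 1} \<times> {1..n + 1}" and s: "\<And>a b. (a, b) \<in> M \<Longrightarrow> (b, a) \<in> M"
    and v: "\<And>a b c. (a, b) \<in> M \<Longrightarrow> (a, c) \<in> M \<Longrightarrow> b = c"
    using assms by (auto simp: matching_def sym_def single_valued_def)
  show ?thesis
    unfolding matching_def
  proof (intro conjI)
    show "cup i M \<subseteq> {1..n + 1} \<times> {1..n + 1}"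
      using sub assms(2) by (auto simp: cup_def)
    show "irrefl (cup i M)"
      using assms(1) v[of _ i "Suc i"] by (auto simp: cup_def irrefl_def matching_def)
    show "sym (cup i M)" using s by (auto simp: cup_def sym_def)
    show "single_valued (cup i M)"
    proof (rule single_valuedI)
      fix a b c assume b: "(a, b) \<in> cup i M" and c: "(a, c) \<in> cup i M"
      show "b = c"
      proof (cases "a \<in> {i, Suc i}")
        case True
        then show ?thesis using b c by (auto simp: cup_def)
      next
        case False
        have v': "b = c" if "(b, d) \<in> M" "(c, d) \<in> M" for b c d using s v that by blast
        from False b c have nb: "b \<notin> {i, Suc i}" "c \<notin> {i, Suc i}" by (auto simp: cup_def)
        from False b have "(a, b) \<in> M \<or> (a, i) \<in> M \<and> (b, Suc i) \<in> M \<or> (a, Suc i) \<in> M \<and> (b, i) \<in> M"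
          by (auto simp: cup_def)
        moreover from False c have "(a, c) \<in> M \<or> (a, i) \<in> M \<and> (c, Suc i) \<in> M \<or> (a, Suc i) \<in> M \<and> (c, i) \<in> M"
          by (auto simp: cup_def)
        moreover have "\<not> ((a, i) \<in> M \<and> (a, Suc i) \<in> M)" using v[of a i "Suc i"] by auto
        ultimately show ?thesis
          using nb v[of a b c] v[of a b i] v[of a b "Suc i"] v[of a c i] v[of a c "Suc i"]
            v'[of b i c] v'[of b "Suc i" c] by auto
      qed
    qed
  qed
qed

text \<open>
  With only two values available, being different from both of two different values is impossible.
  So for \<open>x\<^sub>i \<noteq> x\<^bsub>i+1\<^esub>\<close> the entry at a partner of \<open>i\<close> or \<open>i + 1\<close> is forced, and \<open>x\<close> or its reflection
  separates the old pairs precisely when \<open>x\<close> separates the pairs of the stacked matching.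
\<close>

lemma starts_separated:
  assumes "set w \<subseteq> {1..n}"
  shows "\<exists>M. matching n M \<and> starts n w = (separated n M :: (nat \<Rightarrow> 'k::field_char_0) set)"
  using assms
proof (induction w)
  case Nil
  have "matching n {}" by (auto simp: matching_def sym_def irrefl_def)
  moreover have "starts n [] = (separated n {} :: (nat \<Rightarrow> 'k) set)"
    by (simp add: starts_Nil separated_def)
  ultimately show ?case by blast
next
  case (Cons i w)
  then obtain M where M: "matching n M" "starts n w = (separated n M :: (nat \<Rightarrow> 'k) set)" by auto
  have i: "i \<in> {1..n}" using Cons by simp
  then have i': "i \<in> {1..n + 1}" "Suc i \<in> {1..n + 1}" by auto
  have sub: "\<And>a b. (a, b) \<in> M \<Longrightarrow> a \<in> {1..n + 1} \<and> b \<in> {1..n + 1}"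
    and s: "\<And>a b. (a, b) \<in> M \<Longrightarrow> (b, a) \<in> M"
    and v: "\<And>a b c. (a, b) \<in> M \<Longrightarrow> (a, c) \<in> M \<Longrightarrow> b = c"
    and ir: "\<And>a. (a, a) \<notin> M"
    using M(1) by (auto simp: matching_def sym_def single_valued_def irrefl_def)
  have "x \<in> starts n (i # w) \<longleftrightarrow> x \<in> separated n (cup i M)" if x: "x \<in> two_valued n"
    and xi: "x i \<noteq> x (Suc i)" for x :: "nat \<Rightarrow> 'k"
  proof -
    have two: "x a = x i \<or> x a = x (Suc i)" if "a \<in> {1..n + 1}" for a
      using two_valuedD[OF x i' that xi] .
    have act: "simple_act i x \<in> two_valued n" using two_valued_simple_act[OF x i] .
    have st: "x \<in> starts n (i # w) \<longleftrightarrow>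
        (\<forall>(a, b) \<in> M. x a \<noteq> x b) \<or> (\<forall>(a, b) \<in> M. simple_act i x a \<noteq> simple_act i x b)"
      using x xi act by (simp add: starts_Cons[OF i] M(2) separated_def)
    show ?thesis
    proof
      assume "x \<in> starts n (i # w)"
      then consider "\<And>a b. (a, b) \<in> M \<Longrightarrow> x a \<noteq> x b"
        | "\<And>a b. (a, b) \<in> M \<Longrightarrow> simple_act i x a \<noteq> simple_act i x b"
        unfolding st by auto
      then have "x a \<noteq> x b" if "(a, b) \<in> cup i M" for a b
      proof cases
        case 1
        then show ?thesis
          using that xi two[of a] two[of b] sub[of a b] sub[of a i] sub[of a "Suc i"] sub[of b i] sub[of b "Suc i"]
            1[of a b] 1[of a i] 1[of a "Suc i"] 1[of b i] 1[of b "Suc i"]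
          unfolding cup_def by auto
      next
        case 2
        have e: "a \<noteq> i \<Longrightarrow> a \<noteq> Suc i \<Longrightarrow> (a, i) \<in> M \<Longrightarrow> x a \<noteq> x (Suc i)"
          "a \<noteq> i \<Longrightarrow> a \<noteq> Suc i \<Longrightarrow> (a, Suc i) \<in> M \<Longrightarrow> x a \<noteq> x i" for a
          using 2[of a i] 2[of a "Suc i"] by (auto simp: simple_act_other)
        show ?thesis
          using that xi 2[of a b] e[of a] e[of b] two[of a] two[of b] sub[of a i] sub[of a "Suc i"] sub[of b i] sub[of b "Suc i"]
          unfolding cup_def by (auto simp: simple_act_other)
      qed
      then show "x \<in> separated n (cup i M)" using x by (auto simp: separated_def)
    next
      assume "x \<in> separated n (cup i M)"
      then have c: "\<And>a b. (a, b) \<in> cup i M \<Longrightarrow> x a \<noteq> x b" by (auto simp: separated_def)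
      have c0: "x a \<noteq> x b" if "(a, b) \<in> M" "a \<notin> {i, Suc i}" "b \<notin> {i, Suc i}" for a b
        using c[of a b] that by (auto simp: cup_def)
      have c1: "x a \<noteq> x b" if "(a, i) \<in> M" "(b, Suc i) \<in> M" "a \<notin> {i, Suc i}" "b \<notin> {i, Suc i}" for a b
        using c[of a b] that by (auto simp: cup_def)
      \<comment> \<open>A partner of \<open>i\<close> or \<open>i + 1\<close> decides whether \<open>x\<close> itself or its image under \<open>s\<^sub>i\<close>
        separates the pairs of \<open>M\<close>. If both have partners they agree, since \<open>cup\<close> joins these.\<close>
      define good where "good \<longleftrightarrow> (\<forall>a. a \<notin> {i, Suc i} \<longrightarrow>
        ((a, i) \<in> M \<longrightarrow> x a = x (Suc i)) \<and> ((a, Suc i) \<in> M \<longrightarrow> x a = x i))"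
      define bad where "bad \<longleftrightarrow> (\<forall>a. a \<notin> {i, Suc i} \<longrightarrow>
        ((a, i) \<in> M \<longrightarrow> x a = x i) \<and> ((a, Suc i) \<in> M \<longrightarrow> x a = x (Suc i)))"
      have uniq: "a = b" if "(a, d) \<in> M" "(b, d) \<in> M" for a b d using v s that by blast
      have "good \<or> bad"
      proof (rule ccontr)
        assume "\<not> (good \<or> bad)"
        then obtain a b where a: "a \<notin> {i, Suc i}"
            "(a, i) \<in> M \<and> x a \<noteq> x (Suc i) \<or> (a, Suc i) \<in> M \<and> x a \<noteq> x i"
          and b: "b \<notin> {i, Suc i}"
            "(b, i) \<in> M \<and> x b \<noteq> x i \<or> (b, Suc i) \<in> M \<and> x b \<noteq> x (Suc i)"
          unfolding good_def bad_def by blast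
        have ab: "a \<in> {1..n + 1}" "b \<in> {1..n + 1}"
          using sub[of a i] sub[of a "Suc i"] sub[of b i] sub[of b "Suc i"] a(2) b(2) by argo+
        from a(2) have a': "(a, i) \<in> M \<and> x a = x i \<or> (a, Suc i) \<in> M \<and> x a = x (Suc i)"
          using two[OF ab(1)] by argo
        from b(2) have b': "(b, i) \<in> M \<and> x b = x (Suc i) \<or> (b, Suc i) \<in> M \<and> x b = x i"
          using two[OF ab(2)] by argo
        from a' show False
        proof (elim disjE conjE)
          assume *: "(a, i) \<in> M" "x a = x i"
          from b' show False
          proof (elim disjE conjE)
            assume "(b, i) \<in> M" "x b = x (Suc i)"
            then show False using uniq[OF *(1), of b] * xi by simp
          next
            assume "(b, Suc i) \<in> M" "x b = x i"
            then show False using c1[OF *(1) _ a(1) b(1)] * by simp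
          qed
        next
          assume *: "(a, Suc i) \<in> M" "x a = x (Suc i)"
          from b' show False
          proof (elim disjE conjE)
            assume "(b, i) \<in> M" "x b = x (Suc i)"
            then show False using c1[OF _ *(1) b(1) a(1)] * by simp
          next
            assume "(b, Suc i) \<in> M" "x b = x i"
            then show False using uniq[OF *(1), of b] * xi by simp
          qed
        qed
      qed
      then show "x \<in> starts n (i # w)"
      proof
        assume good
        then have g: "c \<notin> {i, Suc i} \<Longrightarrow> (c, i) \<in> M \<Longrightarrow> x c = x (Suc i)"
          "c \<notin> {i, Suc i} \<Longrightarrow> (c, Suc i) \<in> M \<Longrightarrow> x c = x i" for c
          unfolding good_def by blast+
        have "x a \<noteq> x b" if "(a, b) \<in> M" for a b
          using that s[OF that] c0[OF that] g[of a] g[of b] ir[of a] xi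
          by (cases "a \<in> {i, Suc i}"; cases "b \<in> {i, Suc i}") auto
        then show ?thesis unfolding st by blast
      next
        assume bad
        then have g: "c \<notin> {i, Suc i} \<Longrightarrow> (c, i) \<in> M \<Longrightarrow> x c = x i"
          "c \<notin> {i, Suc i} \<Longrightarrow> (c, Suc i) \<in> M \<Longrightarrow> x c = x (Suc i)" for c
          unfolding bad_def by blast+
        have "simple_act i x a \<noteq> simple_act i x b" if "(a, b) \<in> M" for a b
          using that s[OF that] c0[OF that] g[of a] g[of b] ir[of a] xi
          by (cases "a \<in> {i, Suc i}"; cases "b \<in> {i, Suc i}") (auto simp: simple_act_other)
        then show ?thesis unfolding st by blast
      qed
    qed
  qed
  moreover have "x \<in> separated n (cup i M) \<Longrightarrow> x \<in> two_valued n \<and> x i \<noteq> x (Suc i)" 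
    "x \<in> starts n (i # w) \<Longrightarrow> x \<in> two_valued n \<and> x i \<noteq> x (Suc i)" for x :: "nat \<Rightarrow> 'k"
    by (auto simp: separated_def cup_def starts_Cons[OF i])
  ultimately have "starts n (i # w) = (separated n (cup i M) :: (nat \<Rightarrow> 'k) set)" by blast
  then show ?case using matching_cup[OF M(1) i] by blast
qed

text \<open>
  If neither \<open>i\<close> nor \<open>i + 1\<close> is matched outside \<open>{i, i + 1}\<close>, exchanging them preserves the separated pairs.
  Otherwise a partner \<open>a\<close> carries one of the values \<open>x\<^sub>i\<close>, \<open>x\<^bsub>i+1\<^esub>\<close>, namely the one
  that differs from the value at its partner, so \<open>\<alpha>\<^sub>i\<close> is, up to sign, \<open>x\<^sub>i + x\<^bsub>i+1\<^esub> - 2 x\<^sub>a\<close>.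
\<close>

lemma stable_or_invariant:
  assumes "set w \<subseteq> {1..n}" "i \<in> {1..n}"
  defines "Y \<equiv> {x \<in> starts n w. x i \<noteq> (x (Suc i) :: 'k::field_char_0)}"
  obtains "\<And>x. x \<in> Y \<Longrightarrow> simple_act i x \<in> Y"
  | a e where "a \<in> {1..n + 1}" "a \<notin> {i, Suc i}" "e = 1 \<or> e = -1"
      "\<And>x. x \<in> Y \<Longrightarrow> x i - x (Suc i) = e * (x i + x (Suc i) - 2 * x a)"
proof -
  obtain M where M: "matching n M" "starts n w = (separated n M :: (nat \<Rightarrow> 'k) set)"
    using starts_separated[OF assms(1)] by blast
  have i': "i \<in> {1..n + 1}" "Suc i \<in> {1..n + 1}" using assms(2) by auto
  have sub: "\<And>a b. (a, b) \<in> M \<Longrightarrow> a \<in> {1..n + 1} \<and> b \<in> {1..n + 1}"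
    and s: "\<And>a b. (a, b) \<in> M \<Longrightarrow> (b, a) \<in> M"
    using M(1) by (auto simp: matching_def sym_def)
  have Y: "x \<in> Y \<longleftrightarrow> x \<in> two_valued n \<and> x i \<noteq> x (Suc i) \<and> (\<forall>(a, b) \<in> M. x a \<noteq> x b)" for x
    by (auto simp: Y_def M separated_def)
  show ?thesis
  proof (cases "\<exists>a. a \<notin> {i, Suc i} \<and> ((a, i) \<in> M \<or> (a, Suc i) \<in> M)")
    case True
    then obtain a where a: "a \<notin> {i, Suc i}" "(a, i) \<in> M \<or> (a, Suc i) \<in> M" by blast
    have an: "a \<in> {1..n + 1}" using sub a by blast
    show ?thesis
    proof (cases "(a, i) \<in> M")
      case True
      have *: "x i - x (Suc i) = 1 * (x i + x (Suc i) - 2 * x a)" if x: "x \<in> Y" for x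
      proof -
        have "x a \<noteq> x i" using x True unfolding Y by blast
        then have "x a = x (Suc i)" using x two_valuedD[OF _ i' an, of x] unfolding Y by blast
        then show ?thesis by simp
      qed
      show ?thesis by (rule that(2)[OF an a(1) _ *]) auto
    next
      case False
      have *: "x i - x (Suc i) = -1 * (x i + x (Suc i) - 2 * x a)" if x: "x \<in> Y" for x
      proof -
        have "x a \<noteq> x (Suc i)" using x False a unfolding Y by blast
        then have "x a = x i" using x two_valuedD[OF _ i' an, of x] unfolding Y by blast
        then show ?thesis by simp
      qed
      show ?thesis by (rule that(2)[OF an a(1) _ *]) auto
    qed
  next
    case False
    have "simple_act i x \<in> Y" if x: "x \<in> Y" for x
    proof -
      have "simple_act i x a \<noteq> simple_act i x b" if ab: "(a, b) \<in> M" for a b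
      proof -
        have "x a \<noteq> x b" using x ab unfolding Y by blast
        moreover have N: "(c, i) \<notin> M" "(c, Suc i) \<notin> M" if "c \<notin> {i, Suc i}" for c
          using False that by blast+
        have "a \<in> {i, Suc i} \<longleftrightarrow> b \<in> {i, Suc i}" using N[of a] N[of b] ab s[OF ab] by auto
        ultimately show ?thesis
          by (cases "a \<in> {i, Suc i}") (force simp: simple_act_other)+
      qed
      moreover have "simple_act i x \<in> two_valued n"
        using two_valued_simple_act[OF _ assms(2), of x] x unfolding Y by blast
      ultimately show ?thesis using x unfolding Y by auto
    qed
    then show ?thesis by (rule that(1))
  qed
qed

section \<open>Polynomials in a family of functions\<close>

text \<open>
  The recursion of \<open>homog_poly\<close> with an arbitrary set of functions as coordinates. This allows paths,
  with the entries of all their vectors as coordinates, to be treated like vectors.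
\<close>

inductive hpoly :: "('p \<Rightarrow> 'k::field_char_0) set \<Rightarrow> nat \<Rightarrow> ('p \<Rightarrow> 'k) \<Rightarrow> bool" for X where
  const: "hpoly X 0 (\<lambda>_. c)"
| coord: "hpoly X d f \<Longrightarrow> x \<in> X \<Longrightarrow> hpoly X (Suc d) (\<lambda>p. x p * f p)"
| add: "hpoly X d f \<Longrightarrow> hpoly X d g \<Longrightarrow> hpoly X d (\<lambda>p. f p + g p)"

inductive_set polys :: "('p \<Rightarrow> 'k::field_char_0) set \<Rightarrow> ('p \<Rightarrow> 'k) set" for X where
  homog: "hpoly X d f \<Longrightarrow> f \<in> polys X"
| add: "f \<in> polys X \<Longrightarrow> g \<in> polys X \<Longrightarrow> (\<lambda>p. f p + g p) \<in> polys X"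

definition coords :: "nat \<Rightarrow> ((nat \<Rightarrow> 'k::field_char_0) \<Rightarrow> 'k) set" where
  "coords n = {\<lambda>x. x j | j. j \<in> {1..n + 1}}"

lemma coordsI: "j \<in> {1..n + 1} \<Longrightarrow> (\<lambda>x. x j) \<in> coords n"
  by (auto simp: coords_def)

lemma homog_poly_eq: "homog_poly n = hpoly (coords n)"
proof (intro ext iffI)
  fix d f
  show "hpoly (coords n) d f" if "homog_poly n d f"
    using that by induction (simp_all only: hpoly.intros coordsI)
  show "homog_poly n d f" if "hpoly (coords n) d f"
    using that by induction (auto intro: homog_poly.intros simp: coords_def)
qed

lemma poly_fun_eq: "poly_fun n = polys (coords n)"
proof (intro equalityI subsetI)
  fix f
  show "f \<in> polys (coords n)" if "f \<in> poly_fun n"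
    using that by induction (auto intro: polys.intros simp: homog_poly_eq)
  show "f \<in> poly_fun n" if "f \<in> polys (coords n)"
    using that by induction (auto intro: poly_fun.intros simp: homog_poly_eq)
qed

lemma hpoly_cmult: "hpoly X d f \<Longrightarrow> hpoly X d (\<lambda>p. c * f p)"
proof (induction rule: hpoly.induct)
  case (const c')
  show ?case using hpoly.const[of X "c * c'"] by simp
next
  case (coord d f x)
  from hpoly.coord[OF coord.IH coord.hyps(2)] show ?case by (simp add: mult.left_commute)
next
  case (add d f g)
  from hpoly.add[OF add.IH] show ?case by (simp add: distrib_left)
qed

lemma hpoly_mult:
  assumes "hpoly X d f" "hpoly X e g"
  shows "hpoly X (d + e) (\<lambda>p. f p * g p)"
  using assms(1)
proof (induction rule: hpoly.induct)
  case (const c)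
  show ?case using hpoly_cmult[OF assms(2), of c] by simp
next
  case (coord d f x)
  from hpoly.coord[OF coord.IH coord.hyps(2)] show ?case by (simp add: mult.assoc)
next
  case (add d f g)
  from hpoly.add[OF add.IH] show ?case by (simp add: distrib_right)
qed

lemma hpoly_zero: "X \<noteq> {} \<Longrightarrow> hpoly X d (\<lambda>_. 0)"
proof (induction d)
  case 0 show ?case by (rule hpoly.const)
next
  case (Suc d)
  then obtain x where "x \<in> X" by auto
  from hpoly.coord[OF Suc.IH[OF Suc.prems] this] show ?case by simp
qed

lemma hpoly_subst:
  assumes "hpoly X d f" "\<And>x. x \<in> X \<Longrightarrow> \<exists>y \<in> Y. \<forall>p \<in> D. x (\<pi> p) = y p"
  shows "\<exists>g. hpoly Y d g \<and> (\<forall>p \<in> D. f (\<pi> p) = g p)"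
  using assms(1)
proof (induction rule: hpoly.induct)
  case (const c)
  show ?case by (rule exI[of _ "\<lambda>_. c"]) (simp add: hpoly.const)
next
  case (coord d f x)
  then obtain g where g: "hpoly Y d g" "\<forall>p \<in> D. f (\<pi> p) = g p" by blast
  obtain y where y: "y \<in> Y" "\<forall>p \<in> D. x (\<pi> p) = y p" using assms(2)[OF coord.hyps(2)] by blast
  show ?case
    by (rule exI[of _ "\<lambda>p. y p * g p"]) (use g y hpoly.coord[OF g(1) y(1)] in simp)
next
  case (add d f g)
  then obtain f' g' where "hpoly Y d f'" "\<forall>p \<in> D. f (\<pi> p) = f' p"
    "hpoly Y d g'" "\<forall>p \<in> D. g (\<pi> p) = g' p" by blast
  then show ?case
    by (intro exI[of _ "\<lambda>p. f' p + g' p"]) (simp add: hpoly.add)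
qed

lemma polys_const: "(\<lambda>_. c) \<in> polys X"
  by (rule polys.homog[OF hpoly.const])

lemma polys_coord: "x \<in> X \<Longrightarrow> x \<in> polys X"
  using polys.homog[OF hpoly.coord[OF hpoly.const[of X 1]], of x] by simp

lemma polys_mult:
  assumes "f \<in> polys X" "g \<in> polys X"
  shows "(\<lambda>p. f p * g p) \<in> polys X"
  using assms(1)
proof induction
  case (homog d f)
  from assms(2) show ?case
  proof induction
    case (homog e g)
    show ?case by (rule polys.homog[OF hpoly_mult]) fact+
  next
    case (add g h)
    from polys.add[OF add.IH] show ?case by (simp add: distrib_left)
  qed
next
  case (add f h)
  from polys.add[OF add.IH] show ?case by (simp add: distrib_right)
qed

lemma polys_cmult: "f \<in> polys X \<Longrightarrow> (\<lambda>p. c * f p) \<in> polys X"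
  by (rule polys_mult[OF polys_const])

lemma polys_diff: "f \<in> polys X \<Longrightarrow> g \<in> polys X \<Longrightarrow> (\<lambda>p. f p - g p) \<in> polys X"
proof -
  assume "f \<in> polys X" "g \<in> polys X"
  from polys.add[OF this(1) polys_cmult[OF this(2), of "-1"]] show ?thesis by simp
qed

lemma polys_prod: "finite A \<Longrightarrow> (\<And>a. a \<in> A \<Longrightarrow> f a \<in> polys X) \<Longrightarrow> (\<lambda>p. \<Prod>a\<in>A. f a p) \<in> polys X"
  by (induction A rule: finite_induct) (simp_all add: polys_const polys_mult)

lemma polys_subst:
  assumes "f \<in> polys X" "\<And>x. x \<in> X \<Longrightarrow> \<exists>y \<in> Y. \<forall>p \<in> D. x (\<pi> p) = y p"
  shows "\<exists>g \<in> polys Y. \<forall>p \<in> D. f (\<pi> p) = g p"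
  using assms(1)
proof induction
  case (homog d f)
  then obtain g where "hpoly Y d g" "\<forall>p \<in> D. f (\<pi> p) = g p"
    using hpoly_subst[where \<pi> = \<pi> and D = D and Y = Y, OF homog assms(2)] by blast
  then show ?case by (intro bexI[of _ g]) (simp_all add: polys.homog)
next
  case (add f g)
  then obtain f' g' where "f' \<in> polys Y" "\<forall>p \<in> D. f (\<pi> p) = f' p"
    "g' \<in> polys Y" "\<forall>p \<in> D. g (\<pi> p) = g' p" by blast
  then show ?case
    by (intro bexI[of _ "\<lambda>p. f' p + g' p"]) (simp_all add: polys.add)
qed

text \<open>
  All homogeneous parts beyond the degree of \<open>f\<close> are zero. This needs a coordinate: without one, the
  zero function has degree \<open>0\<close> only.
\<close>

lemma polys_homogeneous_parts:
  assumes "f \<in> polys X" "X \<noteq> {}"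
  shows "\<exists>N g. (\<forall>d. hpoly X d (g d)) \<and> (\<forall>d \<ge> N. g d = (\<lambda>_. 0)) \<and> f = (\<lambda>p. \<Sum>d<N. g d p)"
  using assms(1)
proof induction
  case (homog e f)
  let ?g = "\<lambda>d. if d = e then f else (\<lambda>_. 0)"
  have "f = (\<lambda>p. \<Sum>d<Suc e. ?g d p)"
    by (simp add: if_distrib[of "\<lambda>h. h _"])
  then show ?case
    using homog hpoly_zero[OF assms(2)] by (intro exI[of _ "Suc e"] exI[of _ ?g]) auto
next
  case (add f1 f2)
  obtain N g where g: "\<forall>d. hpoly X d (g d)" "\<forall>d \<ge> N. g d = (\<lambda>_. 0)" "f1 = (\<lambda>p. \<Sum>d<N. g d p)"
    using add.IH(1) by blast
  obtain M h where h: "\<forall>d. hpoly X d (h d)" "\<forall>d \<ge> M. h d = (\<lambda>_. 0)" "f2 = (\<lambda>p. \<Sum>d<M. h d p)"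
    using add.IH(2) by blast
  have ext: "(\<Sum>d<N. g d p) = (\<Sum>d<max N M. g d p)" "(\<Sum>d<M. h d p) = (\<Sum>d<max N M. h d p)" for p
    by (rule sum.mono_neutral_left; use g(2) h(2) in auto)+
  have "(\<lambda>p. f1 p + f2 p) = (\<lambda>p. \<Sum>d<max N M. g d p + h d p)"
    by (simp add: g(3) h(3) ext sum.distrib)
  moreover have "\<forall>d. hpoly X d (\<lambda>p. g d p + h d p)" using g(1) h(1) by (simp add: hpoly.add)
  moreover have "\<forall>d \<ge> max N M. (\<lambda>p. g d p + h d p) = (\<lambda>_. 0)" using g(2) h(2) by simp
  ultimately show ?case
    by (intro exI[of _ "max N M"] exI[of _ "\<lambda>d p. g d p + h d p"]) blast
qed

lemma hpoly_scale:
  assumes "hpoly X d f" "\<And>x. x \<in> X \<Longrightarrow> x q = c * x p"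
  shows "f q = c ^ d * f p"
  using assms(1) by induction (auto simp: assms(2) algebra_simps)

lemma poly_of_infinite_zero:
  fixes q :: "'a::field_char_0 poly"
  assumes "\<And>c. c \<noteq> 0 \<Longrightarrow> poly q c = 0"
  shows "q = 0"
proof (rule ccontr)
  assume "q \<noteq> 0"
  then have "finite {c. poly q c = 0}" by (rule poly_roots_finite)
  moreover have "- {0} \<subseteq> {c. poly q c = 0}" using assms by auto
  ultimately have "finite (- {0 :: 'a})" by (rule rev_finite_subset)
  then show False by (simp add: Compl_eq_Diff_UNIV infinite_UNIV_char_0)
qed

text \<open>
  Along a line a polynomial function is a polynomial in the scalar, which has only finitely many
  zeros unless it vanishes.
\<close>

lemma polys_coords_vanish_at_zero:
  assumes f: "f \<in> polys (coords n)" and z: "\<And>c. c \<noteq> 0 \<Longrightarrow> f (\<lambda>j. c * x j) = 0"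
  shows "f (\<lambda>_. 0) = 0"
proof -
  have h: "\<exists>q. \<forall>c. f (\<lambda>j. c * x j) = poly q c" if "hpoly (coords n) d f" for d f
    using that
  proof induction
    case (const c)
    show ?case by (rule exI[of _ "[:c:]"]) simp
  next
    case (coord d f y)
    then obtain q where "\<forall>c. f (\<lambda>j. c * x j) = poly q c" by blast
    moreover obtain j where "y = (\<lambda>x. x j)" using coord.hyps by (auto simp: coords_def)
    ultimately show ?case by (intro exI[of _ "[:0, x j:] * q"]) simp
  next
    case (add d f g)
    then obtain q r where "\<forall>c. f (\<lambda>j. c * x j) = poly q c" "\<forall>c. g (\<lambda>j. c * x j) = poly r c" by blast
    then show ?case by (intro exI[of _ "q + r"]) simp
  qed
  from f have "\<exists>q. \<forall>c. f (\<lambda>j. c * x j) = poly q c"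
  proof induction
    case (homog d f)
    then show ?case by (rule h)
  next
    case (add f g)
    then obtain q r where "\<forall>c. f (\<lambda>j. c * x j) = poly q c" "\<forall>c. g (\<lambda>j. c * x j) = poly r c" by blast
    then show ?case by (intro exI[of _ "q + r"]) simp
  qed
  then obtain q where q: "\<And>c. f (\<lambda>j. c * x j) = poly q c" by blast
  then have "q = 0" using z by (intro poly_of_infinite_zero) metis
  then show ?thesis using q[of 0] by simp
qed

text \<open>
  The convention of \<open>restr\<close>, extension by zero, for points of any type.
\<close>

definition ext0 :: "'p set \<Rightarrow> ('p \<Rightarrow> 'k::zero) \<Rightarrow> 'p \<Rightarrow> 'k" where
  "ext0 D f = (\<lambda>p. if p \<in> D then f p else 0)"

lemma restr_eq: "restr = ext0"
  by (simp add: restr_def ext0_def fun_eq_iff)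

lemma ext0_in: "p \<in> D \<Longrightarrow> ext0 D f p = f p" and ext0_out: "p \<notin> D \<Longrightarrow> ext0 D f p = 0"
  by (auto simp: ext0_def)

lemma ext0_cong: "(\<And>p. p \<in> D \<Longrightarrow> f p = g p) \<Longrightarrow> ext0 D f = ext0 D g"
  by (auto simp: ext0_def)

section \<open>Graded bimodules of functions\<close>

text \<open>
  Functions on \<open>D\<close> act on the left through \<open>l\<close> and on the right through \<open>r\<close>. The multiplication and unit
  fields are left unspecified, as in the other bimodules that are not rings.
\<close>

definition fun_bimod :: "('p \<Rightarrow> 'k::field_char_0) set \<Rightarrow> 'p set \<Rightarrow> ('p \<Rightarrow> nat \<Rightarrow> 'k) \<Rightarrow>
    ('p \<Rightarrow> nat \<Rightarrow> 'k) \<Rightarrow> ((nat \<Rightarrow> 'k) \<Rightarrow> 'k, 'p \<Rightarrow> 'k) gbimod" where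
  "fun_bimod X D l r =
     \<lparr>carrier = ext0 D ` polys X, monoid.mult = undefined, monoid.one = undefined,
      ring.zero = (\<lambda>_. 0), ring.add = (\<lambda>f g p. f p + g p),
      smult = (\<lambda>s f p. s (l p) * f p), rsmult = (\<lambda>f s p. s (r p) * f p),
      hcomp = (\<lambda>m. {\<lambda>_. 0} \<union> {ext0 D f | f d. m = 2 * int d \<and> hpoly X d f})\<rparr>"

lemma fun_bimod_simps [simp]:
  "carrier (fun_bimod X D l r) = ext0 D ` polys X"
  "ring.zero (fun_bimod X D l r) = (\<lambda>_. 0)"
  "ring.add (fun_bimod X D l r) f g = (\<lambda>p. f p + g p)"
  "smult (fun_bimod X D l r) s f = (\<lambda>p. s (l p) * f p)"
  "rsmult (fun_bimod X D l r) f s = (\<lambda>p. s (r p) * f p)"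
  "hcomp (fun_bimod X D l r) m = {\<lambda>_. 0} \<union> {ext0 D f | f d. m = 2 * int d \<and> hpoly X d f}"
  by (simp_all add: fun_bimod_def)

lemma swap_sides_simps [simp]:
  "carrier (swap_sides M) = carrier M" "ring.zero (swap_sides M) = ring.zero M"
  "ring.add (swap_sides M) = ring.add M" "hcomp (swap_sides M) = hcomp M"
  "smult (swap_sides M) = (\<lambda>s m. rsmult M m s)" "rsmult (swap_sides M) = (\<lambda>m s. smult M s m)"
  by (simp_all add: swap_sides_def)

lemma swap_sides_fun_bimod: "swap_sides (fun_bimod X D l r) = fun_bimod X D r l"
  by (simp add: swap_sides_def fun_bimod_def)

lemma ext0_polys_closed:
  assumes "f \<in> ext0 D ` polys X" "g \<in> ext0 D ` polys X"
  shows "(\<lambda>p. f p + g p) \<in> ext0 D ` polys X" "(\<lambda>p. f p - g p) \<in> ext0 D ` polys X"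
    "(\<lambda>p. f p * g p) \<in> ext0 D ` polys X" "(\<lambda>p. c * f p) \<in> ext0 D ` polys X"
proof -
  obtain f' g' where f: "f' \<in> polys X" "f = ext0 D f'" and g: "g' \<in> polys X" "g = ext0 D g'"
    using assms by blast
  have eqs: "(\<lambda>p. f p + g p) = ext0 D (\<lambda>p. f' p + g' p)" "(\<lambda>p. f p - g p) = ext0 D (\<lambda>p. f' p - g' p)"
    "(\<lambda>p. f p * g p) = ext0 D (\<lambda>p. f' p * g' p)" "(\<lambda>p. c * f p) = ext0 D (\<lambda>p. c * f' p)"
    by (auto simp: f g ext0_def)
  show "(\<lambda>p. f p + g p) \<in> ext0 D ` polys X" "(\<lambda>p. f p - g p) \<in> ext0 D ` polys X"
    "(\<lambda>p. f p * g p) \<in> ext0 D ` polys X" "(\<lambda>p. c * f p) \<in> ext0 D ` polys X"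
    unfolding eqs
    by (rule imageI, (rule polys.add polys_diff polys_mult polys_cmult; rule f(1) g(1)))+
qed

lemma ext0_zero [simp]: "ext0 D (\<lambda>_. 0) = (\<lambda>_. 0)"
  by (simp add: ext0_def)

lemma zero_in_ext0_polys: "(\<lambda>_. 0) \<in> ext0 D ` polys X"
  using imageI[OF polys_const[of 0 X], of "ext0 D"] by simp

lemma abelian_group_fun_bimod: "abelian_group (fun_bimod X D l r)"
proof (rule abelian_groupI)
  fix f assume f: "f \<in> carrier (fun_bimod X D l r)"
  then have "(\<lambda>p. -1 * f p) \<in> ext0 D ` polys X" by (intro ext0_polys_closed) auto
  then show "\<exists>g \<in> carrier (fun_bimod X D l r). g \<oplus>\<^bsub>fun_bimod X D l r\<^esub> f = \<zero>\<^bsub>fun_bimod X D l r\<^esub>"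
    by (intro bexI[of _ "\<lambda>p. -1 * f p"]) auto
qed (auto simp: ext0_polys_closed zero_in_ext0_polys add_ac)

lemma coord_ring_simps [simp]:
  "carrier (coord_ring n X) = ext0 X ` polys (coords n)"
  "ring.zero (coord_ring n X) = (\<lambda>_. 0)" "monoid.one (coord_ring n X) = ext0 X (\<lambda>_. 1)"
  "ring.add (coord_ring n X) f g = (\<lambda>p. f p + g p)"
  "monoid.mult (coord_ring n X) f g = (\<lambda>p. f p * g p)"
  "smult (coord_ring n X) s f = (\<lambda>p. s p * f p)"
  "rsmult (coord_ring n X) f s = (\<lambda>p. f p * s p)"
  "hcomp (coord_ring n X) m = {\<lambda>_. 0} \<union> {ext0 X f | f d. m = 2 * int d \<and> hpoly (coords n) d f}"
  by (simp_all add: coord_ring_def poly_fun_eq homog_poly_eq restr_eq)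

lemma cring_coord_ring: "cring (coord_ring n X)"
proof (rule cringI)
  show "abelian_group (coord_ring n X)"
  proof (rule abelian_groupI)
    fix f assume f: "f \<in> carrier (coord_ring n X)"
    then have "(\<lambda>p. -1 * f p) \<in> ext0 X ` polys (coords n)" by (intro ext0_polys_closed) auto
    then show "\<exists>g \<in> carrier (coord_ring n X). g \<oplus>\<^bsub>coord_ring n X\<^esub> f = \<zero>\<^bsub>coord_ring n X\<^esub>"
      by (intro bexI[of _ "\<lambda>p. -1 * f p"]) auto
  qed (auto simp: ext0_polys_closed zero_in_ext0_polys add_ac)
  show "comm_monoid (coord_ring n X)"
  proof (rule comm_monoidI)
    fix f assume "f \<in> carrier (coord_ring n X)"
    then show "\<one>\<^bsub>coord_ring n X\<^esub> \<otimes>\<^bsub>coord_ring n X\<^esub> f = f"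
      by (auto simp: ext0_def)
  qed (simp_all add: ext0_polys_closed polys_const mult_ac)
qed (auto simp: distrib_right)

lemma finsum_fun_bimod:
  assumes "finite A" "\<And>a. a \<in> A \<Longrightarrow> g a \<in> carrier (fun_bimod X D l r)"
  shows "finsum (fun_bimod X D l r) g A = (\<lambda>p. \<Sum>a\<in>A. g a p)"
  using assms
proof (induction A rule: finite_induct)
  case empty
  interpret abelian_group "fun_bimod X D l r" by (rule abelian_group_fun_bimod)
  show ?case by simp
next
  case (insert a A)
  interpret abelian_group "fun_bimod X D l r" by (rule abelian_group_fun_bimod)
  have "g \<in> A \<rightarrow> carrier (fun_bimod X D l r)" using insert.prems by auto
  then show ?case using insert by (simp add: Pi_def)
qed

text \<open>
  The coordinate conditions say that pulling back linear forms along \<open>l\<close> and \<open>r\<close> stays inside the polynomials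
  in \<open>X\<close>, so the actions are defined; invariance of \<open>D\<close> under scaling makes the decomposition into
  homogeneous functions unique.
\<close>

locale fun_model =
  fixes n :: nat and X :: "('p \<Rightarrow> 'k::field_char_0) set" and D :: "'p set"
    and l r :: "'p \<Rightarrow> nat \<Rightarrow> 'k"
  assumes X_nonempty: "X \<noteq> {}"
    and left_coords: "x \<in> coords n \<Longrightarrow> \<exists>y \<in> X. \<forall>p \<in> D. x (l p) = y p"
    and right_coords: "x \<in> coords n \<Longrightarrow> \<exists>y \<in> X. \<forall>p \<in> D. x (r p) = y p"
    and scaling: "p \<in> D \<Longrightarrow> c \<noteq> 0 \<Longrightarrow> \<exists>q \<in> D. \<forall>x \<in> X. x q = c * x p"
begin

abbreviation "M \<equiv> fun_bimod X D l r"

lemma swap: "fun_model n X D r l"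
  by unfold_locales (use X_nonempty left_coords right_coords scaling in auto)

lemma smult_closed:
  assumes "s \<in> ext0 W ` polys (coords n)" "l ` D \<subseteq> W" "f \<in> carrier M"
  shows "(\<lambda>p. s (l p) * f p) \<in> carrier M"
proof -
  obtain s' f' where s: "s' \<in> polys (coords n)" "s = ext0 W s'" and f: "f' \<in> polys X" "f = ext0 D f'"
    using assms by auto
  obtain g where g: "g \<in> polys X" "\<forall>p \<in> D. s' (l p) = g p"
    using polys_subst[where \<pi> = l and D = D and Y = X, OF s(1) left_coords] by blast
  have "(\<lambda>p. s (l p) * f p) = ext0 D (\<lambda>p. g p * f' p)"
    using g(2) assms(2) by (auto simp: s f ext0_def fun_eq_iff)
  then show ?thesis using polys_mult[OF g(1) f(1)] by simp
qed

lemma left_module: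
  assumes "l ` D \<subseteq> W"
  shows "module (coord_ring n W) M"
proof (rule module.intro[OF cring_coord_ring abelian_group_fun_bimod module_axioms.intro])
  fix s f assume s: "s \<in> carrier (coord_ring n W)" and f: "f \<in> carrier M"
  show "s \<odot>\<^bsub>M\<^esub> f \<in> carrier M" using smult_closed[OF _ assms, of s f] s f by simp
next
  fix f assume f: "f \<in> carrier M"
  show "\<one>\<^bsub>coord_ring n W\<^esub> \<odot>\<^bsub>M\<^esub> f = f" using f subsetD[OF assms imageI] by (auto simp: ext0_def fun_eq_iff)
qed (auto simp: distrib_left distrib_right mult_ac)

lemma hcomp_subset: "hcomp M d \<subseteq> carrier M"
  using zero_in_ext0_polys[of D X] by (auto intro: polys.homog)

lemma hcompI: "hpoly X d f \<Longrightarrow> ext0 D f \<in> hcomp M (2 * int d)"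
  by auto

lemma homogeneous_scale:
  assumes "f \<in> hcomp M m" "p \<in> D" "q \<in> D" "\<forall>x \<in> X. x q = c * x p"
  shows "f q = c ^ nat (m div 2) * f p"
  using assms hpoly_scale[of X _ _ q c p] by (auto simp: ext0_def)

lemma hcomp_add:
  assumes "f \<in> hcomp M m" "g \<in> hcomp M m"
  shows "(\<lambda>p. f p + g p) \<in> hcomp M m"
proof -
  have fz: "(\<lambda>p. f p + 0) = f" "(\<lambda>p. 0 + g p) = g" by auto
  from assms consider "f = (\<lambda>_. 0)" | "g = (\<lambda>_. 0)"
    | f' g' d where "f = ext0 D f'" "g = ext0 D g'" "m = 2 * int d" "hpoly X d f'" "hpoly X d g'"
    by auto
  then show ?thesis
  proof cases
    case 1 then show ?thesis using assms(2) by simp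
  next
    case 2 then show ?thesis using assms(1) by simp
  next
    case 3
    then have "(\<lambda>p. f p + g p) = ext0 D (\<lambda>p. f' p + g' p)" by (auto simp: ext0_def)
    then show ?thesis using hcompI[OF hpoly.add[OF 3(4,5)]] 3(3) by simp
  qed
qed

lemma hcomp_cmult:
  assumes "f \<in> hcomp M m"
  shows "(\<lambda>p. c * f p) \<in> hcomp M m"
proof -
  from assms consider "f = (\<lambda>_. 0)" | f' d where "f = ext0 D f'" "m = 2 * int d" "hpoly X d f'"
    by auto
  then show ?thesis
  proof cases
    case 2
    then have "(\<lambda>p. c * f p) = ext0 D (\<lambda>p. c * f' p)" by (auto simp: ext0_def)
    then show ?thesis using hcompI[OF hpoly_cmult[OF 2(3)]] 2(2) by simp
  qed simp
qed

lemma hcomp_smult: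
  assumes "s \<in> hcomp (coord_ring n W) a" "l ` D \<subseteq> W" "f \<in> hcomp M b"
  shows "(\<lambda>p. s (l p) * f p) \<in> hcomp M (a + b)"
proof -
  from assms(1,3) consider "s = (\<lambda>_. 0)" | "f = (\<lambda>_. 0)"
    | s' f' d e where "f = ext0 D f'" "s = ext0 W s'" "b = 2 * int d" "hpoly X d f'"
        "a = 2 * int e" "hpoly (coords n) e s'"
    by auto
  then show ?thesis
  proof cases
    case 3
    obtain g where g: "hpoly X e g" "\<forall>p \<in> D. s' (l p) = g p"
      using hpoly_subst[where \<pi> = l and D = D and Y = X, OF 3(6) left_coords] by blast
    have "(\<lambda>p. s (l p) * f p) = ext0 D (\<lambda>p. g p * f' p)"
      using g(2) assms(2) by (auto simp: 3 ext0_def fun_eq_iff)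
    moreover have "hpoly X (e + d) (\<lambda>p. g p * f' p)" by (rule hpoly_mult[OF g(1) 3(4)])
    moreover have "a + b = 2 * int (e + d)" by (simp add: 3)
    ultimately show ?thesis using hcompI[of "e + d" "\<lambda>p. g p * f' p"] by simp
  qed simp_all
qed

text \<open>
  Homogeneous functions of different degrees scale differently, hence they are independent even after
  restriction to \<open>D\<close>.
\<close>

lemma graded_decomposition:
  assumes "f \<in> carrier M"
  shows "\<exists>!c :: int \<Rightarrow> _. (\<forall>d. c d \<in> hcomp M d) \<and> finite {d. c d \<noteq> \<zero>\<^bsub>M\<^esub>} \<and>
      f = finsum M c {d. c d \<noteq> \<zero>\<^bsub>M\<^esub>}"
proof -
  have fs: "finsum M c {d. c d \<noteq> \<zero>\<^bsub>M\<^esub>} = (\<lambda>p. \<Sum>d | c d \<noteq> (\<lambda>_. 0). c d p)"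
    if "\<forall>d. c d \<in> hcomp M d" "finite {d. c d \<noteq> \<zero>\<^bsub>M\<^esub>}" for c :: "int \<Rightarrow> _"
  proof -
    have "c d \<in> carrier M" for d using that(1) hcomp_subset by blast
    then show ?thesis using finsum_fun_bimod[OF that(2), of c X D l r] by simp
  qed
  obtain f' where f': "f' \<in> polys X" "f = ext0 D f'" using assms by auto
  obtain N g where g: "\<forall>d. hpoly X d (g d)" "\<forall>d \<ge> N. g d = (\<lambda>_. 0)" "f' = (\<lambda>p. \<Sum>d<N. g d p)"
    using polys_homogeneous_parts[OF f'(1) X_nonempty] by blast
  define c where "c m = (if even m \<and> m \<ge> 0 then ext0 D (g (nat (m div 2))) else (\<lambda>_. 0))" for m :: int
  have c: "c m \<in> hcomp M m" for m
  proof (cases "even m \<and> m \<ge> 0")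
    case True
    then have "m = 2 * int (nat (m div 2))" by auto
    then show ?thesis using True hcompI[OF g(1)[rule_format], of "nat (m div 2)"] by (simp add: c_def)
  qed (auto simp: c_def)
  have sub: "{d. c d \<noteq> (\<lambda>_. 0)} \<subseteq> (\<lambda>d. 2 * int d) ` {..<N}"
  proof
    fix m assume "m \<in> {d. c d \<noteq> (\<lambda>_. 0)}"
    then have m: "even m" "m \<ge> 0" "ext0 D (g (nat (m div 2))) \<noteq> (\<lambda>_. 0)" by (auto simp: c_def split: if_splits)
    then have "nat (m div 2) < N" using g(2) by (metis linorder_not_le ext0_zero)
    then show "m \<in> (\<lambda>d. 2 * int d) ` {..<N}"
      using m by (intro image_eqI[of _ _ "nat (m div 2)"]) auto
  qed
  then have fin: "finite {d. c d \<noteq> (\<lambda>_. 0)}" by (rule finite_subset) auto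
  have "f p = (\<Sum>d | c d \<noteq> (\<lambda>_. 0). c d p)" for p
  proof -
    have "(\<Sum>d | c d \<noteq> (\<lambda>_. 0). c d p) = (\<Sum>d \<in> (\<lambda>d. 2 * int d) ` {..<N}. c d p)"
    proof (rule sum.mono_neutral_left)
      show "\<forall>m \<in> (\<lambda>d. 2 * int d) ` {..<N} - {d. c d \<noteq> (\<lambda>_. 0)}. c m p = 0" by auto
    qed (use sub in auto)
    also have "\<dots> = (\<Sum>d<N. c (2 * int d) p)"
      by (subst sum.reindex) (auto simp: inj_on_def)
    also have "\<dots> = (\<Sum>d<N. ext0 D (g d) p)" by (simp add: c_def)
    also have "\<dots> = f p" by (auto simp: f' g(3) ext0_def)
    finally show ?thesis by simp
  qed
  then have fc: "f = finsum M c {d. c d \<noteq> \<zero>\<^bsub>M\<^esub>}" using fs[of c] c fin by (auto simp: fun_eq_iff)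
  show ?thesis
  proof (rule ex1I[of _ c])
    show "(\<forall>d. c d \<in> hcomp M d) \<and> finite {d. c d \<noteq> \<zero>\<^bsub>M\<^esub>} \<and> f = finsum M c {d. c d \<noteq> \<zero>\<^bsub>M\<^esub>}"
      using c fin fc by simp
  next
    fix b assume b: "(\<forall>d. b d \<in> hcomp M d) \<and> finite {d. b d \<noteq> \<zero>\<^bsub>M\<^esub>} \<and> f = finsum M b {d. b d \<noteq> \<zero>\<^bsub>M\<^esub>}"
    define S where "S = {d. c d \<noteq> (\<lambda>_. 0)} \<union> {d. b d \<noteq> (\<lambda>_. 0)}"
    have finS: "finite S" using fin b by (simp add: S_def)
    define h where "h d = (\<lambda>p. c d p + -1 * b d p)" for d
    have hh: "h d \<in> hcomp M d" for d
      unfolding h_def using c b by (intro hcomp_add hcomp_cmult) blast+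
    have sumh: "(\<Sum>d\<in>S. h d p) = 0" for p
    proof -
      have "(\<Sum>d\<in>S. c d p) = f p"
        unfolding fc using fs[of c] c fin finS by (auto simp: S_def intro!: sum.mono_neutral_right)
      moreover have "(\<Sum>d\<in>S. b d p) = f p"
        using fs[of b] b finS by (auto simp: S_def intro!: sum.mono_neutral_right)
      ultimately show ?thesis by (simp add: h_def sum_subtractf)
    qed
    have odd_zero: "h e = (\<lambda>_. 0)" if "\<not> (even e \<and> e \<ge> 0)" for e
      using hh[of e] that by auto
    have "h d p = 0" for d p
    proof (cases "p \<in> D \<and> d \<in> S \<and> even d \<and> d \<ge> 0")
      case False
      have "h d p = 0" if "p \<notin> D" using hh[of d] that by (auto simp: ext0_def)
      moreover have "h d p = 0" if "d \<notin> S" using that by (auto simp: S_def h_def)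
      moreover have "h d p = 0" if "\<not> (even d \<and> d \<ge> 0)" using odd_zero[OF that] by simp
      ultimately show ?thesis using False by blast
    next
      case True
      \<comment> \<open>Along the scalings of \<open>p\<close> the vanishing sum is a polynomial in the scalar; its coefficients
        are the values \<open>h e p\<close>.\<close>
      define E where "E = {e \<in> S. even e \<and> e \<ge> 0}"
      have finE: "finite E" using finS by (simp add: E_def)
      define q where "q = (\<Sum>e\<in>E. monom (h e p) (nat (e div 2)))"
      have "poly q a = 0" if "a \<noteq> 0" for a
      proof -
        have "\<exists>q \<in> D. \<forall>x \<in> X. x q = a * x p" using scaling[of p a] True that by simp
        then obtain p' where p': "p' \<in> D" "\<forall>x \<in> X. x p' = a * x p" by (rule bexE)
        have "poly q a = (\<Sum>e\<in>E. a ^ nat (e div 2) * h e p)"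
          by (simp add: q_def poly_sum poly_monom mult.commute)
        also have "\<dots> = (\<Sum>e\<in>E. h e p')"
          using homogeneous_scale[OF hh _ p'(1,2)] True by (intro sum.cong) auto
        also have "\<dots> = (\<Sum>e\<in>S. h e p')"
        proof (rule sum.mono_neutral_left[OF finS])
          show "\<forall>e \<in> S - E. h e p' = 0" using odd_zero by (simp add: E_def)
        qed (simp add: E_def)
        finally show ?thesis using sumh by simp
      qed
      then have "q = 0" by (rule poly_of_infinite_zero)
      then have "0 = coeff q (nat (d div 2))" by simp
      also have "\<dots> = (\<Sum>e\<in>E. if e = d then h e p else 0)"
        unfolding q_def coeff_sum
      proof (rule sum.cong[OF refl])
        fix e assume "e \<in> E"
        then have "2 * int (nat (e div 2)) = e" by (simp add: E_def)
        moreover have "2 * int (nat (d div 2)) = d" using True by simp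
        ultimately have "nat (e div 2) = nat (d div 2) \<longleftrightarrow> e = d" by metis
        then show "coeff (monom (h e p) (nat (e div 2))) (nat (d div 2)) = (if e = d then h e p else 0)"
          by simp
      qed
      also have "\<dots> = h d p" using finE True by (simp add: E_def)
      finally show ?thesis by simp
    qed
    then show "b = c" by (auto simp: h_def fun_eq_iff)
  qed
qed

lemma graded_fun_bimod:
  assumes "l ` D \<subseteq> Z" "r ` D \<subseteq> Z"
  shows "graded_bimodule (coord_ring n Z) M"
proof -
  have sg: "subgroup (hcomp M d) (add_monoid M)" for d
  proof -
    interpret abelian_group M by (rule abelian_group_fun_bimod)
    show ?thesis
    proof (rule add.subgroupI)
      show "hcomp M d \<subseteq> carrier M" by (rule hcomp_subset)
      show "hcomp M d \<noteq> {}" by auto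
      fix f g assume f: "f \<in> hcomp M d" and g: "g \<in> hcomp M d"
      show "f \<oplus>\<^bsub>M\<^esub> g \<in> hcomp M d" using hcomp_add[OF f g] by simp
      have m: "(\<lambda>p. -1 * f p) \<in> hcomp M d" by (rule hcomp_cmult[OF f])
      have "\<ominus>\<^bsub>M\<^esub> f = (\<lambda>p. -1 * f p)"
        using f m hcomp_subset[of d] by (intro minus_equality) (auto simp only: subsetD, simp)
      then show "\<ominus>\<^bsub>M\<^esub> f \<in> hcomp M d" using m by simp
    qed
  qed
  interpret s: fun_model n X D r l by (rule swap)
  show ?thesis
    unfolding graded_bimodule_def swap_sides_fun_bimod
    using left_module[OF assms(1)] s.left_module[OF assms(2)] sg graded_decomposition
      hcomp_smult[OF _ assms(1)] s.hcomp_smult[OF _ assms(2)]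
    by (simp add: mult_ac)
qed

end

section \<open>Isomorphisms of graded bimodules\<close>

text \<open>
  The closure conditions concern \<open>M\<close> alone and are part of the definition, because \<open>M\<close> will be a
  tensor product about which nothing else is known; all axioms of a graded bimodule are then
  inherited from \<open>N\<close>. The set \<open>S\<close> of scalars is a parameter because the middle ring of a tensor
  product need not be the ring \<open>R_bar n\<close> of the outer actions.
\<close>

definition gb_iso :: "'r set \<Rightarrow> ('m \<Rightarrow> 'n) \<Rightarrow> ('r, 'm) gbimod \<Rightarrow> ('r, 'n) gbimod \<Rightarrow> bool" where
  "gb_iso S \<phi> M N \<longleftrightarrow> bij_betw \<phi> (carrier M) (carrier N) \<and>
     \<zero>\<^bsub>M\<^esub> \<in> carrier M \<and> \<phi> \<zero>\<^bsub>M\<^esub> = \<zero>\<^bsub>N\<^esub> \<and>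
     (\<forall>x \<in> carrier M. \<forall>y \<in> carrier M. x \<oplus>\<^bsub>M\<^esub> y \<in> carrier M \<and> \<phi> (x \<oplus>\<^bsub>M\<^esub> y) = \<phi> x \<oplus>\<^bsub>N\<^esub> \<phi> y) \<and>
     (\<forall>s \<in> S. \<forall>x \<in> carrier M.
        smult M s x \<in> carrier M \<and> \<phi> (smult M s x) = smult N s (\<phi> x) \<and>
        rsmult M x s \<in> carrier M \<and> \<phi> (rsmult M x s) = rsmult N (\<phi> x) s) \<and>
     (\<forall>d. hcomp M d \<subseteq> carrier M \<and> \<phi> ` hcomp M d = hcomp N d)"

lemma gb_isoD:
  assumes "gb_iso S \<phi> M N"
  shows "bij_betw \<phi> (carrier M) (carrier N)" "inj_on \<phi> (carrier M)" "\<phi> ` carrier M = carrier N"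
    "\<zero>\<^bsub>M\<^esub> \<in> carrier M" "\<phi> \<zero>\<^bsub>M\<^esub> = \<zero>\<^bsub>N\<^esub>"
    "\<And>x. x \<in> carrier M \<Longrightarrow> \<phi> x \<in> carrier N"
    "\<And>x y. x \<in> carrier M \<Longrightarrow> y \<in> carrier M \<Longrightarrow> x \<oplus>\<^bsub>M\<^esub> y \<in> carrier M"
    "\<And>x y. x \<in> carrier M \<Longrightarrow> y \<in> carrier M \<Longrightarrow> \<phi> (x \<oplus>\<^bsub>M\<^esub> y) = \<phi> x \<oplus>\<^bsub>N\<^esub> \<phi> y"
    "\<And>s x. s \<in> S \<Longrightarrow> x \<in> carrier M \<Longrightarrow> smult M s x \<in> carrier M"
    "\<And>s x. s \<in> S \<Longrightarrow> x \<in> carrier M \<Longrightarrow> \<phi> (smult M s x) = smult N s (\<phi> x)"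
    "\<And>s x. s \<in> S \<Longrightarrow> x \<in> carrier M \<Longrightarrow> rsmult M x s \<in> carrier M"
    "\<And>s x. s \<in> S \<Longrightarrow> x \<in> carrier M \<Longrightarrow> \<phi> (rsmult M x s) = rsmult N (\<phi> x) s"
    "\<And>d. hcomp M d \<subseteq> carrier M" "\<And>d. \<phi> ` hcomp M d = hcomp N d"
  using assms unfolding gb_iso_def by (auto simp: bij_betw_def)

lemma gb_iso_inv:
  assumes "gb_iso S \<phi> M N"
  shows "y \<in> carrier N \<Longrightarrow> inv_into (carrier M) \<phi> y \<in> carrier M"
    "y \<in> carrier N \<Longrightarrow> \<phi> (inv_into (carrier M) \<phi> y) = y"
    "x \<in> carrier M \<Longrightarrow> inv_into (carrier M) \<phi> (\<phi> x) = x"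
  using gb_isoD(2,3)[OF assms] by (auto simp: inv_into_into f_inv_into_f inv_into_f_f)

lemma gb_iso_swap_sides: "gb_iso S \<phi> M N \<Longrightarrow> gb_iso S \<phi> (swap_sides M) (swap_sides N)"
  by (auto simp: gb_iso_def)

text \<open>
  Stated for the left action alone, so that it also covers bimodules whose left action has been
  replaced by the action of a quotient of \<open>R_bar n\<close>.
\<close>

lemma module_transfer:
  assumes N: "module R N" and bij: "bij_betw \<phi> (carrier M) (carrier N)"
    and z: "\<zero>\<^bsub>M\<^esub> \<in> carrier M" "\<phi> \<zero>\<^bsub>M\<^esub> = \<zero>\<^bsub>N\<^esub>"
    and a: "\<And>x y. x \<in> carrier M \<Longrightarrow> y \<in> carrier M \<Longrightarrow> x \<oplus>\<^bsub>M\<^esub> y \<in> carrier M"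
      "\<And>x y. x \<in> carrier M \<Longrightarrow> y \<in> carrier M \<Longrightarrow> \<phi> (x \<oplus>\<^bsub>M\<^esub> y) = \<phi> x \<oplus>\<^bsub>N\<^esub> \<phi> y"
    and s: "\<And>s x. s \<in> carrier R \<Longrightarrow> x \<in> carrier M \<Longrightarrow> s \<odot>\<^bsub>M\<^esub> x \<in> carrier M"
      "\<And>s x. s \<in> carrier R \<Longrightarrow> x \<in> carrier M \<Longrightarrow> \<phi> (s \<odot>\<^bsub>M\<^esub> x) = s \<odot>\<^bsub>N\<^esub> \<phi> x"
  shows "module R M"
proof -
  interpret N: module R N by fact
  have c: "\<phi> x \<in> carrier N" if "x \<in> carrier M" for x using bij that by (auto simp: bij_betw_def)
  have eq: "x = y" if "\<phi> x = \<phi> y" "x \<in> carrier M" "y \<in> carrier M" for x y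
    using bij that by (auto simp: bij_betw_def inj_on_def)
  have ab: "abelian_group M"
  proof (rule abelian_groupI)
    fix x assume x: "x \<in> carrier M"
    have "\<ominus>\<^bsub>N\<^esub> \<phi> x \<in> \<phi> ` carrier M" using bij c[OF x] by (simp add: bij_betw_def)
    then obtain y where y: "y \<in> carrier M" "\<phi> y = \<ominus>\<^bsub>N\<^esub> \<phi> x" by auto
    have "y \<oplus>\<^bsub>M\<^esub> x = \<zero>\<^bsub>M\<^esub>"
      by (rule eq) (use x y z a c N.l_neg in simp_all)
    then show "\<exists>y \<in> carrier M. y \<oplus>\<^bsub>M\<^esub> x = \<zero>\<^bsub>M\<^esub>" using y by blast
  next
    fix x y z assume "x \<in> carrier M" "y \<in> carrier M" "z \<in> carrier M"
    then show "x \<oplus>\<^bsub>M\<^esub> y \<oplus>\<^bsub>M\<^esub> z = x \<oplus>\<^bsub>M\<^esub> (y \<oplus>\<^bsub>M\<^esub> z)"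
      by (intro eq) (simp_all add: a c N.a_assoc)
  next
    fix x y assume "x \<in> carrier M" "y \<in> carrier M"
    then show "x \<oplus>\<^bsub>M\<^esub> y = y \<oplus>\<^bsub>M\<^esub> x" by (intro eq) (simp_all add: a c N.a_comm)
  next
    fix x assume "x \<in> carrier M"
    then show "\<zero>\<^bsub>M\<^esub> \<oplus>\<^bsub>M\<^esub> x = x" by (intro eq) (simp_all add: a c z)
  qed (simp_all add: a z)
  show ?thesis
  proof (rule module.intro[OF N.is_cring ab module_axioms.intro])
    fix r t x assume "r \<in> carrier R" "t \<in> carrier R" "x \<in> carrier M"
    then show "(r \<oplus>\<^bsub>R\<^esub> t) \<odot>\<^bsub>M\<^esub> x = r \<odot>\<^bsub>M\<^esub> x \<oplus>\<^bsub>M\<^esub> t \<odot>\<^bsub>M\<^esub> x"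
      by (intro eq) (simp_all add: a c s N.smult_l_distr)
  next
    fix r x y assume "r \<in> carrier R" "x \<in> carrier M" "y \<in> carrier M"
    then show "r \<odot>\<^bsub>M\<^esub> (x \<oplus>\<^bsub>M\<^esub> y) = r \<odot>\<^bsub>M\<^esub> x \<oplus>\<^bsub>M\<^esub> r \<odot>\<^bsub>M\<^esub> y"
      by (intro eq) (simp_all add: a c s N.smult_r_distr)
  next
    fix r t x assume "r \<in> carrier R" "t \<in> carrier R" "x \<in> carrier M"
    then show "(r \<otimes>\<^bsub>R\<^esub> t) \<odot>\<^bsub>M\<^esub> x = r \<odot>\<^bsub>M\<^esub> (t \<odot>\<^bsub>M\<^esub> x)"
      by (intro eq) (simp_all add: a c s N.smult_assoc1)
  next
    fix x assume "x \<in> carrier M"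
    then show "\<one>\<^bsub>R\<^esub> \<odot>\<^bsub>M\<^esub> x = x" by (intro eq) (simp_all add: c s)
  qed (simp_all add: s)
qed

lemma finsum_transfer:
  assumes "abelian_group M" "abelian_group N" "finite A" "g \<in> A \<rightarrow> carrier M"
    and "\<phi> ` carrier M \<subseteq> carrier N" "\<phi> \<zero>\<^bsub>M\<^esub> = \<zero>\<^bsub>N\<^esub>"
      "\<And>x y. x \<in> carrier M \<Longrightarrow> y \<in> carrier M \<Longrightarrow> \<phi> (x \<oplus>\<^bsub>M\<^esub> y) = \<phi> x \<oplus>\<^bsub>N\<^esub> \<phi> y"
  shows "\<phi> (finsum M g A) = finsum N (\<lambda>a. \<phi> (g a)) A"
  using assms(3,4)
proof (induction A rule: finite_induct)
  case empty
  interpret M: abelian_group M by fact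
  interpret N: abelian_group N by fact
  show ?case using assms(6) by simp
next
  case (insert a A)
  interpret M: abelian_group M by fact
  interpret N: abelian_group N by fact
  have g: "g \<in> A \<rightarrow> carrier M" "g a \<in> carrier M" using insert.prems by auto
  have "(\<lambda>a. \<phi> (g a)) \<in> A \<rightarrow> carrier N" "\<phi> (g a) \<in> carrier N" using g assms(5) by auto
  then show ?case
    using insert g assms(7)[of "g a" "finsum M g A"] by (simp add: Pi_def)
qed

lemma gb_iso_module:
  assumes "gb_iso (carrier R) \<phi> M N" "module R N"
  shows "module R M"
  by (rule module_transfer[OF assms(2) gb_isoD(1)[OF assms(1)]]) (use gb_isoD[OF assms(1)] in simp_all)

text \<open>
  Every axiom is an identity or an existence statement between elements of \<open>M\<close>; injectivity of \<open>\<phi>\<close> reduces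
  it to \<open>N\<close>, where it holds.
\<close>

lemma gb_iso_graded:
  assumes iso: "gb_iso (carrier R) \<phi> M N" and N: "graded_bimodule R N"
    and R: "\<And>d. hcomp R d \<subseteq> carrier R"
  shows "graded_bimodule R M"
proof -
  note D = gb_isoD[OF iso] and I = gb_iso_inv[OF iso]
  define \<psi> where "\<psi> = inv_into (carrier M) \<phi>"
  have modN: "module R N" "module R (swap_sides N)" using N by (auto simp: graded_bimodule_def)
  have modM: "module R M" by (rule gb_iso_module[OF iso modN(1)])
  have modM': "module R (swap_sides M)" by (rule gb_iso_module[OF gb_iso_swap_sides[OF iso] modN(2)])
  interpret M: module R M by fact
  interpret N: module R N by fact
  have eq: "x = y" if "\<phi> x = \<phi> y" "x \<in> carrier M" "y \<in> carrier M" for x y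
    using D(2) that by (auto simp: inj_on_def)
  have hc: "x \<in> carrier M" "\<phi> x \<in> hcomp N d" if "x \<in> hcomp M d" for x d
    using D(13,14)[of d] that by auto
  have hmem: "x \<in> hcomp M d" if "x \<in> carrier M" "\<phi> x \<in> hcomp N d" for x d
  proof -
    have "\<phi> x \<in> \<phi> ` hcomp M d" using that D(14)[of d] by simp
    then obtain y where y: "y \<in> hcomp M d" "\<phi> x = \<phi> y" by (rule imageE)
    have "y = x" using eq[OF y(2)[symmetric] hc(1)[OF y(1)] that(1)] .
    then show ?thesis using y(1) by simp
  qed
  have sgN: "subgroup (hcomp N d) (add_monoid N)" for d using N by (simp add: graded_bimodule_def)
  have smN: "smult N s m \<in> hcomp N (a + b) \<and> rsmult N m s \<in> hcomp N (a + b)"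
    if "s \<in> hcomp R a" "m \<in> hcomp N b" for s m a b
    using N[unfolded graded_bimodule_def] that by simp
  have commN: "rsmult N (smult N s m) t = smult N s (rsmult N m t)"
    if "s \<in> carrier R" "t \<in> carrier R" "m \<in> carrier N" for s t m
    using N[unfolded graded_bimodule_def] that by simp
  have sg: "subgroup (hcomp M d) (add_monoid M)" for d
  proof (rule M.add.subgroupI)
    show "hcomp M d \<subseteq> carrier M" by (rule D(13))
    have "\<zero>\<^bsub>N\<^esub> \<in> hcomp N d" using subgroup.one_closed[OF sgN] by simp
    then have "\<zero>\<^bsub>M\<^esub> \<in> hcomp M d" using D by (intro hmem) simp_all
    then show "hcomp M d \<noteq> {}" by blast
    fix x assume x: "x \<in> hcomp M d"
    have xc: "x \<in> carrier M" using hc[OF x] by simp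
    have "\<phi> (\<ominus>\<^bsub>M\<^esub> x) \<oplus>\<^bsub>N\<^esub> \<phi> x = \<zero>\<^bsub>N\<^esub>"
      using D(5) D(8)[of "\<ominus>\<^bsub>M\<^esub> x" x] xc M.l_neg[OF xc] by simp
    then have "\<ominus>\<^bsub>N\<^esub> \<phi> x = \<phi> (\<ominus>\<^bsub>M\<^esub> x)"
      by (rule N.minus_equality) (use D(6) xc in simp_all)
    moreover have "\<ominus>\<^bsub>N\<^esub> \<phi> x \<in> hcomp N d"
      using subgroup.m_inv_closed[OF sgN hc(2)[OF x]] by (simp add: a_inv_def)
    ultimately show "\<ominus>\<^bsub>M\<^esub> x \<in> hcomp M d" using hmem xc by simp
    fix y assume y: "y \<in> hcomp M d"
    have "\<phi> x \<oplus>\<^bsub>N\<^esub> \<phi> y \<in> hcomp N d"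
      using subgroup.m_closed[OF sgN hc(2)[OF x] hc(2)[OF y]] by simp
    then show "x \<oplus>\<^bsub>M\<^esub> y \<in> hcomp M d" using hmem D(7,8) hc(1)[OF x] hc(1)[OF y] by simp
  qed
  have dec: "\<exists>!c :: int \<Rightarrow> _. (\<forall>d. c d \<in> hcomp M d) \<and> finite {d. c d \<noteq> \<zero>\<^bsub>M\<^esub>} \<and>
        m = finsum M c {d. c d \<noteq> \<zero>\<^bsub>M\<^esub>}" if m: "m \<in> carrier M" for m
  proof -
    have z: "c d \<noteq> \<zero>\<^bsub>M\<^esub> \<longleftrightarrow> \<phi> (c d) \<noteq> \<zero>\<^bsub>N\<^esub>" if "\<forall>d. c d \<in> hcomp M d" for c and d :: int
      using eq[of "c d" "\<zero>\<^bsub>M\<^esub>"] D(4,5) hc(1)[OF that[rule_format, of d]] by auto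
    have fs: "m = finsum M c A \<longleftrightarrow> \<phi> m = finsum N (\<lambda>d. \<phi> (c d)) A"
      if c: "\<forall>d. c d \<in> hcomp M d" and "finite A" for c and A :: "int set"
    proof -
      have cc: "c \<in> A \<rightarrow> carrier M" using c hc(1) by blast
      have "\<phi> (finsum M c A) = finsum N (\<lambda>d. \<phi> (c d)) A"
        by (rule finsum_transfer) (use cc that D in \<open>auto intro: M.abelian_group_axioms N.abelian_group_axioms\<close>)
      moreover have "finsum M c A \<in> carrier M" using cc by (rule M.finsum_closed)
      ultimately show ?thesis using eq[of m "finsum M c A"] m by auto
    qed
    have "\<phi> m \<in> carrier N" using D(6) m .
    then have "\<exists>!c :: int \<Rightarrow> _. (\<forall>d. c d \<in> hcomp N d) \<and> finite {d. c d \<noteq> \<zero>\<^bsub>N\<^esub>} \<and>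
        \<phi> m = finsum N c {d. c d \<noteq> \<zero>\<^bsub>N\<^esub>}"
      using N[unfolded graded_bimodule_def, THEN conjunct2, THEN conjunct2, THEN conjunct2, THEN conjunct2, THEN conjunct1]
      by (rule bspec[rotated])
    then obtain c where c: "\<forall>d. c d \<in> hcomp N d" "finite {d. c d \<noteq> \<zero>\<^bsub>N\<^esub>}"
        "\<phi> m = finsum N c {d. c d \<noteq> \<zero>\<^bsub>N\<^esub>}"
      and uniq: "\<forall>c'. (\<forall>d. c' d \<in> hcomp N d) \<and> finite {d. c' d \<noteq> \<zero>\<^bsub>N\<^esub>} \<and>
        \<phi> m = finsum N c' {d. c' d \<noteq> \<zero>\<^bsub>N\<^esub>} \<longrightarrow> c' = c"
      unfolding Ex1_def by (elim exE conjE)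
    have cN: "c d \<in> carrier N" for d
      using c(1)[rule_format, of d] subgroup.mem_carrier[OF sgN] by simp
    define b where "b d = \<psi> (c d)" for d
    have pb: "\<phi> (b d) = c d" "b d \<in> carrier M" for d using I cN by (simp_all add: b_def \<psi>_def)
    have b: "\<forall>d. b d \<in> hcomp M d" using hmem pb c(1) by simp
    show ?thesis
    proof (rule ex1I[of _ b])
      show "(\<forall>d. b d \<in> hcomp M d) \<and> finite {d. b d \<noteq> \<zero>\<^bsub>M\<^esub>} \<and> m = finsum M b {d. b d \<noteq> \<zero>\<^bsub>M\<^esub>}"
      proof -
        have zz: "{d. b d \<noteq> \<zero>\<^bsub>M\<^esub>} = {d. c d \<noteq> \<zero>\<^bsub>N\<^esub>}" using z[OF b] by (simp add: pb)
        show ?thesis unfolding zz using b c(2,3) fs[OF b c(2)] by (simp add: pb)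
      qed
    next
      fix b' assume b': "(\<forall>d. b' d \<in> hcomp M d) \<and> finite {d. b' d \<noteq> \<zero>\<^bsub>M\<^esub>} \<and> m = finsum M b' {d. b' d \<noteq> \<zero>\<^bsub>M\<^esub>}"
      then have b'': "\<forall>d. b' d \<in> hcomp M d" by simp
      have "(\<forall>d. \<phi> (b' d) \<in> hcomp N d) \<and> finite {d. \<phi> (b' d) \<noteq> \<zero>\<^bsub>N\<^esub>} \<and>
        \<phi> m = finsum N (\<lambda>d. \<phi> (b' d)) {d. \<phi> (b' d) \<noteq> \<zero>\<^bsub>N\<^esub>}"
      proof -
        have zz: "{d. \<phi> (b' d) \<noteq> \<zero>\<^bsub>N\<^esub>} = {d. b' d \<noteq> \<zero>\<^bsub>M\<^esub>}" using z[OF b''] by simp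
        have fin: "finite {d. b' d \<noteq> \<zero>\<^bsub>M\<^esub>}" using b' by simp
        show ?thesis unfolding zz using b' fin fs[OF b'' fin] hc(2) by simp
      qed
      then have eqc: "(\<lambda>d. \<phi> (b' d)) = c" by (rule uniq[rule_format])
      show "b' = b"
      proof
        fix d
        show "b' d = b d"
          by (rule eq) (use pb fun_cong[OF eqc, of d] hc(1)[OF b''[rule_format]] in simp_all)
      qed
    qed
  qed
  show ?thesis
    unfolding graded_bimodule_def
  proof (intro conjI ballI allI)
    show "module R M" "module R (swap_sides M)" by fact+
    show "rsmult M (smult M r m) s = smult M r (rsmult M m s)"
      if "r \<in> carrier R" "s \<in> carrier R" "m \<in> carrier M" for r s m
      by (rule eq) (use D that commN in simp_all)
    show "subgroup (hcomp M d) (add_monoid M)" for d by (rule sg)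
    fix a b r m assume rm: "r \<in> hcomp R a" "m \<in> hcomp M b"
    then have "r \<in> carrier R" "m \<in> carrier M" using R hc(1) by blast+
    then show "smult M r m \<in> hcomp M (a + b)" "rsmult M m r \<in> hcomp M (a + b)"
      using smN[OF rm(1) hc(2)[OF rm(2)]] D by (auto intro: hmem)
  qed (rule dec)
qed

lemma gb_iso_isomorphic:
  assumes iso: "gb_iso (carrier R) \<phi> M N" "gb_iso (carrier R) \<phi>' M' N" and N: "graded_bimodule R N"
    and R: "\<And>d. hcomp R d \<subseteq> carrier R"
  shows "gbimod_isomorphic R M M'"
proof -
  have hom: "inv_into (carrier M') \<phi>' \<circ> \<phi> \<in> gbimod_hom R M M'"
    if i: "gb_iso (carrier R) \<phi> M N" "gb_iso (carrier R) \<phi>' M' N"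
    for \<phi> :: "'x \<Rightarrow> _" and \<phi>' :: "'y \<Rightarrow> _" and M M'
  proof -
    note D = gb_isoD[OF i(1)] and D' = gb_isoD[OF i(2)] and I = gb_iso_inv[OF i(2)]
    let ?\<psi> = "inv_into (carrier M') \<phi>'"
    have eq: "x = y" if "\<phi>' x = \<phi>' y" "x \<in> carrier M'" "y \<in> carrier M'" for x y
      using D'(2) that by (auto simp: inj_on_def)
    have h: "?\<psi> (\<phi> x) \<in> hcomp M' d" if "x \<in> hcomp M d" for x d
    proof -
      have "\<phi> x \<in> \<phi>' ` hcomp M' d" using D(14)[of d] D'(14)[of d] that by auto
      then obtain y where y: "y \<in> hcomp M' d" "\<phi> x = \<phi>' y" by auto
      then have "?\<psi> (\<phi> x) = y" using I(3) D'(13)[of d] by auto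
      then show ?thesis using y by simp
    qed
    have clos: "?\<psi> (\<phi> x) \<in> carrier M'" "\<phi>' (?\<psi> (\<phi> x)) = \<phi> x" if "x \<in> carrier M" for x
      using D(6)[OF that] I by auto
    have "?\<psi> (\<phi> (x \<oplus>\<^bsub>M\<^esub> y)) = ?\<psi> (\<phi> x) \<oplus>\<^bsub>M'\<^esub> ?\<psi> (\<phi> y)" if "x \<in> carrier M" "y \<in> carrier M" for x y
    proof (rule eq)
      show "\<phi>' (?\<psi> (\<phi> (x \<oplus>\<^bsub>M\<^esub> y))) = \<phi>' (?\<psi> (\<phi> x) \<oplus>\<^bsub>M'\<^esub> ?\<psi> (\<phi> y))"
        using clos(2)[OF D(7)[OF that]] clos[OF that(1)] clos[OF that(2)] D(8)[OF that]
        by (simp only: D'(8))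
    qed (use that clos D(7) D'(7) in simp_all)
    moreover have "?\<psi> (\<phi> (smult M r x)) = smult M' r (?\<psi> (\<phi> x))" if "r \<in> carrier R" "x \<in> carrier M" for r x
    proof (rule eq)
      show "\<phi>' (?\<psi> (\<phi> (smult M r x))) = \<phi>' (smult M' r (?\<psi> (\<phi> x)))"
        using clos(2)[OF D(9)[OF that]] clos[OF that(2)] D(10)[OF that] that by (simp only: D'(10))
    qed (use that clos D(9) D'(9) in simp_all)
    moreover have "?\<psi> (\<phi> (rsmult M x r)) = rsmult M' (?\<psi> (\<phi> x)) r" if "r \<in> carrier R" "x \<in> carrier M" for r x
    proof (rule eq)
      show "\<phi>' (?\<psi> (\<phi> (rsmult M x r))) = \<phi>' (rsmult M' (?\<psi> (\<phi> x)) r)"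
        using clos(2)[OF D(11)[OF that]] clos[OF that(2)] D(12)[OF that] that by (simp only: D'(12))
    qed (use that clos D(11) D'(11) in simp_all)
    ultimately show ?thesis
      unfolding gbimod_hom_def using h clos(1) by auto
  qed
  have "inv_into (carrier M) \<phi> (\<phi>' (inv_into (carrier M') \<phi>' (\<phi> x))) = x" if "x \<in> carrier M" for x
    using gb_iso_inv[OF iso(1)] gb_iso_inv[OF iso(2)] gb_isoD(6)[OF iso(1) that] that by simp
  moreover have "inv_into (carrier M') \<phi>' (\<phi> (inv_into (carrier M) \<phi> (\<phi>' x))) = x" if "x \<in> carrier M'" for x
    using gb_iso_inv[OF iso(1)] gb_iso_inv[OF iso(2)] gb_isoD(6)[OF iso(2) that] that by simp
  ultimately show ?thesis
    unfolding gbimod_isomorphic_def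
    using gb_iso_graded[OF iso(1) N R] gb_iso_graded[OF iso(2) N R] hom[OF iso] hom[OF iso(2,1)]
    by (intro conjI bexI[of _ "inv_into (carrier M') \<phi>' \<circ> \<phi>"] bexI[of _ "inv_into (carrier M) \<phi> \<circ> \<phi>'"]) simp_all
qed

lemma gb_iso_transport:
  assumes iso: "gb_iso S \<phi> M N" and inj: "inj_on f (carrier M)"
  shows "gb_iso S (\<phi> \<circ> inv_into (carrier M) f) (transport f M) N"
proof -
  note D = gb_isoD[OF iso]
  have inv: "inv_into (carrier M) f (f x) = x" if "x \<in> carrier M" for x using inj that by simp
  have "bij_betw (inv_into (carrier M) f) (f ` carrier M) (carrier M)"
    using inj by (simp add: bij_betw_inv_into inj_on_imp_bij_betw)
  then have "bij_betw (\<phi> \<circ> inv_into (carrier M) f) (f ` carrier M) (carrier N)"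
    using D(1) by (rule bij_betw_trans)
  moreover have "(\<phi> \<circ> inv_into (carrier M) f) ` f ` hcomp M d = hcomp N d" for d
  proof -
    have "(\<phi> \<circ> inv_into (carrier M) f) ` f ` hcomp M d = \<phi> ` hcomp M d"
      unfolding image_image using inv D(13)[of d] by (intro image_cong) auto
    then show ?thesis using D(14) by simp
  qed
  moreover have "f ` hcomp M d \<subseteq> f ` carrier M" for d using D(13)[of d] by (rule image_mono)
  ultimately show ?thesis
    unfolding gb_iso_def transport_def Let_def using D(4-12) by (auto simp: inv)
qed

text \<open>
  An abstract tensor product: \<open>\<tau> a b\<close> stands for the formal symbol of \<open>(a, b)\<close>, and \<open>K\<close> contains the defining
  relations. It is kept free of any reference to left and right modules so that the roles of the
  two factors can be exchanged. The family \<open>c\<close> generates the second factor over \<open>S\<close>.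
\<close>

locale balanced_map =
  fixes K :: "'z::ab_group_add set" and A :: "'a::ab_group_add set" and B :: "'b::ab_group_add set"
    and \<tau> :: "'a \<Rightarrow> 'b \<Rightarrow> 'z" and S :: "'s set" and ra :: "'a \<Rightarrow> 's \<Rightarrow> 'a" and la :: "'s \<Rightarrow> 'b \<Rightarrow> 'b"
    and I :: "'i set" and c :: "'i \<Rightarrow> 'b"
  assumes K: "0 \<in> K" "x \<in> K \<Longrightarrow> y \<in> K \<Longrightarrow> x - y \<in> K"
    and A: "0 \<in> A" "a \<in> A \<Longrightarrow> a' \<in> A \<Longrightarrow> a - a' \<in> A"
    and B: "0 \<in> B" "b \<in> B \<Longrightarrow> b' \<in> B \<Longrightarrow> b - b' \<in> B"
    and add_left: "a \<in> A \<Longrightarrow> a' \<in> A \<Longrightarrow> b \<in> B \<Longrightarrow> \<tau> (a + a') b - \<tau> a b - \<tau> a' b \<in> K"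
    and add_right: "a \<in> A \<Longrightarrow> b \<in> B \<Longrightarrow> b' \<in> B \<Longrightarrow> \<tau> a (b + b') - \<tau> a b - \<tau> a b' \<in> K"
    and act: "s \<in> S \<Longrightarrow> a \<in> A \<Longrightarrow> ra a s \<in> A" "s \<in> S \<Longrightarrow> b \<in> B \<Longrightarrow> la s b \<in> B"
      "s \<in> S \<Longrightarrow> a \<in> A \<Longrightarrow> b \<in> B \<Longrightarrow> \<tau> (ra a s) b - \<tau> a (la s b) \<in> K"
    and I: "finite I" "i \<in> I \<Longrightarrow> c i \<in> B"
      "b \<in> B \<Longrightarrow> \<exists>s. (\<forall>i \<in> I. s i \<in> S) \<and> b = (\<Sum>i\<in>I. la (s i) (c i))"
begin

text \<open>
  Modulo the relations, scalars move to the first factor, so that every formal sum can be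
  written with one term for each generator.
\<close>

definition normalizable :: "'z \<Rightarrow> bool" where
  "normalizable z \<longleftrightarrow> (\<exists>t. (\<forall>i \<in> I. t i \<in> A) \<and> z - (\<Sum>i\<in>I. \<tau> (t i) (c i)) \<in> K)"

lemma K_uminus: "x \<in> K \<Longrightarrow> - x \<in> K"
  using K(2)[OF K(1), of x] by simp

lemma K_add: "x \<in> K \<Longrightarrow> y \<in> K \<Longrightarrow> x + y \<in> K"
  using K(2)[OF _ K_uminus, of x y] by simp

lemma K_sum: "finite J \<Longrightarrow> (\<And>j. j \<in> J \<Longrightarrow> f j \<in> K) \<Longrightarrow> (\<Sum>j\<in>J. f j) \<in> K"
  by (induction J rule: finite_induct) (simp_all add: K(1) K_add)

lemma B_sum: "finite J \<Longrightarrow> (\<And>j. j \<in> J \<Longrightarrow> f j \<in> B) \<Longrightarrow> (\<Sum>j\<in>J. f j) \<in> B"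
proof (induction J rule: finite_induct)
  case (insert j J)
  have "f j - (0 - (\<Sum>j\<in>J. f j)) \<in> B" using insert by (intro B) auto
  then show ?case using insert by simp
qed (simp add: B(1))

lemma \<tau>_zero: "b \<in> B \<Longrightarrow> \<tau> 0 b \<in> K"
  using K_uminus[OF add_left[OF A(1) A(1), of b]] by simp

lemma \<tau>_sum:
  assumes "finite J" "\<And>j. j \<in> J \<Longrightarrow> f j \<in> B" "a \<in> A"
  shows "\<tau> a (\<Sum>j\<in>J. f j) - (\<Sum>j\<in>J. \<tau> a (f j)) \<in> K"
  using assms(1,2)
proof (induction J rule: finite_induct)
  case empty
  show ?case using K_uminus[OF add_right[OF assms(3) B(1) B(1)]] by simp
next
  case (insert j J)
  have "\<tau> a (f j + (\<Sum>j\<in>J. f j)) - \<tau> a (f j) - \<tau> a (\<Sum>j\<in>J. f j) \<in> K"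
    using insert by (intro add_right assms(3) B_sum) auto
  moreover have "\<tau> a (\<Sum>j\<in>J. f j) - (\<Sum>j\<in>J. \<tau> a (f j)) \<in> K" using insert by simp
  ultimately have "(\<tau> a (f j + (\<Sum>j\<in>J. f j)) - \<tau> a (f j) - \<tau> a (\<Sum>j\<in>J. f j)) +
      (\<tau> a (\<Sum>j\<in>J. f j) - (\<Sum>j\<in>J. \<tau> a (f j))) \<in> K" by (rule K_add)
  then show ?case using insert.hyps by (simp add: algebra_simps)
qed

lemma normalizable_\<tau>:
  assumes a: "a \<in> A" and b: "b \<in> B"
  shows "normalizable (\<tau> a b)"
proof -
  obtain s where s: "\<forall>i \<in> I. s i \<in> S" "b = (\<Sum>i\<in>I. la (s i) (c i))" using I(3)[OF b] by blast
  have 1: "\<tau> a b - (\<Sum>i\<in>I. \<tau> a (la (s i) (c i))) \<in> K"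
    unfolding s(2) using s(1) I act(2) a by (intro \<tau>_sum) auto
  have 2: "(\<Sum>i\<in>I. \<tau> (ra a (s i)) (c i) - \<tau> a (la (s i) (c i))) \<in> K"
    using s(1) I a act(3) by (intro K_sum) auto
  have "\<tau> a b - (\<Sum>i\<in>I. \<tau> (ra a (s i)) (c i)) \<in> K"
    using K(2)[OF 1 2] by (simp add: sum_subtractf)
  then show ?thesis
    unfolding normalizable_def using s(1) act(1) a by (intro exI[of _ "\<lambda>i. ra a (s i)"]) simp
qed

lemma normalizable_diff:
  assumes "normalizable y" "normalizable z"
  shows "normalizable (y - z)"
proof -
  obtain t where t: "\<forall>i \<in> I. t i \<in> A" "y - (\<Sum>i\<in>I. \<tau> (t i) (c i)) \<in> K"
    using assms(1) unfolding normalizable_def by blast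
  obtain t' where t': "\<forall>i \<in> I. t' i \<in> A" "z - (\<Sum>i\<in>I. \<tau> (t' i) (c i)) \<in> K"
    using assms(2) unfolding normalizable_def by blast
  have "(\<Sum>i\<in>I. \<tau> (t i - t' i + t' i) (c i) - \<tau> (t i - t' i) (c i) - \<tau> (t' i) (c i)) \<in> K"
    using t t' I A(2) by (intro K_sum add_left) auto
  from K_add[OF K(2)[OF t(2) t'(2)] this]
  have "y - z - (\<Sum>i\<in>I. \<tau> (t i - t' i) (c i)) \<in> K"
    by (simp add: sum_subtractf sum.distrib algebra_simps)
  then show ?thesis
    unfolding normalizable_def using t(1) t'(1) A(2) by (intro exI[of _ "\<lambda>i. t i - t' i"]) simp
qed

lemma normalizable_zero: "normalizable 0"
  using normalizable_diff[OF normalizable_\<tau>[OF A(1) B(1)] normalizable_\<tau>[OF A(1) B(1)]] by simp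

lemma normalized_zero:
  assumes "z - (\<Sum>i\<in>I. \<tau> (t i) (c i)) \<in> K" "\<And>i. i \<in> I \<Longrightarrow> t i = 0"
  shows "z \<in> K"
proof -
  have "(\<Sum>i\<in>I. \<tau> (t i) (c i)) \<in> K" using assms(2) I by (intro K_sum) (auto simp: \<tau>_zero)
  from K_add[OF assms(1) this] show ?thesis by simp
qed

end

section \<open>Tensor products as functions on fibre products\<close>

lemma keys_frag_extend_subset:
  assumes "Poly_Mapping.keys z \<subseteq> A" "\<And>q. q \<in> A \<Longrightarrow> h q \<in> B"
  shows "Poly_Mapping.keys (frag_extend (\<lambda>q. frag_of (h q)) z) \<subseteq> B"
  using assms(1)
proof (rule frag_induction)
  show "Poly_Mapping.keys (frag_extend (\<lambda>q. frag_of (h q)) (frag_of q)) \<subseteq> B" if "q \<in> A" for q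
    using assms(2)[OF that] by simp
  show "Poly_Mapping.keys (frag_extend (\<lambda>q. frag_of (h q)) (a - b)) \<subseteq> B"
    if "Poly_Mapping.keys (frag_extend (\<lambda>q. frag_of (h q)) a) \<subseteq> B"
      "Poly_Mapping.keys (frag_extend (\<lambda>q. frag_of (h q)) b) \<subseteq> B" for a b
    unfolding frag_extend_diff by (rule order_trans[OF keys_diff Un_least[OF that]])
qed simp

text \<open>
  The reason why the evaluation map of a tensor product is onto, in each degree separately: in a monomial
  the coordinates of the two kinds can be collected.
\<close>

lemma hpoly_split:
  assumes f: "hpoly X e f"
    and split: "\<And>y. y \<in> X \<Longrightarrow> (\<exists>x \<in> X1. \<forall>p \<in> D. x (\<pi>1 p) = y p) \<or> (\<exists>x \<in> X2. \<forall>p \<in> D. x (\<pi>2 p) = y p)"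
  shows "\<exists>ts. (\<forall>(a, b) \<in> set ts. \<exists>d1 d2. d1 + d2 = e \<and> hpoly X1 d1 a \<and> hpoly X2 d2 b) \<and>
    (\<forall>p \<in> D. f p = (\<Sum>(a, b) \<leftarrow> ts. a (\<pi>1 p) * b (\<pi>2 p)))"
  using f
proof induction
  case (const c)
  have "hpoly X1 0 (\<lambda>_. c)" "hpoly X2 0 (\<lambda>_. 1)" by (rule hpoly.const)+
  then show ?case by (intro exI[of _ "[(\<lambda>_. c, \<lambda>_. 1)]"]) auto
next
  case (coord d f y)
  then obtain ts where ts: "\<forall>(a, b) \<in> set ts. \<exists>d1 d2. d1 + d2 = d \<and> hpoly X1 d1 a \<and> hpoly X2 d2 b"
    "\<forall>p \<in> D. f p = (\<Sum>(a, b) \<leftarrow> ts. a (\<pi>1 p) * b (\<pi>2 p))" by blast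
  from split[OF coord.hyps(2)] show ?case
  proof
    assume "\<exists>x \<in> X1. \<forall>p \<in> D. x (\<pi>1 p) = y p"
    then obtain x where x: "x \<in> X1" "\<forall>p \<in> D. x (\<pi>1 p) = y p" by blast
    let ?ts = "map (\<lambda>(a, b). (\<lambda>q. x q * a q, b)) ts"
    have degs: "\<exists>d1 d2. d1 + d2 = Suc d \<and> hpoly X1 d1 a' \<and> hpoly X2 d2 b" if ab: "(a', b) \<in> set ?ts" for a' b
    proof -
      obtain a where a: "(a, b) \<in> set ts" "a' = (\<lambda>q. x q * a q)" using ab by auto
      obtain d1 d2 where d: "d1 + d2 = d" "hpoly X1 d1 a" "hpoly X2 d2 b" using ts(1) a(1) by blast
      show ?thesis
        using d hpoly.coord[OF d(2) x(1)] unfolding a(2)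
        by (intro exI[of _ "Suc d1"] exI[of _ d2]) simp
    qed
    have vals: "y p * f p = (\<Sum>(a, b) \<leftarrow> ?ts. a (\<pi>1 p) * b (\<pi>2 p))" if p: "p \<in> D" for p
    proof -
      have "(\<Sum>(a, b) \<leftarrow> map (\<lambda>(a, b). (\<lambda>q. x q * a q, b)) ts. a (\<pi>1 p) * b (\<pi>2 p)) = y p * (\<Sum>(a, b) \<leftarrow> ts. a (\<pi>1 p) * b (\<pi>2 p))"
        by (induction ts) (use x(2) p in \<open>auto simp: algebra_simps\<close>)
      then show ?thesis using ts(2) p by simp
    qed
    show ?thesis
    proof (intro exI[of _ ?ts] conjI ballI)
      fix t assume "t \<in> set ?ts"
      then show "case t of (a, b) \<Rightarrow> \<exists>d1 d2. d1 + d2 = Suc d \<and> hpoly X1 d1 a \<and> hpoly X2 d2 b"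
        using degs[of "fst t" "snd t"] by (simp only: split_beta prod.collapse)
    qed (rule vals)
  next
    assume "\<exists>x \<in> X2. \<forall>p \<in> D. x (\<pi>2 p) = y p"
    then obtain x where x: "x \<in> X2" "\<forall>p \<in> D. x (\<pi>2 p) = y p" by blast
    let ?ts = "map (\<lambda>(a, b). (a, \<lambda>q. x q * b q)) ts"
    have degs: "\<exists>d1 d2. d1 + d2 = Suc d \<and> hpoly X1 d1 a \<and> hpoly X2 d2 b'" if ab: "(a, b') \<in> set ?ts" for a b'
    proof -
      obtain b where b: "(a, b) \<in> set ts" "b' = (\<lambda>q. x q * b q)" using ab by auto
      obtain d1 d2 where d: "d1 + d2 = d" "hpoly X1 d1 a" "hpoly X2 d2 b" using ts(1) b(1) by blast
      show ?thesis
        using d hpoly.coord[OF d(3) x(1)] unfolding b(2)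
        by (intro exI[of _ d1] exI[of _ "Suc d2"]) simp
    qed
    have vals: "y p * f p = (\<Sum>(a, b) \<leftarrow> ?ts. a (\<pi>1 p) * b (\<pi>2 p))" if p: "p \<in> D" for p
    proof -
      have "(\<Sum>(a, b) \<leftarrow> map (\<lambda>(a, b). (a, \<lambda>q. x q * b q)) ts. a (\<pi>1 p) * b (\<pi>2 p)) = y p * (\<Sum>(a, b) \<leftarrow> ts. a (\<pi>1 p) * b (\<pi>2 p))"
        by (induction ts) (use x(2) p in \<open>auto simp: algebra_simps\<close>)
      then show ?thesis using ts(2) p by simp
    qed
    show ?thesis
    proof (intro exI[of _ ?ts] conjI ballI)
      fix t assume "t \<in> set ?ts"
      then show "case t of (a, b) \<Rightarrow> \<exists>d1 d2. d1 + d2 = Suc d \<and> hpoly X1 d1 a \<and> hpoly X2 d2 b"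
        using degs[of "fst t" "snd t"] by (simp only: split_beta prod.collapse)
    qed (rule vals)
  qed
next
  case (add d f g)
  then obtain ts us where
    "\<forall>(a, b) \<in> set ts. \<exists>d1 d2. d1 + d2 = d \<and> hpoly X1 d1 a \<and> hpoly X2 d2 b"
    "\<forall>p \<in> D. f p = (\<Sum>(a, b) \<leftarrow> ts. a (\<pi>1 p) * b (\<pi>2 p))"
    "\<forall>(a, b) \<in> set us. \<exists>d1 d2. d1 + d2 = d \<and> hpoly X1 d1 a \<and> hpoly X2 d2 b"
    "\<forall>p \<in> D. g p = (\<Sum>(a, b) \<leftarrow> us. a (\<pi>1 p) * b (\<pi>2 p))" by (elim exE conjE)
  then show ?case by (intro exI[of _ "ts @ us"]) auto
qed

text \<open>
  \<open>M\<close> and \<open>N\<close> are copies of function bimodules on \<open>D1\<close> and \<open>D2\<close>, and \<open>D\<close> plays the part of the fibre product over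
  the common point: the assumption \<open>middle\<close> says that the scalars of the tensor product cannot
  distinguish the two images of a point of \<open>D\<close>. The last three assumptions identify the
  coordinates on \<open>D\<close> with those pulled back along the projections.
\<close>

locale fibre_tensor =
  T: fun_model n X D l r
  for n :: nat and X :: "('p \<Rightarrow> 'k::field_char_0) set" and D :: "'p set" and l r :: "'p \<Rightarrow> nat \<Rightarrow> 'k" +
  fixes M :: "((nat \<Rightarrow> 'k) \<Rightarrow> 'k, 'a tens) gbimod" and N :: "((nat \<Rightarrow> 'k) \<Rightarrow> 'k, 'a tens) gbimod"
    and S :: "((nat \<Rightarrow> 'k) \<Rightarrow> 'k) set" and \<phi> \<psi>
    and X1 :: "('p1 \<Rightarrow> 'k) set" and D1 l1 r1
    and X2 :: "('p2 \<Rightarrow> 'k) set" and D2 l2 r2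
    and \<pi>1 :: "'p \<Rightarrow> 'p1" and \<pi>2 :: "'p \<Rightarrow> 'p2"
  assumes isoM: "gb_iso (carrier (R_bar n)) \<phi> M (fun_bimod X1 D1 l1 r1)"
    and isoN: "gb_iso (carrier (R_bar n)) \<psi> N (fun_bimod X2 D2 l2 r2)"
    and proj: "p \<in> D \<Longrightarrow> \<pi>1 p \<in> D1" "p \<in> D \<Longrightarrow> \<pi>2 p \<in> D2"
    and outer: "p \<in> D \<Longrightarrow> l p = l1 (\<pi>1 p)" "p \<in> D \<Longrightarrow> r p = r2 (\<pi>2 p)"
    and middle: "s \<in> S \<Longrightarrow> p \<in> D \<Longrightarrow> s (r1 (\<pi>1 p)) = s (l2 (\<pi>2 p))"
    and S_right: "s \<in> S \<Longrightarrow> m \<in> carrier M \<Longrightarrow> rsmult M m s \<in> carrier M"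
      "s \<in> S \<Longrightarrow> m \<in> carrier M \<Longrightarrow> \<phi> (rsmult M m s) = (\<lambda>q. s (r1 q) * \<phi> m q)"
    and S_left: "s \<in> S \<Longrightarrow> m' \<in> carrier N \<Longrightarrow> smult N s m' \<in> carrier N"
      "s \<in> S \<Longrightarrow> m' \<in> carrier N \<Longrightarrow> \<psi> (smult N s m') = (\<lambda>q. s (l2 q) * \<psi> m' q)"
    and pull1: "x \<in> X1 \<Longrightarrow> \<exists>y \<in> X. \<forall>p \<in> D. x (\<pi>1 p) = y p"
    and pull2: "x' \<in> X2 \<Longrightarrow> \<exists>y \<in> X. \<forall>p \<in> D. x' (\<pi>2 p) = y p"
    and split: "y \<in> X \<Longrightarrow> (\<exists>x \<in> X1. \<forall>p \<in> D. x (\<pi>1 p) = y p) \<or> (\<exists>x \<in> X2. \<forall>p \<in> D. x (\<pi>2 p) = y p)"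
begin

abbreviation "G \<equiv> free_Abelian_group (carrier M \<times> carrier N)"
abbreviation "K \<equiv> generate G (tensor_rels S M N)"

lemmas M = gb_isoD[OF isoM] and N = gb_isoD[OF isoN]
  and invM = gb_iso_inv[OF isoM] and invN = gb_iso_inv[OF isoN]

text \<open>
  The map from formal sums of pairs to functions on the fibre product that sends \<open>(m, u)\<close> to the product of
  the two functions. It induces the isomorphism from the tensor product.
\<close>

definition ev :: "(('a tens \<times> 'a tens) \<Rightarrow>\<^sub>0 int) \<Rightarrow> 'p \<Rightarrow> 'k" where
  "ev z p = (if p \<in> D then \<Sum>q \<in> Poly_Mapping.keys z.
     of_int (Poly_Mapping.lookup z q) * (\<phi> (fst q) (\<pi>1 p) * \<psi> (snd q) (\<pi>2 p)) else 0)"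

lemma ev_superset:
  assumes "finite A" "Poly_Mapping.keys z \<subseteq> A" "p \<in> D"
  shows "ev z p = (\<Sum>q\<in>A. of_int (Poly_Mapping.lookup z q) * (\<phi> (fst q) (\<pi>1 p) * \<psi> (snd q) (\<pi>2 p)))"
  unfolding ev_def using assms
  by (simp, intro sum.mono_neutral_left) (auto simp: in_keys_iff)

lemma ev_diff: "ev (a - b) = (\<lambda>p. ev a p - ev b p)"
proof
  fix p
  let ?A = "Poly_Mapping.keys a \<union> Poly_Mapping.keys b"
  show "ev (a - b) p = ev a p - ev b p"
  proof (cases "p \<in> D")
    case True
    have "finite ?A" by simp
    moreover have "Poly_Mapping.keys (a - b) \<subseteq> ?A" by (rule keys_diff)
    ultimately show ?thesis
      using True by (simp add: ev_superset[of ?A] lookup_minus left_diff_distrib sum_subtractf)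
  qed (simp add: ev_def)
qed

lemma ev_zero [simp]: "ev 0 = (\<lambda>_. 0)"
  by (simp add: ev_def fun_eq_iff)

lemma ev_add: "ev (a + b) = (\<lambda>p. ev a p + ev b p)"
  using ev_diff[of a "0 - b"] ev_diff[of 0 b] by simp

lemma ev_uminus: "ev (- a) = (\<lambda>p. - ev a p)"
  using ev_diff[of 0 a] by simp

lemma ev_frag_of: "ev (frag_of q) = (\<lambda>p. if p \<in> D then \<phi> (fst q) (\<pi>1 p) * \<psi> (snd q) (\<pi>2 p) else 0)"
  by (simp add: ev_def fun_eq_iff)

lemma ev_sum: "ev (\<Sum>i\<in>I. f i) = (\<lambda>p. \<Sum>i\<in>I. ev (f i) p)"
  by (induction I rule: infinite_finite_induct) (simp_all add: ev_add)

lemma carrier_G: "z \<in> carrier G \<longleftrightarrow> Poly_Mapping.keys z \<subseteq> carrier M \<times> carrier N"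
  by (simp add: carrier_free_Abelian_group_iff)

lemma rels_cases:
  assumes "z \<in> tensor_rels S M N"
  obtains (left) m m' u where "m \<in> carrier M" "m' \<in> carrier M" "u \<in> carrier N"
      "z = frag_of (m \<oplus>\<^bsub>M\<^esub> m', u) - frag_of (m, u) - frag_of (m', u)"
    | (right) m u u' where "m \<in> carrier M" "u \<in> carrier N" "u' \<in> carrier N"
      "z = frag_of (m, u \<oplus>\<^bsub>N\<^esub> u') - frag_of (m, u) - frag_of (m, u')"
    | (act) m s u where "m \<in> carrier M" "s \<in> S" "u \<in> carrier N"
      "z = frag_of (rsmult M m s, u) - frag_of (m, smult N s u)"
  using assms unfolding tensor_rels_def by (elim UnE CollectE exE conjE)

lemma rels_subset: "tensor_rels S M N \<subseteq> carrier G"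
proof
  fix z assume "z \<in> tensor_rels S M N"
  then show "z \<in> carrier G"
    unfolding carrier_G
    by (cases rule: rels_cases)
      (simp_all add: M(7) N(7) S_left S_right, (intro order_trans[OF keys_diff] Un_least; simp add: M(7) N(7) S_left S_right)+)
qed

lemma group_G: "group G"
  by simp

lemma subgroup_K: "subgroup K G"
  using group.generate_is_subgroup[OF group_G rels_subset] .

lemma K_diff: "x \<in> K \<Longrightarrow> y \<in> K \<Longrightarrow> x - y \<in> K"
proof -
  assume x: "x \<in> K" and y: "y \<in> K"
  have "y \<in> carrier G" using subgroup.mem_carrier[OF subgroup_K y] .
  then have "inv\<^bsub>G\<^esub> y = - y" by (simp add: carrier_free_Abelian_group_iff)
  then show ?thesis
    using subgroup.m_closed[OF subgroup_K x subgroup.m_inv_closed[OF subgroup_K y]] by simp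
qed

lemma K_zero: "0 \<in> K"
  using subgroup.one_closed[OF subgroup_K] by simp

lemma ev_rels:
  assumes "z \<in> tensor_rels S M N"
  shows "ev z = (\<lambda>_. 0)"
  using assms
proof (cases rule: rels_cases)
  case (left m m' u)
  then show ?thesis by (simp add: ev_diff ev_frag_of M(8) distrib_right fun_eq_iff)
next
  case (right m u u')
  then show ?thesis by (simp add: ev_diff ev_frag_of N(8) distrib_left fun_eq_iff)
next
  case (act m s u)
  then show ?thesis by (simp add: ev_diff ev_frag_of S_left S_right middle fun_eq_iff)
qed

lemma ev_K: "z \<in> K \<Longrightarrow> ev z = (\<lambda>_. 0)"
proof (induction z rule: generate.induct)
  case (inv h)
  then have "h \<in> carrier G" using rels_subset by blast
  then show ?case using ev_rels[OF inv] by (simp add: ev_uminus carrier_free_Abelian_group_iff)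
qed (simp_all add: ev_rels ev_add)

abbreviation "A1 \<equiv> ext0 D1 ` polys X1"
abbreviation "A2 \<equiv> ext0 D2 ` polys X2"

definition tau :: "('p1 \<Rightarrow> 'k) \<Rightarrow> ('p2 \<Rightarrow> 'k) \<Rightarrow> ('a tens \<times> 'a tens) \<Rightarrow>\<^sub>0 int" where
  "tau f g = frag_of (inv_into (carrier M) \<phi> f, inv_into (carrier N) \<psi> g)"

lemma ev_tau:
  assumes "f \<in> A1" "g \<in> A2"
  shows "ev (tau f g) = (\<lambda>p. if p \<in> D then f (\<pi>1 p) * g (\<pi>2 p) else 0)"
  using assms invM(2)[of f] invN(2)[of g] by (simp add: tau_def ev_frag_of fun_eq_iff)

lemma tau_relations:
  shows "f \<in> A1 \<Longrightarrow> f' \<in> A1 \<Longrightarrow> g \<in> A2 \<Longrightarrow> tau (f + f') g - tau f g - tau f' g \<in> K"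
    and "f \<in> A1 \<Longrightarrow> g \<in> A2 \<Longrightarrow> g' \<in> A2 \<Longrightarrow> tau f (g + g') - tau f g - tau f g' \<in> K"
    and "s \<in> S \<Longrightarrow> f \<in> A1 \<Longrightarrow> g \<in> A2 \<Longrightarrow>
      tau (\<lambda>q. s (r1 q) * f q) g - tau f (\<lambda>q. s (l2 q) * g q) \<in> K"
proof -
  let ?i = "inv_into (carrier M) \<phi>" and ?j = "inv_into (carrier N) \<psi>"
  have i: "?i f \<in> carrier M" "\<phi> (?i f) = f" if "f \<in> A1" for f using invM that by simp_all
  have j: "?j g \<in> carrier N" "\<psi> (?j g) = g" if "g \<in> A2" for g using invN that by simp_all
  have i_eq: "?i (\<phi> m) = m" if "m \<in> carrier M" for m using invM that by simp
  have j_eq: "?j (\<psi> m) = m" if "m \<in> carrier N" for m using invN that by simp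
  have rel: "z \<in> K" if "z \<in> tensor_rels S M N" for z using that by (rule generate.incl)
  {
    assume f: "f \<in> A1" "f' \<in> A1" and g: "g \<in> A2"
    have "?i (f + f') = ?i f \<oplus>\<^bsub>M\<^esub> ?i f'"
      using i_eq[of "?i f \<oplus>\<^bsub>M\<^esub> ?i f'"] i[OF f(1)] i[OF f(2)] by (simp add: M plus_fun_def)
    then show "tau (f + f') g - tau f g - tau f' g \<in> K"
      unfolding tau_def tensor_rels_def using i(1)[OF f(1)] i(1)[OF f(2)] j(1)[OF g]
      by (intro generate.incl UnI1 CollectI exI[of _ "?i f"] exI[of _ "?i f'"] exI[of _ "?j g"]) simp
  next
    assume f: "f \<in> A1" and g: "g \<in> A2" "g' \<in> A2"
    have "?j (g + g') = ?j g \<oplus>\<^bsub>N\<^esub> ?j g'"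
      using j_eq[of "?j g \<oplus>\<^bsub>N\<^esub> ?j g'"] j[OF g(1)] j[OF g(2)] by (simp add: N plus_fun_def)
    then show "tau f (g + g') - tau f g - tau f g' \<in> K"
      unfolding tau_def tensor_rels_def using j(1)[OF g(1)] j(1)[OF g(2)] i(1)[OF f]
      by (intro generate.incl UnI1 UnI2 CollectI exI[of _ "?i f"] exI[of _ "?j g"] exI[of _ "?j g'"]) simp
  next
    assume s: "s \<in> S" and f: "f \<in> A1" and g: "g \<in> A2"
    have "?i (\<lambda>q. s (r1 q) * f q) = rsmult M (?i f) s"
      using i_eq[of "rsmult M (?i f) s"] i[OF f] s by (simp add: S_right)
    moreover have "?j (\<lambda>q. s (l2 q) * g q) = smult N s (?j g)"
      using j_eq[of "smult N s (?j g)"] j[OF g] s by (simp add: S_left)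
    ultimately show "tau (\<lambda>q. s (r1 q) * f q) g - tau f (\<lambda>q. s (l2 q) * g q) \<in> K"
      unfolding tau_def tensor_rels_def using j(1)[OF g] i(1)[OF f] s
      by (intro generate.incl UnI2 CollectI exI[of _ "?i f"] exI[of _ s] exI[of _ "?j g"]) simp
  }
qed

lemma right_act_closed: "s \<in> S \<Longrightarrow> f \<in> A1 \<Longrightarrow> (\<lambda>q. s (r1 q) * f q) \<in> A1"
  using S_right[of s "inv_into (carrier M) \<phi> f"] invM(1,2)[of f] M(6)[of "rsmult M (inv_into (carrier M) \<phi> f) s"]
  by simp

lemma left_act_closed: "s \<in> S \<Longrightarrow> g \<in> A2 \<Longrightarrow> (\<lambda>q. s (l2 q) * g q) \<in> A2"
  using S_left[of s "inv_into (carrier N) \<psi> g"] invN(1,2)[of g] N(6)[of "smult N s (inv_into (carrier N) \<psi> g)"]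
  by simp

lemma A_zero: "0 \<in> ext0 E ` polys (Y :: ('q \<Rightarrow> 'k) set)"
  using zero_in_ext0_polys by (simp add: zero_fun_def)

lemma A_diff: "f \<in> ext0 E ` polys (Y :: ('q \<Rightarrow> 'k) set) \<Longrightarrow> g \<in> ext0 E ` polys Y \<Longrightarrow> f - g \<in> ext0 E ` polys Y"
  using ext0_polys_closed(2)[of f E Y g] by (simp add: fun_diff_def)

lemma sum_fun_eq: "(\<Sum>i\<in>I. f i) = (\<lambda>q. \<Sum>i\<in>I. f i q)" for f :: "'i \<Rightarrow> 'q \<Rightarrow> 'k"
  by (induction I rule: infinite_finite_induct) (simp_all add: plus_fun_def zero_fun_def)

lemma normalizable_carrier_G:
  assumes z: "z \<in> carrier G"
    and tau: "\<And>f g. f \<in> A1 \<Longrightarrow> g \<in> A2 \<Longrightarrow> P (tau f g)"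
    and zero: "P 0" and diff: "\<And>y z. P y \<Longrightarrow> P z \<Longrightarrow> P (y - z)"
  shows "P z"
  using z[unfolded carrier_G]
proof (rule frag_induction)
  fix q assume q: "q \<in> carrier M \<times> carrier N"
  obtain x y where xy: "q = (x, y)" "x \<in> carrier M" "y \<in> carrier N" using q by auto
  have "tau (\<phi> x) (\<psi> y) = frag_of q" using xy invM(3) invN(3) by (simp add: tau_def)
  moreover have "\<phi> x \<in> A1" "\<psi> y \<in> A2" using M(6)[OF xy(2)] N(6)[OF xy(3)] by simp_all
  ultimately show "P (frag_of q)" using tau[of "\<phi> x" "\<psi> y"] by simp
qed (use zero diff in auto)

text \<open>
  A formal sum in the kernel is congruent to one with a single term \<open>t i \<otimes> c i\<close> per generator. Fixing the
  point of the left factor and letting the point of the right factor vary, independence at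
  the common point forces every \<open>t i\<close> to vanish at the fixed point.
\<close>

lemma kernel_left_basis:
  assumes I: "finite I" "\<And>i. i \<in> I \<Longrightarrow> c i \<in> A2"
    and gen: "\<And>g. g \<in> A2 \<Longrightarrow> \<exists>s. (\<forall>i \<in> I. s i \<in> S) \<and> g = (\<lambda>q. \<Sum>i\<in>I. s i (l2 q) * c i q)"
    and indep: "\<And>q \<gamma> i. q \<in> D1 \<Longrightarrow> (\<And>p. p \<in> D \<Longrightarrow> \<pi>1 p = q \<Longrightarrow> (\<Sum>i\<in>I. \<gamma> i * c i (\<pi>2 p)) = 0) \<Longrightarrow>
      i \<in> I \<Longrightarrow> \<gamma> i = 0"
    and z: "z \<in> carrier G" "ev z = (\<lambda>_. 0)"
  shows "z \<in> K"
proof -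
  interpret b: balanced_map K A1 A2 tau S "\<lambda>f s q. s (r1 q) * f q" "\<lambda>s g q. s (l2 q) * g q" I c
  proof unfold_locales
    show "\<exists>s. (\<forall>i\<in>I. s i \<in> S) \<and> g = (\<Sum>i\<in>I. (\<lambda>q. s i (l2 q) * c i q))" if "g \<in> A2" for g
      using gen[OF that] by (simp add: sum_fun_eq)
  qed (fact K_zero K_diff A_zero A_diff tau_relations right_act_closed left_act_closed I)+
  have "b.normalizable z"
    by (rule normalizable_carrier_G[OF z(1)])
      (fact b.normalizable_\<tau> b.normalizable_zero b.normalizable_diff)+
  then obtain t where t: "\<forall>i \<in> I. t i \<in> A1" "z - (\<Sum>i\<in>I. tau (t i) (c i)) \<in> K"
    unfolding b.normalizable_def by blast
  have ev0: "(\<Sum>i\<in>I. t i (\<pi>1 p) * c i (\<pi>2 p)) = 0" if "p \<in> D" for p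
  proof -
    have "ev (z - (\<Sum>i\<in>I. tau (t i) (c i))) p = 0" using ev_K[OF t(2)] by simp
    then have "(\<Sum>i\<in>I. ev (tau (t i) (c i)) p) = 0" using z(2) by (simp add: ev_diff ev_sum)
    then show ?thesis using t(1) I(2) that by (simp add: ev_tau)
  qed
  have "t i = 0" if i: "i \<in> I" for i
  proof
    fix q show "t i q = 0 q"
    proof (cases "q \<in> D1")
      case True
      have "t i q = 0" by (rule indep[OF True _ i]) (use ev0 in auto)
      then show ?thesis by simp
    next
      case False
      then show ?thesis using t(1) i by (auto simp: ext0_def)
    qed
  qed
  then show ?thesis by (rule b.normalized_zero[OF t(2)])
qed

text \<open>
  The same argument with the factors exchanged.
\<close>

lemma kernel_right_basis:
  assumes I: "finite I" "\<And>i. i \<in> I \<Longrightarrow> c i \<in> A1"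
    and gen: "\<And>f. f \<in> A1 \<Longrightarrow> \<exists>s. (\<forall>i \<in> I. s i \<in> S) \<and> f = (\<lambda>q. \<Sum>i\<in>I. s i (r1 q) * c i q)"
    and indep: "\<And>q \<gamma> i. q \<in> D2 \<Longrightarrow> (\<And>p. p \<in> D \<Longrightarrow> \<pi>2 p = q \<Longrightarrow> (\<Sum>i\<in>I. \<gamma> i * c i (\<pi>1 p)) = 0) \<Longrightarrow>
      i \<in> I \<Longrightarrow> \<gamma> i = 0"
    and z: "z \<in> carrier G" "ev z = (\<lambda>_. 0)"
  shows "z \<in> K"
proof -
  interpret b: balanced_map K A2 A1 "\<lambda>g f. tau f g" S "\<lambda>g s q. s (l2 q) * g q" "\<lambda>s f q. s (r1 q) * f q" I c
  proof unfold_locales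
    show "\<exists>s. (\<forall>i\<in>I. s i \<in> S) \<and> f = (\<Sum>i\<in>I. (\<lambda>q. s i (r1 q) * c i q))" if "f \<in> A1" for f
      using gen[OF that] by (simp add: sum_fun_eq)
    show "tau f (\<lambda>q. s (l2 q) * g q) - tau (\<lambda>q. s (r1 q) * f q) g \<in> K" if "s \<in> S" "g \<in> A2" "f \<in> A1" for s f g
      using K_diff[OF K_zero tau_relations(3)[OF that(1,3,2)]] by simp
    show "tau f (g + g') - tau f g - tau f g' \<in> K" if "g \<in> A2" "g' \<in> A2" "f \<in> A1" for f g g'
      by (rule tau_relations(2)[OF that(3,1,2)])
    show "tau (f + f') g - tau f g - tau f' g \<in> K" if "g \<in> A2" "f \<in> A1" "f' \<in> A1" for f f' g
      by (rule tau_relations(1)[OF that(2,3,1)])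
  qed (fact K_zero K_diff A_zero A_diff right_act_closed left_act_closed I)+
  have "b.normalizable z"
    by (rule normalizable_carrier_G[OF z(1)])
      (fact b.normalizable_\<tau>[rotated] b.normalizable_zero b.normalizable_diff)+
  then obtain t where t: "\<forall>i \<in> I. t i \<in> A2" "z - (\<Sum>i\<in>I. tau (c i) (t i)) \<in> K"
    unfolding b.normalizable_def by blast
  have ev0: "(\<Sum>i\<in>I. t i (\<pi>2 p) * c i (\<pi>1 p)) = 0" if "p \<in> D" for p
  proof -
    have "ev (z - (\<Sum>i\<in>I. tau (c i) (t i))) p = 0" using ev_K[OF t(2)] by simp
    then have "(\<Sum>i\<in>I. ev (tau (c i) (t i)) p) = 0" using z(2) by (simp add: ev_diff ev_sum)
    then show ?thesis using t(1) I(2) that by (simp add: ev_tau mult.commute)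
  qed
  have "t i = 0" if i: "i \<in> I" for i
  proof
    fix q show "t i q = 0 q"
    proof (cases "q \<in> D2")
      case True
      have "t i q = 0" by (rule indep[OF True _ i]) (use ev0 in auto)
      then show ?thesis by simp
    next
      case False
      then show ?thesis using t(1) i by (auto simp: ext0_def)
    qed
  qed
  then show ?thesis by (rule b.normalized_zero[OF t(2)])
qed

end

context fibre_tensor
begin

declare carrier_free_Abelian_group_iff [simp del]

abbreviation "TT \<equiv> fun_bimod X D l r"
abbreviation "Q \<equiv> tensor_quot S M N"

lemma G_diff: "a \<in> carrier G \<Longrightarrow> b \<in> carrier G \<Longrightarrow> a - b \<in> carrier G"
  unfolding carrier_G by (rule order_trans[OF keys_diff Un_least])

lemma G_zero: "0 \<in> carrier G"
  by (simp add: carrier_G)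

lemma G_add: "a \<in> carrier G \<Longrightarrow> b \<in> carrier G \<Longrightarrow> a + b \<in> carrier G"
  using G_diff[of a "0 - b"] G_diff[OF G_zero, of b] by simp

lemma product_in_carrier:
  assumes "f \<in> A1" "g \<in> A2"
  shows "(\<lambda>p. if p \<in> D then f (\<pi>1 p) * g (\<pi>2 p) else 0) \<in> carrier TT"
proof -
  obtain f' g' where f: "f' \<in> polys X1" "f = ext0 D1 f'" and g: "g' \<in> polys X2" "g = ext0 D2 g'"
    using assms by blast
  obtain f'' where f'': "f'' \<in> polys X" "\<forall>p \<in> D. f' (\<pi>1 p) = f'' p"
    using polys_subst[where \<pi> = \<pi>1 and D = D and Y = X, OF f(1) pull1] by blast
  obtain g'' where g'': "g'' \<in> polys X" "\<forall>p \<in> D. g' (\<pi>2 p) = g'' p"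
    using polys_subst[where \<pi> = \<pi>2 and D = D and Y = X, OF g(1) pull2] by blast
  have "(\<lambda>p. if p \<in> D then f (\<pi>1 p) * g (\<pi>2 p) else 0) = ext0 D (\<lambda>p. f'' p * g'' p)"
    using f''(2) g''(2) proj by (simp add: f g ext0_def fun_eq_iff)
  then show ?thesis using polys_mult[OF f''(1) g''(1)] by simp
qed

lemma ev_in_carrier:
  assumes "z \<in> carrier G"
  shows "ev z \<in> carrier TT"
proof (rule normalizable_carrier_G[OF assms])
  show "ev (tau f g) \<in> carrier TT" if "f \<in> A1" "g \<in> A2" for f g
    using product_in_carrier[OF that] ev_tau[OF that] by simp
  show "ev (y - z) \<in> carrier TT" if "ev y \<in> carrier TT" "ev z \<in> carrier TT" for y z
    using that unfolding ev_diff fun_bimod_simps by (rule ext0_polys_closed)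
qed (simp add: zero_in_ext0_polys)

abbreviation "H d \<equiv> {frag_of (x, y) | x y a b. a + b = d \<and> x \<in> hcomp M a \<and> y \<in> hcomp N b}"

lemma H_subset: "H d \<subseteq> carrier G"
  using subsetD[OF M(13)] subsetD[OF N(13)] by (auto simp: carrier_G)

text \<open>
  The homogeneous components of the tensor product are generated by products of homogeneous
  elements; under \<open>ev\<close> these are all homogeneous functions, by \<open>hpoly_split\<close>.
\<close>

lemma ev_generate_H: "ev ` generate G (H d) = hcomp TT d"
proof (intro equalityI subsetI)
  fix f assume "f \<in> ev ` generate G (H d)"
  then obtain z where z: "z \<in> generate G (H d)" "f = ev z" by blast
  have gen: "ev h \<in> hcomp TT d" if h0: "h \<in> H d" for h
  proof -
    obtain x y a b where h: "h = frag_of (x, y)" "a + b = d" "x \<in> hcomp M a" "y \<in> hcomp N b"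
      using h0 by blast
    have "\<phi> x \<in> hcomp (fun_bimod X1 D1 l1 r1) a" "\<psi> y \<in> hcomp (fun_bimod X2 D2 l2 r2) b"
      using M(14)[of a] N(14)[of b] h by blast+
    then consider "\<phi> x = (\<lambda>_. 0)" | "\<psi> y = (\<lambda>_. 0)"
      | f g d1 d2 where "\<phi> x = ext0 D1 f" "a = 2 * int d1" "hpoly X1 d1 f"
        "\<psi> y = ext0 D2 g" "b = 2 * int d2" "hpoly X2 d2 g" by auto
    then show ?thesis
    proof cases
      case 3
      obtain f' where f': "hpoly X d1 f'" "\<forall>p \<in> D. f (\<pi>1 p) = f' p"
        using hpoly_subst[where \<pi> = \<pi>1 and D = D and Y = X, OF 3(3) pull1] by blast
      obtain g' where g': "hpoly X d2 g'" "\<forall>p \<in> D. g (\<pi>2 p) = g' p"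
        using hpoly_subst[where \<pi> = \<pi>2 and D = D and Y = X, OF 3(6) pull2] by blast
      have "ev h = ext0 D (\<lambda>p. f' p * g' p)"
        using f'(2) g'(2) proj by (simp add: h ev_frag_of 3 ext0_def fun_eq_iff)
      moreover have "d = 2 * int (d1 + d2)" using h 3 by simp
      ultimately show ?thesis using T.hcompI[OF hpoly_mult[OF f'(1) g'(1)]] by simp
    qed (simp_all add: h(1) ev_frag_of fun_eq_iff)
  qed
  from z(1) have "ev z \<in> hcomp TT d"
  proof (induction z rule: generate.induct)
    case (inv h)
    then have "h \<in> carrier G" using H_subset by blast
    then have "inv\<^bsub>G\<^esub> h = - h" by (simp add: carrier_free_Abelian_group_iff)
    then show ?case using T.hcomp_cmult[OF gen[OF inv], of "-1"] by (simp only: ev_uminus) simp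
  next
    case (eng h1 h2)
    from T.hcomp_add[OF eng.IH] show ?case by (simp only: ev_add mult_free_Abelian_group)
  qed (use gen in simp_all)
  then show "f \<in> hcomp TT d" using z(2) by simp
next
  have inv_hM: "inv_into (carrier M) \<phi> f \<in> hcomp M a" if "f \<in> hcomp (fun_bimod X1 D1 l1 r1) a" for f a
  proof -
    have "f \<in> \<phi> ` hcomp M a" using that M(14)[of a] by simp
    then obtain x where x: "x \<in> hcomp M a" "f = \<phi> x" by (rule imageE)
    then show ?thesis using invM(3) M(13)[of a] by auto
  qed
  have inv_hN: "inv_into (carrier N) \<psi> f \<in> hcomp N a" if "f \<in> hcomp (fun_bimod X2 D2 l2 r2) a" for f a
  proof -
    have "f \<in> \<psi> ` hcomp N a" using that N(14)[of a] by simp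
    then obtain x where x: "x \<in> hcomp N a" "f = \<psi> x" by (rule imageE)
    then show ?thesis using invN(3) N(13)[of a] by auto
  qed
  fix f assume "f \<in> hcomp TT d"
  then consider "f = (\<lambda>_. 0)" | f' e where "f = ext0 D f'" "d = 2 * int e" "hpoly X e f'" by auto
  then show "f \<in> ev ` generate G (H d)"
  proof cases
    case 1
    have "0 \<in> generate G (H d)" using generate.one[of G "H d"] by simp
    then show ?thesis using 1 by (intro image_eqI[of _ _ 0]) simp_all
  next
    case 2
    obtain ts where ts: "\<forall>(a, b) \<in> set ts. \<exists>d1 d2. d1 + d2 = e \<and> hpoly X1 d1 a \<and> hpoly X2 d2 b"
      "\<forall>p \<in> D. f' p = (\<Sum>(a, b) \<leftarrow> ts. a (\<pi>1 p) * b (\<pi>2 p))"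
      using hpoly_split[OF 2(3) split] by blast
    have "\<exists>z \<in> generate G (H d). ev z = ext0 D (\<lambda>p. \<Sum>(a, b) \<leftarrow> ts. a (\<pi>1 p) * b (\<pi>2 p))"
      using ts(1)
    proof (induction ts)
      case Nil
      have "0 \<in> generate G (H d)" using generate.one[of G "H d"] by simp
      then show ?case by (intro bexI[of _ 0]) simp_all
    next
      case (Cons t ts)
      obtain a b where t: "t = (a, b)" by (cases t)
      obtain z where z: "z \<in> generate G (H d)"
        "ev z = ext0 D (\<lambda>p. \<Sum>(a, b) \<leftarrow> ts. a (\<pi>1 p) * b (\<pi>2 p))" using Cons by auto
      obtain d1 d2 where d: "d1 + d2 = e" "hpoly X1 d1 a" "hpoly X2 d2 b" using Cons.prems t by auto
      have "ext0 D1 a \<in> hcomp (fun_bimod X1 D1 l1 r1) (2 * int d1)"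
        "ext0 D2 b \<in> hcomp (fun_bimod X2 D2 l2 r2) (2 * int d2)" using d by auto
      from inv_hM[OF this(1)] inv_hN[OF this(2)] have "tau (ext0 D1 a) (ext0 D2 b) \<in> H d"
        unfolding tau_def using d(1) 2(2)
        by (intro CollectI exI[of _ "inv_into (carrier M) \<phi> (ext0 D1 a)"]
            exI[of _ "inv_into (carrier N) \<psi> (ext0 D2 b)"] exI[of _ "2 * int d1"] exI[of _ "2 * int d2"]) simp
      then have "tau (ext0 D1 a) (ext0 D2 b) + z \<in> generate G (H d)"
        using generate.eng[OF generate.incl z(1), of "tau (ext0 D1 a) (ext0 D2 b)"] by simp
      moreover have "ev (tau (ext0 D1 a) (ext0 D2 b)) = (\<lambda>p. if p \<in> D then ext0 D1 a (\<pi>1 p) * ext0 D2 b (\<pi>2 p) else 0)"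
        using d(2,3) by (intro ev_tau imageI polys.homog)
      then have "ev (tau (ext0 D1 a) (ext0 D2 b) + z) = ext0 D (\<lambda>p. \<Sum>(a, b) \<leftarrow> t # ts. a (\<pi>1 p) * b (\<pi>2 p))"
        using proj by (simp add: ev_add z(2) t ext0_def fun_eq_iff)
      ultimately show ?case by blast
    qed
    then obtain z where z: "z \<in> generate G (H d)"
      "ev z = ext0 D (\<lambda>p. \<Sum>(a, b) \<leftarrow> ts. a (\<pi>1 p) * b (\<pi>2 p))" by blast
    have "ev z = f" unfolding z(2) 2(1) using ts(2) by (intro ext0_cong) simp
    then show ?thesis using z(1) by blast
  qed
qed

lemma ev_surj:
  assumes "f \<in> carrier TT"
  shows "\<exists>z \<in> carrier G. ev z = f"
proof -
  obtain f' where f': "f' \<in> polys X" "f = ext0 D f'" using assms by auto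
  from f'(1) have "\<exists>z \<in> carrier G. ev z = ext0 D f'"
  proof induction
    case (homog d f)
    have "ext0 D f \<in> ev ` generate G (H (2 * int d))" unfolding ev_generate_H by (rule T.hcompI[OF homog])
    then obtain z where "z \<in> generate G (H (2 * int d))" "ev z = ext0 D f" by auto
    then show ?case using group.generate_in_carrier[OF group_G H_subset] by blast
  next
    case (add f g)
    then obtain y z where "y \<in> carrier G" "ev y = ext0 D f" "z \<in> carrier G" "ev z = ext0 D g" by blast
    then show ?case by (intro bexI[of _ "y + z"] G_add) (auto simp: ev_add ext0_def)
  qed
  then show ?thesis using f'(2) by simp
qed

text \<open>
  Once the relations are known to be the whole kernel of \<open>ev\<close>, the elements of the tensor product are the
  fibres of \<open>ev\<close>.
\<close>

definition cls :: "('p \<Rightarrow> 'k) \<Rightarrow> (('a tens \<times> 'a tens) \<Rightarrow>\<^sub>0 int) set" where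
  "cls f = {z \<in> carrier G. ev z = f}"

context
  assumes kernel: "\<And>z. z \<in> carrier G \<Longrightarrow> ev z = (\<lambda>_. 0) \<Longrightarrow> z \<in> K"
begin

lemma K_eq: "K = cls (\<lambda>_. 0)"
  using kernel ev_K subgroup.mem_carrier[OF subgroup_K] by (auto simp: cls_def)

lemma K_coset:
  assumes "z \<in> carrier G"
  shows "K #>\<^bsub>G\<^esub> z = cls (ev z)"
proof (intro equalityI subsetI)
  fix y assume "y \<in> K #>\<^bsub>G\<^esub> z"
  then obtain k where "k \<in> K" "y = k + z" by (auto simp: r_coset_def)
  then show "y \<in> cls (ev z)" using assms by (simp add: K_eq cls_def ev_add G_add)
next
  fix y assume "y \<in> cls (ev z)"
  then have "y - z \<in> K" using assms by (simp add: K_eq cls_def ev_diff G_diff)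
  then show "y \<in> K #>\<^bsub>G\<^esub> z" unfolding r_coset_def by (intro UN_I[of "y - z"]) simp_all
qed

lemma cls_add:
  assumes "f \<in> carrier TT"
  shows "cls f <#>\<^bsub>G\<^esub> cls g = cls (\<lambda>p. f p + g p)"
proof (intro equalityI subsetI)
  fix z assume "z \<in> cls f <#>\<^bsub>G\<^esub> cls g"
  then obtain a b where "a \<in> cls f" "b \<in> cls g" "z = a + b" by (auto simp: set_mult_def)
  then show "z \<in> cls (\<lambda>p. f p + g p)" by (auto simp: cls_def ev_add intro: G_add)
next
  fix z assume z: "z \<in> cls (\<lambda>p. f p + g p)"
  obtain a where a: "a \<in> carrier G" "ev a = f" using ev_surj[OF assms] by blast
  then have "a \<in> cls f" "z - a \<in> cls g" using z by (auto simp: cls_def ev_diff intro: G_diff)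
  then show "z \<in> cls f <#>\<^bsub>G\<^esub> cls g"
    unfolding set_mult_def by (intro UN_I[of a] UN_I[of "z - a"]) simp_all
qed

lemma cls_act:
  assumes h: "\<And>q. q \<in> carrier M \<times> carrier N \<Longrightarrow> h q \<in> carrier M \<times> carrier N"
      "\<And>q. q \<in> carrier M \<times> carrier N \<Longrightarrow> ev (frag_of (h q)) = (\<lambda>p. s p * ev (frag_of q) p)"
    and f: "f \<in> carrier TT"
  shows "K <#>\<^bsub>G\<^esub> (frag_extend (\<lambda>q. frag_of (h q)) ` cls f) = cls (\<lambda>p. s p * f p)"
    and "(\<lambda>p. s p * f p) \<in> carrier TT"
proof -
  have hG: "frag_extend (\<lambda>q. frag_of (h q)) z \<in> carrier G" if "z \<in> carrier G" for z
    using that unfolding carrier_G by (rule keys_frag_extend_subset) (rule h(1))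
  have ev_h: "ev (frag_extend (\<lambda>q. frag_of (h q)) z) = (\<lambda>p. s p * ev z p)" if "z \<in> carrier G" for z
    using that[unfolded carrier_G]
    by (rule frag_induction) (simp_all add: h(2) frag_extend_diff ev_diff right_diff_distrib)
  obtain z where "z \<in> carrier G" "ev z = f" using ev_surj[OF f] by blast
  then show "(\<lambda>p. s p * f p) \<in> carrier TT" using ev_in_carrier[OF hG, of z] ev_h[of z] by simp
  show "K <#>\<^bsub>G\<^esub> (frag_extend (\<lambda>q. frag_of (h q)) ` cls f) = cls (\<lambda>p. s p * f p)"
  proof (intro equalityI subsetI)
    fix y assume "y \<in> K <#>\<^bsub>G\<^esub> (frag_extend (\<lambda>q. frag_of (h q)) ` cls f)"
    then obtain k z where "k \<in> K" "z \<in> cls f" "y = k + frag_extend (\<lambda>q. frag_of (h q)) z"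
      by (auto simp: set_mult_def)
    then show "y \<in> cls (\<lambda>p. s p * f p)" by (simp add: K_eq cls_def ev_add ev_h G_add hG)
  next
    fix y assume y: "y \<in> cls (\<lambda>p. s p * f p)"
    obtain z where z: "z \<in> carrier G" "ev z = f" using ev_surj[OF f] by blast
    have "y - frag_extend (\<lambda>q. frag_of (h q)) z \<in> K"
      using y z by (simp add: K_eq cls_def ev_diff ev_h G_diff hG)
    moreover have "z \<in> cls f" using z by (simp add: cls_def)
    ultimately show "y \<in> K <#>\<^bsub>G\<^esub> (frag_extend (\<lambda>q. frag_of (h q)) ` cls f)"
      unfolding set_mult_def
      by (intro UN_I[of "y - frag_extend (\<lambda>q. frag_of (h q)) z"] UN_I[OF imageI[of z]]) simp_all
  qed
qed

text \<open>
  The choice of the representative does not matter because \<open>ev\<close> is constant on a fibre.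
\<close>

definition theta :: "(('a tens \<times> 'a tens) \<Rightarrow>\<^sub>0 int) set \<Rightarrow> 'p \<Rightarrow> 'k" where
  "theta C = ev (SOME z. z \<in> C)"

lemma theta_cls: "f \<in> carrier TT \<Longrightarrow> theta (cls f) = f"
proof -
  assume "f \<in> carrier TT"
  then have "\<exists>z. z \<in> cls f" using ev_surj by (auto simp: cls_def)
  then have "(SOME z. z \<in> cls f) \<in> cls f" by (rule someI_ex)
  then show ?thesis by (simp add: theta_def cls_def)
qed

lemma Q_simps:
  "carrier Q = cls ` carrier TT" "\<zero>\<^bsub>Q\<^esub> = cls (\<lambda>_. 0)"
  "C \<oplus>\<^bsub>Q\<^esub> C' = C <#>\<^bsub>G\<^esub> C'"
  "smult Q s C = K <#>\<^bsub>G\<^esub> (frag_extend (\<lambda>q. frag_of (smult M s (fst q), snd q)) ` C)"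
  "rsmult Q C s = K <#>\<^bsub>G\<^esub> (frag_extend (\<lambda>q. frag_of (fst q, rsmult N (snd q) s)) ` C)"
  "hcomp Q d = cls ` hcomp TT d"
proof -
  have "carrier Q = rcosets\<^bsub>G\<^esub> K" by (simp add: tensor_quot_def Let_def FactGroup_def)
  also have "\<dots> = cls ` ev ` carrier G" using K_coset by (auto simp: RCOSETS_def)
  also have "ev ` carrier G = carrier TT" using ev_in_carrier ev_surj by (auto simp del: fun_bimod_simps)
  finally show "carrier Q = cls ` carrier TT" .
  show "\<zero>\<^bsub>Q\<^esub> = cls (\<lambda>_. 0)" by (simp add: tensor_quot_def Let_def FactGroup_def K_eq)
  show "C \<oplus>\<^bsub>Q\<^esub> C' = C <#>\<^bsub>G\<^esub> C'" by (simp add: tensor_quot_def Let_def FactGroup_def)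
  show "smult Q s C = K <#>\<^bsub>G\<^esub> (frag_extend (\<lambda>q. frag_of (smult M s (fst q), snd q)) ` C)"
    "rsmult Q C s = K <#>\<^bsub>G\<^esub> (frag_extend (\<lambda>q. frag_of (fst q, rsmult N (snd q) s)) ` C)"
    by (simp_all add: tensor_quot_def Let_def case_prod_unfold)
  have "hcomp Q d = (\<lambda>z. K #>\<^bsub>G\<^esub> z) ` generate G (H d)" by (simp add: tensor_quot_def Let_def)
  also have "\<dots> = (\<lambda>z. cls (ev z)) ` generate G (H d)"
    using K_coset group.generate_in_carrier[OF group_G H_subset] by (intro image_cong) auto
  also have "\<dots> = cls ` hcomp TT d" by (simp only: ev_generate_H[symmetric] image_image)
  finally show "hcomp Q d = cls ` hcomp TT d" .
qed

lemma tensor_quot_iso: "gb_iso (carrier (R_bar n)) theta Q TT"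
proof -
  have act: "smult Q s (cls f) = cls (\<lambda>p. s (l p) * f p)" "(\<lambda>p. s (l p) * f p) \<in> carrier TT"
    "rsmult Q (cls f) s = cls (\<lambda>p. s (r p) * f p)" "(\<lambda>p. s (r p) * f p) \<in> carrier TT"
    if s: "s \<in> carrier (R_bar n)" and f: "f \<in> carrier TT" for s f
  proof -
    let ?h = "\<lambda>q. (smult M s (fst q), snd q)"
    have h: "?h q \<in> carrier M \<times> carrier N" "ev (frag_of (?h q)) = (\<lambda>p. s (l p) * ev (frag_of q) p)"
      if q: "q \<in> carrier M \<times> carrier N" for q
    proof -
      show "?h q \<in> carrier M \<times> carrier N" using q M(9)[OF s] by auto
      show "ev (frag_of (?h q)) = (\<lambda>p. s (l p) * ev (frag_of q) p)"
        using q by (intro ext) (auto simp: ev_frag_of M(10)[OF s] outer)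
    qed
    show "smult Q s (cls f) = cls (\<lambda>p. s (l p) * f p)"
      unfolding Q_simps by (rule cls_act(1)[OF h f])
    show "(\<lambda>p. s (l p) * f p) \<in> carrier TT" by (rule cls_act(2)[OF h f])
    let ?h' = "\<lambda>q. (fst q, rsmult N (snd q) s)"
    have h': "?h' q \<in> carrier M \<times> carrier N" "ev (frag_of (?h' q)) = (\<lambda>p. s (r p) * ev (frag_of q) p)"
      if q: "q \<in> carrier M \<times> carrier N" for q
    proof -
      show "?h' q \<in> carrier M \<times> carrier N" using q N(11)[OF s] by auto
      show "ev (frag_of (?h' q)) = (\<lambda>p. s (r p) * ev (frag_of q) p)"
        using q by (intro ext) (auto simp: ev_frag_of N(12)[OF s] outer)
    qed
    show "rsmult Q (cls f) s = cls (\<lambda>p. s (r p) * f p)"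
      unfolding Q_simps by (rule cls_act(1)[OF h' f])
    show "(\<lambda>p. s (r p) * f p) \<in> carrier TT" by (rule cls_act(2)[OF h' f])
  qed
  have zero: "(\<lambda>_. 0) \<in> carrier TT" by (simp add: zero_in_ext0_polys)
  have bij: "bij_betw theta (cls ` carrier TT) (carrier TT)"
    by (rule bij_betwI[where g = cls]) (auto simp: theta_cls simp del: fun_bimod_simps)
  have add: "cls f \<oplus>\<^bsub>Q\<^esub> cls g = cls (\<lambda>p. f p + g p)" "(\<lambda>p. f p + g p) \<in> carrier TT"
    if "f \<in> carrier TT" "g \<in> carrier TT" for f g
  proof -
    show "cls f \<oplus>\<^bsub>Q\<^esub> cls g = cls (\<lambda>p. f p + g p)"
      unfolding Q_simps(3) by (rule cls_add[OF that(1)])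
    show "(\<lambda>p. f p + g p) \<in> carrier TT"
      using that unfolding fun_bimod_simps by (rule ext0_polys_closed)
  qed
  have hc: "theta ` cls ` hcomp TT d = hcomp TT d" for d
  proof -
    have "theta (cls f) = f" if "f \<in> hcomp TT d" for f
      by (rule theta_cls[OF subsetD[OF T.hcomp_subset that]])
    then have "(\<lambda>f. theta (cls f)) ` hcomp TT d = (\<lambda>f. f) ` hcomp TT d" by (rule image_cong[OF refl])
    then show ?thesis unfolding image_image by simp
  qed
  have "theta \<zero>\<^bsub>Q\<^esub> = \<zero>\<^bsub>TT\<^esub>" using theta_cls[OF zero] by (simp add: Q_simps(2))
  moreover have "C \<oplus>\<^bsub>Q\<^esub> C' \<in> carrier Q \<and> theta (C \<oplus>\<^bsub>Q\<^esub> C') = theta C \<oplus>\<^bsub>TT\<^esub> theta C'"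
    if C: "C \<in> carrier Q" "C' \<in> carrier Q" for C C'
  proof -
    obtain f g where "f \<in> carrier TT" "g \<in> carrier TT" "C = cls f" "C' = cls g"
      using C unfolding Q_simps(1) by (elim imageE)
    then show ?thesis
      using add[of f g] theta_cls[of "\<lambda>p. f p + g p"] theta_cls[of f] theta_cls[of g]
      unfolding Q_simps(1) by simp
  qed
  moreover have "smult Q s C \<in> carrier Q \<and> theta (smult Q s C) = smult TT s (theta C) \<and>
      rsmult Q C s \<in> carrier Q \<and> theta (rsmult Q C s) = rsmult TT (theta C) s"
    if s: "s \<in> carrier (R_bar n)" and C: "C \<in> carrier Q" for s C
  proof -
    obtain f where f: "f \<in> carrier TT" "C = cls f" using C unfolding Q_simps(1) by (elim imageE)
    show ?thesis
      using act[OF s f(1)] theta_cls[OF f(1)] theta_cls[OF act(2)[OF s f(1)]] theta_cls[OF act(4)[OF s f(1)]]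
      unfolding f(2) Q_simps(1) by simp
  qed
  moreover have "hcomp Q d \<subseteq> carrier Q" for d
    unfolding Q_simps(1,6) by (rule image_mono[OF T.hcomp_subset])
  ultimately show ?thesis
    unfolding gb_iso_def using bij zero hc by (simp add: Q_simps(1,2,6) del: fun_bimod_simps)
qed

theorem tensor_iso: "\<exists>\<chi>. gb_iso (carrier (R_bar n)) \<chi> (tensor S M N) TT"
  unfolding tensor_def
  using gb_iso_transport[OF tensor_quot_iso inj_on_coset_name[OF rels_subset]] by blast

end

end

section \<open>Functions on folded paths\<close>

definition pcoords :: "nat \<Rightarrow> nat \<Rightarrow> ((nat \<Rightarrow> 'k::field_char_0) list \<Rightarrow> 'k) set" where
  "pcoords n L = {\<lambda>P. (P ! l) j | l j. l < L \<and> j \<in> {1..n + 1}}"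

lemma pcoordsI: "l < L \<Longrightarrow> j \<in> {1..n + 1} \<Longrightarrow> (\<lambda>P. (P ! l) j) \<in> pcoords n L"
  unfolding pcoords_def by (intro CollectI exI[of _ l] exI[of _ j] conjI refl)

lemma pcoordsE:
  assumes "x \<in> pcoords n L"
  obtains l j where "l < L" "j \<in> {1..n + 1}" "x = (\<lambda>P. (P ! l) j)"
  using assms unfolding pcoords_def by (elim CollectE exE conjE)

lemma coordsE:
  assumes "x \<in> coords n"
  obtains j where "j \<in> {1..n + 1}" "x = (\<lambda>p. p j)"
  using assms unfolding coords_def by (elim CollectE exE conjE)

lemma pull_pcoords:
  assumes x: "x \<in> coords n" and L: "l < L" and \<pi>: "\<And>p. p \<in> D \<Longrightarrow> \<pi> p = p ! l"
  shows "\<exists>y \<in> pcoords n L. \<forall>p \<in> D. x (\<pi> p) = y p"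
proof -
  obtain j where j: "j \<in> {1..n + 1}" "x = (\<lambda>p. p j)" using x by (rule coordsE)
  show ?thesis
    by (rule bexI[OF _ pcoordsI[OF L j(1)]]) (simp add: j(2) \<pi>)
qed

lemma fold_paths_length: "P \<in> fold_paths n w \<Longrightarrow> length P = Suc (length w)"
  by (simp add: fold_paths_def)

lemma fold_paths_hd: "P \<in> fold_paths n w \<Longrightarrow> hd P = P ! 0"
  using fold_paths_nonempty hd_conv_nth by blast

lemma fold_paths_last: "P \<in> fold_paths n w \<Longrightarrow> last P = P ! length w"
  by (simp add: last_conv_nth fold_paths_nonempty fold_paths_length)

lemma fold_paths_ends:
  assumes "P \<in> fold_paths n w"
  shows "hd P \<in> two_valued n" "last P \<in> two_valued n"
  using assms fold_paths_nonempty[OF assms] unfolding fold_paths_def by auto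

definition path_bimod :: "nat \<Rightarrow> nat list \<Rightarrow> ((nat \<Rightarrow> 'k::field_char_0) \<Rightarrow> 'k, (nat \<Rightarrow> 'k) list \<Rightarrow> 'k) gbimod" where
  "path_bimod n w = fun_bimod (pcoords n (Suc (length w))) (fold_paths n w) hd last"

lemma fun_model_paths:
  assumes "D \<subseteq> fold_paths n w" "\<And>P c. P \<in> D \<Longrightarrow> c \<noteq> 0 \<Longrightarrow> map (\<lambda>x j. c * x j) P \<in> D"
  shows "fun_model n (pcoords n (Suc (length w))) D hd last"
proof unfold_locales
  show "pcoords n (Suc (length w)) \<noteq> ({} :: ((nat \<Rightarrow> 'a) list \<Rightarrow> 'a) set)"
    using pcoordsI[of 0 "Suc (length w)" 1 n] by auto
  show "\<exists>y \<in> pcoords n (Suc (length w)). \<forall>p \<in> D. x (hd p) = y p" if "x \<in> coords n" for x :: "(nat \<Rightarrow> 'a) \<Rightarrow> 'a"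
    by (rule pull_pcoords[OF that, of 0]) (auto dest!: subsetD[OF assms(1)] simp: fold_paths_hd)
  show "\<exists>y \<in> pcoords n (Suc (length w)). \<forall>p \<in> D. x (last p) = y p" if "x \<in> coords n" for x :: "(nat \<Rightarrow> 'a) \<Rightarrow> 'a"
    by (rule pull_pcoords[OF that, of "length w"]) (auto dest!: subsetD[OF assms(1)] simp: fold_paths_last)
  fix P :: "(nat \<Rightarrow> 'a) list" and c :: 'a
  assume P: "P \<in> D" "c \<noteq> 0"
  have len: "length P = Suc (length w)" using P assms(1) fold_paths_length by blast
  have "x (map (\<lambda>x j. c * x j) P) = c * x P" if "x \<in> pcoords n (Suc (length w))" for x
    using that len by (auto elim!: pcoordsE)
  then show "\<exists>q \<in> D. \<forall>x \<in> pcoords n (Suc (length w)). x q = c * x P"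
    using assms(2)[OF P] by (intro bexI[of _ "map (\<lambda>x j. c * x j) P"]) simp_all
qed

lemma fun_model_path_bimod: "fun_model n (pcoords n (Suc (length w))) (fold_paths n w) hd last"
  by (rule fun_model_paths) (simp_all add: fold_paths_scale)

lemma gb_iso_cong:
  assumes iso: "gb_iso S \<phi> M N" and eq: "\<And>x. x \<in> carrier M \<Longrightarrow> \<phi> x = \<phi>' x"
  shows "gb_iso S \<phi>' M N"
proof -
  note D = gb_isoD[OF iso]
  show ?thesis
    unfolding gb_iso_def
  proof (intro conjI ballI allI)
    show "bij_betw \<phi>' (carrier M) (carrier N)" by (rule iffD1[OF bij_betw_cong[OF eq] D(1)])
    have "\<phi>' ` hcomp M d = \<phi> ` hcomp M d" for d
      by (rule image_cong[OF refl]) (rule eq[symmetric, OF subsetD[OF D(13)]])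
    then show "\<phi>' ` hcomp M d = hcomp N d" for d using D(14) by simp
  qed (simp_all add: D eq[symmetric] del: D(3))
qed

text \<open>
  Elements of coordinate bimodules all have the form \<open>Elt f\<close>; the value on formal combinations is arbitrary.
\<close>

definition res_map :: "(nat \<Rightarrow> 'k::field_char_0) set \<Rightarrow> ((nat \<Rightarrow> 'k) \<Rightarrow> 'k) tens \<Rightarrow> (nat \<Rightarrow> 'k) \<Rightarrow> 'k" where
  "res_map Y t = (case t of Elt f \<Rightarrow> ext0 Y f | Formal _ \<Rightarrow> undefined)"

text \<open>
  The nonzero points of a nontrivial union of lines.
\<close>

definition cone :: "(nat \<Rightarrow> 'k::field_char_0) set \<Rightarrow> bool" where
  "cone Y \<longleftrightarrow> (\<exists>x. x \<in> Y) \<and> (\<lambda>_. 0) \<notin> Y \<and> (\<forall>x \<in> Y. \<forall>c. c \<noteq> 0 \<longrightarrow> (\<lambda>j. c * x j) \<in> Y)"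

lemma polys_eq_on_cone:
  assumes "cone Y" "f \<in> polys (coords n)" "g \<in> polys (coords n)" "\<And>x. x \<in> Y \<Longrightarrow> f x = g x"
  shows "x \<in> insert (\<lambda>_. 0) Y \<Longrightarrow> f x = g x"
proof -
  obtain y where y: "y \<in> Y" using assms(1) by (auto simp: cone_def)
  have "f (\<lambda>_. 0) - g (\<lambda>_. 0) = 0"
    by (rule polys_coords_vanish_at_zero[where x = y, OF polys_diff[OF assms(2,3)]])
      (use y assms(1,4) in \<open>auto simp: cone_def\<close>)
  then show "x \<in> insert (\<lambda>_. 0) Y \<Longrightarrow> f x = g x" using assms(4) by auto
qed

lemma ext0_ext0: "Y \<subseteq> X \<Longrightarrow> ext0 Y (ext0 X f) = ext0 Y f"
  by (auto simp: ext0_def fun_eq_iff)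

text \<open>
  Removing the origin loses nothing by \<open>polys_eq_on_cone\<close>. The scalars may be any functions that are
  polynomial on \<open>X\<close>; this includes both \<open>R_bar n\<close> and the invariants in the middle of \<open>B_simple\<close>, which
  live on different varieties.
\<close>

lemma coord_ring_iso:
  assumes "cone Y" "X = insert (\<lambda>_. 0) Y"
    and S: "\<And>s. s \<in> S \<Longrightarrow> \<exists>s' \<in> polys (coords n). \<forall>x \<in> X. s x = s' x"
  shows "gb_iso S (ext0 Y) (coord_ring n X) (fun_bimod (coords n) Y id id)"
proof -
  have YX: "Y \<subseteq> X" using assms(2) by auto
  have bij: "bij_betw (ext0 Y) (ext0 X ` polys (coords n)) (ext0 Y ` polys (coords n))"
    unfolding bij_betw_def
  proof
    show "inj_on (ext0 Y) (ext0 X ` polys (coords n))"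
    proof (rule inj_onI, elim imageE)
      fix f g f' g' assume *: "ext0 Y f = ext0 Y g" "f = ext0 X f'" "g = ext0 X g'"
        "f' \<in> polys (coords n)" "g' \<in> polys (coords n)"
      have "f' x = g' x" if "x \<in> Y" for x
        using fun_cong[OF *(1), of x] that YX by (auto simp: *(2,3) ext0_def)
      then show "f = g" unfolding *(2,3)
        using polys_eq_on_cone[OF assms(1) *(4,5)] assms(2) by (intro ext0_cong) blast
    qed
    show "ext0 Y ` ext0 X ` polys (coords n) = ext0 Y ` polys (coords n)"
      by (simp only: image_image ext0_ext0[OF YX])
  qed
  have closed: "(\<lambda>x. s x * f x) \<in> ext0 X ` polys (coords n)" if s: "s \<in> S" and f: "f \<in> ext0 X ` polys (coords n)" for s f
  proof -
    obtain s' f' where s': "s' \<in> polys (coords n)" "\<forall>x \<in> X. s x = s' x"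
      and f': "f' \<in> polys (coords n)" "f = ext0 X f'" using S[OF s] f by blast
    have "(\<lambda>x. s x * f x) = ext0 X (\<lambda>x. s' x * f' x)"
      using s'(2) by (auto simp: f'(2) ext0_def fun_eq_iff)
    then show ?thesis using polys_mult[OF s'(1) f'(1)] by simp
  qed
  have comm: "(\<lambda>x. f x * s x) = (\<lambda>x. s x * f x)" for f s :: "(nat \<Rightarrow> 'a) \<Rightarrow> 'a"
    by (simp add: mult.commute)
  show ?thesis
    unfolding gb_iso_def
  proof (intro conjI ballI allI)
    fix d
    have "ext0 Y ` {ext0 X f | f e. d = 2 * int e \<and> hpoly (coords n) e f}
        = {ext0 Y (ext0 X f) | f e. d = 2 * int e \<and> hpoly (coords n) e f}" by auto
    then show "ext0 Y ` hcomp (coord_ring n X) d = hcomp (fun_bimod (coords n) Y id id) d"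
      by (simp add: ext0_ext0[OF YX])
    show "hcomp (coord_ring n X) d \<subseteq> carrier (coord_ring n X)"
      using zero_in_ext0_polys by (auto intro: polys.homog)
  next
    fix s f assume s: "s \<in> S" and f: "f \<in> carrier (coord_ring n X)"
    show "s \<odot>\<^bsub>coord_ring n X\<^esub> f \<in> carrier (coord_ring n X)"
      "rsmult (coord_ring n X) f s \<in> carrier (coord_ring n X)"
      using closed[OF s, of f] f comm[of f s] by simp_all
    show "ext0 Y (s \<odot>\<^bsub>coord_ring n X\<^esub> f) = s \<odot>\<^bsub>fun_bimod (coords n) Y id id\<^esub> (ext0 Y f)"
      "ext0 Y (rsmult (coord_ring n X) f s) = rsmult (fun_bimod (coords n) Y id id) (ext0 Y f) s"
      by (auto simp: ext0_def fun_eq_iff)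
  next
    fix f g assume "f \<in> carrier (coord_ring n X)" "g \<in> carrier (coord_ring n X)"
    then show "f \<oplus>\<^bsub>coord_ring n X\<^esub> g \<in> carrier (coord_ring n X)" by (simp add: ext0_polys_closed)
    show "ext0 Y (f \<oplus>\<^bsub>coord_ring n X\<^esub> g) = ext0 Y f \<oplus>\<^bsub>fun_bimod (coords n) Y id id\<^esub> ext0 Y g"
      by (auto simp: ext0_def fun_eq_iff)
  qed (use bij in \<open>simp_all add: zero_in_ext0_polys\<close>)
qed

lemma coord_bimod_iso:
  assumes "cone Y" "X = insert (\<lambda>_. 0) Y"
    and S: "\<And>s. s \<in> S \<Longrightarrow> \<exists>s' \<in> polys (coords n). \<forall>x \<in> X. s x = s' x"
  shows "gb_iso S (res_map Y) (coord_bimod n X) (fun_bimod (coords n) Y id id)"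
proof -
  have inj: "inj_on Elt (carrier (coord_ring n X))" by (auto simp: inj_on_def)
  from gb_iso_transport[OF coord_ring_iso[OF assms] inj]
  have iso: "gb_iso S (ext0 Y \<circ> inv_into (carrier (coord_ring n X)) Elt) (coord_bimod n X) (fun_bimod (coords n) Y id id)"
    by (simp add: coord_bimod_def)
  have eq: "(ext0 Y \<circ> inv_into (carrier (coord_ring n X)) Elt) t = res_map Y t" if t: "t \<in> carrier (coord_bimod n X)" for t
  proof -
    obtain f where "f \<in> carrier (coord_ring n X)" "t = Elt f"
      using t by (auto simp: coord_bimod_def transport_def Let_def simp del: coord_ring_simps)
    then show ?thesis using inj by (simp add: res_map_def del: coord_ring_simps)
  qed
  show ?thesis by (rule gb_iso_cong[OF iso eq])
qed

lemma bimod_scalars: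
  assumes "s \<in> carrier (R_bar n)" "X \<subseteq> weyl_union n"
  shows "\<exists>s' \<in> polys (coords n). \<forall>x \<in> X. s x = s' x"
proof -
  obtain s' where "s' \<in> polys (coords n)" "s = ext0 (weyl_union n) s'" using assms(1) by auto
  then show ?thesis using assms(2) by (intro bexI[of _ s']) (auto simp: ext0_def)
qed

text \<open>
  The functions \<open>f0 + \<alpha> f1\<close> with invariant \<open>f0\<close>, \<open>f1\<close> contain the constants and are closed under sums. They
  are closed under multiplication by a coordinate because each coordinate is an invariant
  form plus a multiple of \<open>\<alpha>\<close>, and \<open>\<alpha>\<^sup>2\<close> is invariant.
\<close>

lemma simple_decomposition:
  assumes i: "i \<in> {1..n}" and f: "f \<in> polys (coords n)"
  shows "\<exists>f0 \<in> polys (coords n). \<exists>f1 \<in> polys (coords n).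
    (\<forall>x. f0 (simple_act i x) = f0 x \<and> f1 (simple_act i x) = f1 x \<and>
      f x = f0 x + (x i - x (Suc i)) * (f1 x :: 'k::field_char_0))"
    (is "?P f")
proof -
  have i': "i \<in> {1..n + 1}" "Suc i \<in> {1..n + 1}" using i by auto
  note cc = polys_coord[OF coordsI]
  define al :: "(nat \<Rightarrow> 'k) \<Rightarrow> 'k" where "al x = x i - x (Suc i)" for x
  have al: "al \<in> polys (coords n)" unfolding al_def by (rule polys_diff[OF cc[OF i'(1)] cc[OF i'(2)]])
  have al_act: "al (simple_act i x) = - al x" for x by (simp add: al_def)
  have constants: "?P (\<lambda>_. c)" for c
    by (rule bexI[of _ "\<lambda>_. c"], rule bexI[of _ "\<lambda>_. 0"]) (simp_all add: polys_const)
  have plus: "?P (\<lambda>x. f x + g x)" if fg: "?P f" "?P g" for f g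
  proof -
    obtain f0 f1 where F: "f0 \<in> polys (coords n)" "f1 \<in> polys (coords n)"
      "\<forall>x. f0 (simple_act i x) = f0 x \<and> f1 (simple_act i x) = f1 x \<and> f x = f0 x + (x i - x (Suc i)) * f1 x"
      using fg(1) by blast
    obtain g0 g1 where G: "g0 \<in> polys (coords n)" "g1 \<in> polys (coords n)"
      "\<forall>x. g0 (simple_act i x) = g0 x \<and> g1 (simple_act i x) = g1 x \<and> g x = g0 x + (x i - x (Suc i)) * g1 x"
      using fg(2) by blast
    show ?thesis
      by (rule bexI[of _ "\<lambda>x. f0 x + g0 x"], rule bexI[of _ "\<lambda>x. f1 x + g1 x"])
        (simp_all add: F G polys.add algebra_simps)
  qed
  have mult: "?P (\<lambda>x. y x * f x)" if y: "y \<in> coords n" and f: "?P f" for y f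
  proof -
    obtain f0 f1 where F: "f0 \<in> polys (coords n)" "f1 \<in> polys (coords n)"
      "\<forall>x. f0 (simple_act i x) = f0 x \<and> f1 (simple_act i x) = f1 x \<and> f x = f0 x + (x i - x (Suc i)) * f1 x"
      using f by blast
    obtain j where j: "j \<in> {1..n + 1}" "y = (\<lambda>x. x j)" using y by (rule coordsE)
    \<comment> \<open>\<open>c\<close> makes \<open>u = x\<^sub>j - c \<alpha>\<close> invariant.\<close>
    define c :: 'k where "c = (if j = i then 1/2 else if j = Suc i then -1/2 else 0)"
    define u where "u x = x j - c * al x" for x
    have u: "u \<in> polys (coords n)" unfolding u_def by (rule polys_diff[OF cc[OF j(1)] polys_cmult[OF al]])
    have u_act: "u (simple_act i x) = u x" for x
    proof -
      consider "j = i" | "j = Suc i" | "j \<noteq> i" "j \<noteq> Suc i" by blast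
      then show ?thesis
        by cases (simp_all add: u_def c_def al_def simple_act_other field_simps)
    qed
    have inv: "f0 (simple_act i x) = f0 x" "f1 (simple_act i x) = f1 x" for x using F(3) by simp_all
    have "y x * f x = (u x + c * al x) * (f0 x + al x * f1 x)" for x
      by (simp add: j(2) u_def F(3) al_def)
    then have eq: "y x * f x = (u x * f0 x + c * (al x * (al x * f1 x))) + (x i - x (Suc i)) * (u x * f1 x + c * f0 x)" for x
      unfolding al_def[of x, symmetric] by (simp add: algebra_simps)
    show ?thesis
      by (rule bexI[of _ "\<lambda>x. u x * f0 x + c * (al x * (al x * f1 x))"],
          rule bexI[of _ "\<lambda>x. u x * f1 x + c * f0 x"])
        (simp_all only: eq F(1,2) inv u_act al_act polys.add polys_mult polys_cmult al u mult_minus_left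
          mult_minus_right minus_minus simp_thms)
  qed
  have h: "?P f" if "hpoly (coords n) d f" for d f
    using that
  proof induction
    case (const c) show ?case by (rule constants)
  next
    case (coord d f y) show ?case by (rule mult[OF coord.hyps(2) coord.IH])
  next
    case (add d f g) show ?case by (rule plus[OF add.IH])
  qed
  from f show ?thesis
  proof induction
    case (homog d f) show ?case by (rule h[OF homog])
  next
    case (add f g) show ?case by (rule plus[OF add.IH])
  qed
qed

text \<open>
  Independence is required of the values at the paths from each single starting point, not only over the ring.
  This implies independence over the functions on \<open>starts n w\<close>, and it survives restricting the
  starting points to a smaller set, as happens in the middle factor of a product.
\<close>

definition left_basis :: "nat \<Rightarrow> nat list \<Rightarrow> 'i set \<Rightarrow> ('i \<Rightarrow> (nat \<Rightarrow> 'k::field_char_0) list \<Rightarrow> 'k) \<Rightarrow> bool" where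
  "left_basis n w I b \<longleftrightarrow> finite I \<and> (\<forall>i \<in> I. b i \<in> carrier (path_bimod n w)) \<and>
     (\<forall>f \<in> carrier (path_bimod n w). \<exists>s. (\<forall>i \<in> I. s i \<in> polys (coords n)) \<and>
        (\<forall>P \<in> fold_paths n w. f P = (\<Sum>i\<in>I. s i (hd P) * b i P))) \<and>
     (\<forall>y \<in> starts n w. \<forall>\<gamma>. (\<forall>P \<in> fold_paths n w. hd P = y \<longrightarrow> (\<Sum>i\<in>I. \<gamma> i * b i P) = 0) \<longrightarrow>
        (\<forall>i \<in> I. \<gamma> i = 0))"

lemma path_bimod_carrier: "carrier (path_bimod n w) = ext0 (fold_paths n w) ` polys (pcoords n (Suc (length w)))"
  by (simp add: path_bimod_def)

lemma left_basis_Nil: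
  "left_basis n [] {[] :: bool list} (\<lambda>_. ext0 (fold_paths n []) (\<lambda>_. 1 :: 'k::field_char_0))"
  unfolding left_basis_def
proof (intro conjI ballI allI impI)
  fix f :: "(nat \<Rightarrow> 'k) list \<Rightarrow> 'k" assume "f \<in> carrier (path_bimod n [])"
  then obtain f' where f': "f' \<in> polys (pcoords n 1)" "f = ext0 (fold_paths n []) f'"
    by (auto simp: path_bimod_carrier)
  have "\<exists>y \<in> coords n. \<forall>p \<in> UNIV. x [p] = y p" if "x \<in> pcoords n 1" for x :: "(nat \<Rightarrow> 'k) list \<Rightarrow> 'k"
    using that by (auto elim!: pcoordsE intro!: bexI coordsI)
  from polys_subst[where \<pi> = "\<lambda>x. [x]" and D = UNIV and Y = "coords n", OF f'(1) this]
  obtain s where s: "s \<in> polys (coords n)" "\<forall>p \<in> UNIV. f' [p] = s p" by blast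
  show "\<exists>s. (\<forall>i \<in> {[] :: bool list}. s i \<in> polys (coords n)) \<and>
      (\<forall>P \<in> fold_paths n []. f P = (\<Sum>i\<in>{[]}. s i (hd P) * ext0 (fold_paths n []) (\<lambda>_. 1) P))"
    by (rule exI[of _ "\<lambda>_. s"]) (use s in \<open>auto simp: f'(2) ext0_def fold_paths_Nil\<close>)
next
  fix y :: "nat \<Rightarrow> 'k" and \<gamma> :: "bool list \<Rightarrow> 'k" and i :: "bool list" assume "y \<in> starts n []" and *: "\<forall>P \<in> fold_paths n []. hd P = y \<longrightarrow>
    (\<Sum>i\<in>{[]}. \<gamma> i * ext0 (fold_paths n []) (\<lambda>_. 1) P) = 0" and i: "i \<in> {[]}"
  then have "[y] \<in> fold_paths n []" by (simp add: starts_Nil fold_paths_Nil)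
  then show "\<gamma> i = 0" using *[rule_format, of "[y]"] i by (simp add: ext0_def)
qed (auto simp: path_bimod_carrier polys_const)

section \<open>Bases over the starting point\<close>

lemma pcoords_tl:
  assumes "x \<in> pcoords n L" "\<And>P. P \<in> D \<Longrightarrow> P \<noteq> []"
  shows "\<exists>y \<in> pcoords n (Suc L). \<forall>P \<in> D. x (tl P) = y P"
proof -
  obtain l j where lj: "l < L" "j \<in> {1..n + 1}" "x = (\<lambda>P. (P ! l) j)" using assms(1) by (rule pcoordsE)
  have "tl P ! l = P ! Suc l" if "P \<in> D" for P using assms(2)[OF that] by (cases P) simp_all
  then show ?thesis
    using lj by (intro bexI[OF _ pcoordsI[of "Suc l" "Suc L" j]]) simp_all
qed

text \<open>
  Let \<open>\<alpha>\<close> be the root of \<open>s\<^sub>i\<close>. If the transverse starting points are stable under \<open>s\<^sub>i\<close>, both \<open>b j\<close> and \<open>\<alpha> b j\<close>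
  are needed, and they are separated by the two foldings of a path. If \<open>\<alpha>\<close> agrees with an
  invariant form there, it can be moved to the new starting point and the \<open>b j\<close> suffice.
\<close>

lemma left_basis_Cons:
  fixes b :: "bool list \<Rightarrow> (nat \<Rightarrow> 'k::field_char_0) list \<Rightarrow> 'k"
  assumes B: "left_basis n w I b" and w: "set w \<subseteq> {1..n}" and i: "i \<in> {1..n}"
  shows "\<exists>(I' :: bool list set) b'. left_basis n (i # w) I' (b' :: _ \<Rightarrow> _ \<Rightarrow> 'k)"
proof -
  let ?D = "fold_paths n (i # w) :: (nat \<Rightarrow> 'k) list set"
  define al :: "(nat \<Rightarrow> 'k) \<Rightarrow> 'k" where "al x = x i - x (Suc i)" for x
  have i': "i \<in> {1..n + 1}" "Suc i \<in> {1..n + 1}" using i by auto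
  have al: "al \<in> polys (coords n)"
    unfolding al_def by (rule polys_diff[OF polys_coord[OF coordsI[OF i'(1)]] polys_coord[OF coordsI[OF i'(2)]]])
  have al_act: "al (simple_act i x) = - al x" for x by (simp add: al_def)
  have fin: "finite I" and bc: "\<And>j. j \<in> I \<Longrightarrow> b j \<in> carrier (path_bimod n w)"
    and gen: "\<And>f. f \<in> carrier (path_bimod n w) \<Longrightarrow> \<exists>s. (\<forall>j \<in> I. s j \<in> polys (coords n)) \<and>
        (\<forall>P \<in> fold_paths n w. f P = (\<Sum>j\<in>I. s j (hd P) * b j P))"
    and indep: "\<And>y \<gamma> j. y \<in> starts n w \<Longrightarrow>
        (\<And>P. P \<in> fold_paths n w \<Longrightarrow> hd P = y \<Longrightarrow> (\<Sum>j\<in>I. \<gamma> j * b j P) = 0) \<Longrightarrow> j \<in> I \<Longrightarrow> \<gamma> j = 0"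
    using B unfolding left_basis_def by (simp, blast, blast, blast)
  have DE: "R \<noteq> []" "tl R \<in> fold_paths n w" "hd R \<in> two_valued n" "hd R i \<noteq> hd R (Suc i)"
    "hd (tl R) = hd R \<or> hd (tl R) = simple_act i (hd R)" if "R \<in> ?D" for R
  proof -
    show "R \<noteq> []" using fold_paths_nonempty[OF that] .
    then have "hd R # tl R \<in> ?D" using that by simp
    then show "tl R \<in> fold_paths n w" "hd R \<in> two_valued n" "hd R i \<noteq> hd R (Suc i)"
      "hd (tl R) = hd R \<or> hd (tl R) = simple_act i (hd R)"
      by (auto simp: fold_paths_Cons fold_step_def)
  qed
  have DI: "x # P \<in> ?D" if "P \<in> fold_paths n w" "x \<in> two_valued n" "x i \<noteq> x (Suc i)"
    "hd P = x \<or> hd P = simple_act i x" for x P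
    using that by (simp add: fold_paths_Cons fold_step_def)
  have carI: "ext0 ?D (\<lambda>R. f (hd (tl R)) * g (tl R)) \<in> carrier (path_bimod n (i # w))"
    if f: "f \<in> polys (coords n)" and g: "g \<in> polys (pcoords n (Suc (length w)))" for f g
  proof -
    obtain g' where g': "g' \<in> polys (pcoords n (Suc (length (i # w))))" "\<forall>R \<in> ?D. g (tl R) = g' R"
      using polys_subst[where \<pi> = tl and D = ?D and Y = "pcoords n (Suc (length (i # w)))", OF g]
        pcoords_tl[where D = ?D and L = "Suc (length w)"] DE(1) by force
    have "\<exists>y \<in> pcoords n (Suc (length (i # w))). \<forall>R \<in> ?D. x (hd (tl R)) = y R" if "x \<in> coords n" for x
      by (rule pull_pcoords[OF that, of 1]) (auto dest!: fold_paths_length simp: length_Suc_conv)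
    from polys_subst[where \<pi> = "\<lambda>R. hd (tl R)" and D = ?D and Y = "pcoords n (Suc (length (i # w)))", OF f this]
    obtain f' where f': "f' \<in> polys (pcoords n (Suc (length (i # w))))" "\<forall>R \<in> ?D. f (hd (tl R)) = f' R" by blast
    have "ext0 ?D (\<lambda>R. f (hd (tl R)) * g (tl R)) = ext0 ?D (\<lambda>R. f' R * g' R)"
      using f'(2) g'(2) by (intro ext0_cong) simp
    then show ?thesis using polys_mult[OF f'(1) g'(1)] by (simp add: path_bimod_carrier)
  qed
  have bpoly: "\<exists>g \<in> polys (pcoords n (Suc (length w))). \<forall>P \<in> fold_paths n w. b j P = g P" if "j \<in> I" for j
    using bc[OF that] by (auto simp: path_bimod_carrier ext0_def)
  have carB: "ext0 ?D (\<lambda>R. f (hd (tl R)) * b j (tl R)) \<in> carrier (path_bimod n (i # w))"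
    if f: "f \<in> polys (coords n)" and j: "j \<in> I" for f j
  proof -
    obtain g where g: "g \<in> polys (pcoords n (Suc (length w)))" "\<forall>P \<in> fold_paths n w. b j P = g P"
      using bpoly[OF j] by blast
    have "ext0 ?D (\<lambda>R. f (hd (tl R)) * b j (tl R)) = ext0 ?D (\<lambda>R. f (hd (tl R)) * g (tl R))"
      using g(2) DE(2) by (intro ext0_cong) simp
    then show ?thesis using carI[OF f g(1)] by simp
  qed
  \<comment> \<open>The starting points of \<open>R\<close> and \<open>tl R\<close> are equal or swapped by \<open>s\<^sub>i\<close>, so invariant coefficients may
    be evaluated at either. Splitting off \<open>al\<close> therefore always leads to the following form; the two
    cases below only differ in what becomes of the factor \<open>al (hd (tl R))\<close>.\<close>
  define E where "E f \<longleftrightarrow> (\<exists>s t. (\<forall>j \<in> I. s j \<in> polys (coords n) \<and> t j \<in> polys (coords n)) \<and>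
    (\<forall>R \<in> ?D. f R = (\<Sum>j\<in>I. (s j (hd R) + t j (hd R) * al (hd (tl R))) * b j (tl R))))"
    for f :: "(nat \<Rightarrow> 'k) list \<Rightarrow> 'k"
  have E_add: "E (\<lambda>R. f R + g R)" if "E f" "E g" for f g
  proof -
    obtain s t where st: "\<forall>j \<in> I. s j \<in> polys (coords n) \<and> t j \<in> polys (coords n)"
      "\<forall>R \<in> ?D. f R = (\<Sum>j\<in>I. (s j (hd R) + t j (hd R) * al (hd (tl R))) * b j (tl R))"
      using \<open>E f\<close> unfolding E_def by blast
    obtain s' t' where st': "\<forall>j \<in> I. s' j \<in> polys (coords n) \<and> t' j \<in> polys (coords n)"
      "\<forall>R \<in> ?D. g R = (\<Sum>j\<in>I. (s' j (hd R) + t' j (hd R) * al (hd (tl R))) * b j (tl R))"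
      using \<open>E g\<close> unfolding E_def by blast
    show ?thesis
      unfolding E_def using st st'
      by (intro exI[of _ "\<lambda>j x. s j x + s' j x"] exI[of _ "\<lambda>j x. t j x + t' j x"])
        (auto simp: polys.add sum.distrib algebra_simps)
  qed
  have E_prod: "E (\<lambda>R. f (hd R) * g (tl R))"
    if f: "f \<in> polys (coords n)" and g: "g \<in> polys (pcoords n (Suc (length w)))" for f g
  proof -
    have "ext0 (fold_paths n w) g \<in> carrier (path_bimod n w)" using g by (simp add: path_bimod_carrier)
    from gen[OF this] obtain s where s: "\<forall>j \<in> I. s j \<in> polys (coords n)"
      "\<forall>P \<in> fold_paths n w. ext0 (fold_paths n w) g P = (\<Sum>j\<in>I. s j (hd P) * b j P)" by blast
    have "\<forall>j \<in> I. \<exists>p. fst p \<in> polys (coords n) \<and> snd p \<in> polys (coords n) \<and>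
      (\<forall>x. fst p (simple_act i x) = fst p x \<and> snd p (simple_act i x) = snd p x \<and> s j x = fst p x + al x * snd p x)"
    proof
      fix j assume "j \<in> I"
      with s(1) have "s j \<in> polys (coords n)" by blast
      from simple_decomposition[OF i this] obtain s0 s1 where "s0 \<in> polys (coords n)" "s1 \<in> polys (coords n)"
        "\<forall>x. s0 (simple_act i x) = s0 x \<and> s1 (simple_act i x) = s1 x \<and> s j x = s0 x + (x i - x (Suc i)) * s1 x"
        by blast
      then show "\<exists>p. fst p \<in> polys (coords n) \<and> snd p \<in> polys (coords n) \<and>
        (\<forall>x. fst p (simple_act i x) = fst p x \<and> snd p (simple_act i x) = snd p x \<and> s j x = fst p x + al x * snd p x)"
        by (intro exI[of _ "(s0, s1)"]) (simp add: al_def)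
    qed
    then obtain p where p: "\<forall>j \<in> I. fst (p j) \<in> polys (coords n) \<and> snd (p j) \<in> polys (coords n) \<and>
      (\<forall>x. fst (p j) (simple_act i x) = fst (p j) x \<and> snd (p j) (simple_act i x) = snd (p j) x \<and>
        s j x = fst (p j) x + al x * snd (p j) x)" by (rule bchoice[THEN exE])
    have "f (hd R) * g (tl R) = (\<Sum>j\<in>I. (f (hd R) * fst (p j) (hd R) + f (hd R) * snd (p j) (hd R) * al (hd (tl R))) * b j (tl R))"
      if R: "R \<in> ?D" for R
    proof -
      have inv: "fst (p j) (hd (tl R)) = fst (p j) (hd R)" "snd (p j) (hd (tl R)) = snd (p j) (hd R)" if "j \<in> I" for j
        using DE(5)[OF R] p that by auto
      have "g (tl R) = (\<Sum>j\<in>I. s j (hd (tl R)) * b j (tl R))"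
        using s(2)[rule_format, OF DE(2)[OF R]] DE(2)[OF R] by (simp add: ext0_def)
      also have "\<dots> = (\<Sum>j\<in>I. (fst (p j) (hd R) + al (hd (tl R)) * snd (p j) (hd R)) * b j (tl R))"
        using p inv by (intro sum.cong) simp_all
      finally show ?thesis by (simp add: sum_distrib_left algebra_simps)
    qed
    then show ?thesis
      unfolding E_def using p f
      by (intro exI[of _ "\<lambda>j x. f x * fst (p j) x"] exI[of _ "\<lambda>j x. f x * snd (p j) x"]) (simp add: polys_mult)
  qed
  have E_cong: "E f" if "E g" "\<And>R. R \<in> ?D \<Longrightarrow> f R = g R" for f g
    using that unfolding E_def by simp
  have E_hpoly: "E f" if f: "hpoly (pcoords n (Suc (length (i # w)))) d f" for f d
  proof -
    have sp: "(\<exists>x \<in> coords n. \<forall>R \<in> ?D. x (hd R) = y R) \<or>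
        (\<exists>x \<in> pcoords n (Suc (length w)). \<forall>R \<in> ?D. x (tl R) = y R)"
      if y: "y \<in> pcoords n (Suc (length (i # w)))" for y :: "(nat \<Rightarrow> 'k) list \<Rightarrow> 'k"
    proof -
      obtain l j where lj: "l < Suc (length (i # w))" "j \<in> {1..n + 1}" "y = (\<lambda>P. (P ! l) j)"
        using y by (rule pcoordsE)
      show ?thesis
      proof (cases l)
        case 0
        then show ?thesis using lj
          by (intro disjI1 bexI[OF _ coordsI[OF lj(2)]]) (simp add: fold_paths_hd[of _ n "i # w"])
      next
        case (Suc m)
        have "tl R ! m = R ! Suc m" if "R \<in> ?D" for R using DE(1)[OF that] by (cases R) simp_all
        then show ?thesis using lj Suc
          by (intro disjI2 bexI[OF _ pcoordsI[of m _ j]]) simp_all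
      qed
    qed
    obtain ts where ts: "\<forall>(a, c) \<in> set ts. \<exists>d1 d2. d1 + d2 = d \<and> hpoly (coords n) d1 a \<and>
        hpoly (pcoords n (Suc (length w))) d2 c"
      "\<forall>R \<in> ?D. f R = (\<Sum>(a, c) \<leftarrow> ts. a (hd R) * c (tl R))"
      using hpoly_split[OF f sp] by blast
    have "E (\<lambda>R. \<Sum>(a, c) \<leftarrow> ts. a (hd R) * c (tl R))"
      using ts(1)
    proof (induction ts)
      case Nil
      have "E (\<lambda>R. (\<lambda>_. 0) (hd R) * (\<lambda>_. 0) (tl R))" by (rule E_prod[OF polys_const polys_const])
      then show ?case by simp
    next
      case (Cons t ts)
      obtain a c where t: "t = (a, c)" by (cases t)
      have "a \<in> polys (coords n)" "c \<in> polys (pcoords n (Suc (length w)))"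
        using Cons.prems t by (auto intro: polys.homog)
      from E_add[OF E_prod[OF this] Cons.IH] Cons.prems show ?case by (simp add: t)
    qed
    then show ?thesis by (rule E_cong) (use ts(2) in simp)
  qed
  have E_all: "E f" if f: "f \<in> carrier (path_bimod n (i # w))" for f
  proof -
    obtain f' where f': "f' \<in> polys (pcoords n (Suc (length (i # w))))" "f = ext0 ?D f'"
      using f unfolding path_bimod_carrier by blast
    from f'(1) have "E f'"
    proof induction
      case (homog d f) show ?case by (rule E_hpoly[OF homog])
    next
      case (add f g) show ?case by (rule E_add[OF add.IH])
    qed
    then show ?thesis by (rule E_cong) (simp add: f'(2) ext0_def)
  qed
  have startsE: "x \<in> two_valued n" "x i \<noteq> x (Suc i)" "x \<in> starts n w \<or> simple_act i x \<in> starts n w"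
    if "x \<in> starts n (i # w)" for x :: "nat \<Rightarrow> 'k"
    using that by (simp_all add: starts_Cons[OF i])
  consider (stable) "\<And>x :: nat \<Rightarrow> 'k. x \<in> starts n w \<Longrightarrow> x i \<noteq> x (Suc i) \<Longrightarrow> simple_act i x \<in> starts n w"
    | (invariant) a e where "a \<in> {1..n + 1}" "a \<notin> {i, Suc i}"
      "\<And>x :: nat \<Rightarrow> 'k. x \<in> starts n w \<Longrightarrow> x i \<noteq> x (Suc i) \<Longrightarrow> al x = e * (x i + x (Suc i) - 2 * x a)"
    by (rule stable_or_invariant[OF w i, where 'k = 'k]) (auto simp: al_def)
  then show ?thesis
  proof cases
    case stable
    define I' where "I' = Cons False ` I \<union> Cons True ` I"
    define b' where "b' k = ext0 ?D (\<lambda>R. (if hd k then al (hd (tl R)) else 1) * b (tl k) (tl R))" for k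
    have sum_I': "(\<Sum>k\<in>I'. F k) = (\<Sum>j\<in>I. F (False # j) + F (True # j))" for F :: "bool list \<Rightarrow> 'k"
    proof -
      have "(\<Sum>k\<in>I'. F k) = (\<Sum>k\<in>Cons False ` I. F k) + (\<Sum>k\<in>Cons True ` I. F k)"
        unfolding I'_def using fin by (intro sum.union_disjoint) auto
      then show ?thesis by (simp add: sum.reindex inj_on_def sum.distrib)
    qed
    have "left_basis n (i # w) I' b'"
      unfolding left_basis_def
    proof (intro conjI ballI allI impI)
      show "finite I'" using fin by (simp add: I'_def)
      fix k assume "k \<in> I'"
      then obtain j where j: "j \<in> I" "k = False # j \<or> k = True # j" by (auto simp: I'_def)
      from j(2) show "b' k \<in> carrier (path_bimod n (i # w))"
      proof
        assume k: "k = False # j"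
        show ?thesis using carB[OF polys_const[of 1] j(1)] by (simp add: b'_def k)
      next
        assume k: "k = True # j"
        show ?thesis using carB[OF al j(1)] by (simp add: b'_def k)
      qed
    next
      fix f :: "(nat \<Rightarrow> 'k) list \<Rightarrow> 'k" assume "f \<in> carrier (path_bimod n (i # w))"
      then have "E f" by (rule E_all)
      then obtain s t where st: "\<forall>j \<in> I. s j \<in> polys (coords n) \<and> t j \<in> polys (coords n)"
        "\<forall>R \<in> ?D. f R = (\<Sum>j\<in>I. (s j (hd R) + t j (hd R) * al (hd (tl R))) * b j (tl R))"
        unfolding E_def by blast
      define u where "u k = (if hd k then t (tl k) else s (tl k))" for k
      have "f R = (\<Sum>k\<in>I'. u k (hd R) * b' k R)" if "R \<in> ?D" for R
        using st(2) that by (simp add: sum_I' u_def b'_def ext0_in algebra_simps)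
      moreover have "\<forall>k \<in> I'. u k \<in> polys (coords n)" using st(1) by (auto simp: I'_def u_def)
      ultimately show "\<exists>u. (\<forall>k \<in> I'. u k \<in> polys (coords n)) \<and> (\<forall>R \<in> ?D. f R = (\<Sum>k\<in>I'. u k (hd R) * b' k R))"
        by (intro exI[of _ u]) simp
    next
      fix x :: "nat \<Rightarrow> 'k" and \<gamma> :: "bool list \<Rightarrow> 'k" and k
      assume x: "x \<in> starts n (i # w)"
        and z: "\<forall>R \<in> ?D. hd R = x \<longrightarrow> (\<Sum>k\<in>I'. \<gamma> k * b' k R) = 0" and k: "k \<in> I'"
      note X = startsE[OF x]
      have xx: "x \<in> starts n w" "simple_act i x \<in> starts n w"
        using X(3) stable[of x] stable[of "simple_act i x"] X(2) by auto
      \<comment> \<open>Stability gives paths below both \<open>x\<close> and its reflection, where \<open>al\<close> has opposite values.\<close>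
      have lin: "\<gamma> (False # j) + \<gamma> (True # j) * al y = 0" if y: "y = x \<or> y = simple_act i x" and j: "j \<in> I" for y j
      proof (rule indep[OF _ _ j])
        show "y \<in> starts n w" using y xx by blast
        fix P assume P: "P \<in> fold_paths n w" "hd P = y"
        have R: "x # P \<in> ?D" using DI[OF P(1) X(1,2)] y P(2) by simp
        have "(\<Sum>k\<in>I'. \<gamma> k * b' k (x # P)) = 0" using z R by simp
        then show "(\<Sum>j\<in>I. (\<gamma> (False # j) + \<gamma> (True # j) * al y) * b j P) = 0"
          using R P(2) by (simp add: sum_I' b'_def ext0_in algebra_simps)
      qed
      have alx: "al x \<noteq> 0" using X(2) by (simp add: al_def)
      have zero: "\<gamma> (False # j) = 0 \<and> \<gamma> (True # j) = 0" if j: "j \<in> I" for j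
      proof -
        have 1: "\<gamma> (False # j) + \<gamma> (True # j) * al x = 0" and 2: "\<gamma> (False # j) - \<gamma> (True # j) * al x = 0"
          using lin[OF _ j, of x] lin[OF _ j, of "simple_act i x"] by (simp_all add: al_act)
        have "2 * (\<gamma> (True # j) * al x) = (\<gamma> (False # j) + \<gamma> (True # j) * al x) - (\<gamma> (False # j) - \<gamma> (True # j) * al x)"
          by simp
        also have "\<dots> = 0" by (simp only: 1 2) simp
        finally have "\<gamma> (True # j) = 0" using alx by simp
        then show ?thesis using 1 by simp
      qed
      then show "\<gamma> k = 0" using k by (auto simp: I'_def)
    qed
    then show ?thesis by blast
  next
    case (invariant a e)
    define ell :: "(nat \<Rightarrow> 'k) \<Rightarrow> 'k" where "ell x = e * (x i + x (Suc i) - 2 * x a)" for x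
    have ell: "ell \<in> polys (coords n)"
      unfolding ell_def
      by (rule polys_cmult[OF polys_diff[OF polys.add[OF polys_coord[OF coordsI[OF i'(1)]] polys_coord[OF coordsI[OF i'(2)]]]
              polys_cmult[OF polys_coord[OF coordsI[OF invariant(1)]]]]])
    have ell_act: "ell (simple_act i x) = ell x" for x
      using invariant(2) by (simp add: ell_def simple_act_other add.commute)
    have al_ell: "al (hd (tl R)) = ell (hd R)" if R: "R \<in> ?D" for R
    proof -
      have "hd (tl R) \<in> starts n w" using DE(2)[OF R] by (simp add: starts_def)
      moreover have "hd (tl R) i \<noteq> hd (tl R) (Suc i)" using DE(4,5)[OF R] by auto
      ultimately have "al (hd (tl R)) = ell (hd (tl R))" using invariant(3) by (simp add: ell_def)
      then show ?thesis using DE(5)[OF R] ell_act by auto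
    qed
    define b' where "b' j = ext0 ?D (\<lambda>R. 1 * b j (tl R))" for j
    have "left_basis n (i # w) I b'"
      unfolding left_basis_def
    proof (intro conjI ballI allI impI)
      show "finite I" by (rule fin)
      show "b' j \<in> carrier (path_bimod n (i # w))" if "j \<in> I" for j
        using carB[OF polys_const[of 1] that] by (simp add: b'_def)
    next
      fix f :: "(nat \<Rightarrow> 'k) list \<Rightarrow> 'k" assume "f \<in> carrier (path_bimod n (i # w))"
      then have "E f" by (rule E_all)
      then obtain s t where st: "\<forall>j \<in> I. s j \<in> polys (coords n) \<and> t j \<in> polys (coords n)"
        "\<forall>R \<in> ?D. f R = (\<Sum>j\<in>I. (s j (hd R) + t j (hd R) * al (hd (tl R))) * b j (tl R))"
        unfolding E_def by blast
      define u where "u j x = s j x + t j x * ell x" for j x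
      have "u j \<in> polys (coords n)" if "j \<in> I" for j
        unfolding u_def using st(1) that ell by (intro polys.add polys_mult) auto
      moreover have "f R = (\<Sum>j\<in>I. u j (hd R) * b' j R)" if "R \<in> ?D" for R
        using st(2) that by (simp add: u_def b'_def ext0_in al_ell)
      ultimately show "\<exists>u. (\<forall>j \<in> I. u j \<in> polys (coords n)) \<and> (\<forall>R \<in> ?D. f R = (\<Sum>j\<in>I. u j (hd R) * b' j R))"
        by (intro exI[of _ u]) simp
    next
      fix x :: "nat \<Rightarrow> 'k" and \<gamma> :: "bool list \<Rightarrow> 'k" and k
      assume x: "x \<in> starts n (i # w)"
        and z: "\<forall>R \<in> ?D. hd R = x \<longrightarrow> (\<Sum>j\<in>I. \<gamma> j * b' j R) = 0" and k: "k \<in> I"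
      note X = startsE[OF x]
      obtain y where y: "y = x \<or> y = simple_act i x" "y \<in> starts n w" using X(3) by blast
      show "\<gamma> k = 0"
      proof (rule indep[OF y(2) _ k])
        fix P assume P: "P \<in> fold_paths n w" "hd P = y"
        have R: "x # P \<in> ?D" using DI[OF P(1) X(1,2)] y(1) P(2) by simp
        then have "(\<Sum>j\<in>I. \<gamma> j * b' j (x # P)) = 0" using z by simp
        then show "(\<Sum>j\<in>I. \<gamma> j * b j P) = 0" using R by (simp add: b'_def ext0_in)
      qed
    qed
    then show ?thesis by blast
  qed
qed

lemma left_basis_exists:
  "set w \<subseteq> {1..n} \<Longrightarrow> \<exists>(I :: bool list set) b. left_basis n w I (b :: _ \<Rightarrow> _ \<Rightarrow> 'k::field_char_0)"
proof (induction w)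
  case Nil
  show ?case using left_basis_Nil by blast
next
  case (Cons i w)
  then obtain I :: "bool list set" and b where "left_basis n w I (b :: _ \<Rightarrow> _ \<Rightarrow> 'k)" by auto
  then show ?case by (rule left_basis_Cons) (use Cons.prems in auto)
qed

section \<open>Reversal and annihilators\<close>

lemma gb_iso_trans:
  assumes f: "gb_iso S \<phi> M N" and g: "gb_iso S \<psi> N P"
  shows "gb_iso S (\<psi> \<circ> \<phi>) M P"
proof -
  note F = gb_isoD[OF f] and G = gb_isoD[OF g]
  have "bij_betw (\<psi> \<circ> \<phi>) (carrier M) (carrier P)" by (rule bij_betw_trans[OF F(1) G(1)])
  moreover have "(\<psi> \<circ> \<phi>) ` hcomp M d = hcomp P d" for d
    by (simp only: image_comp[symmetric] F(14) G(14))
  ultimately show ?thesis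
    unfolding gb_iso_def using F(4-13) G(4-12) by simp
qed

text \<open>
  All conditions on folded paths are symmetric in the two ends.
\<close>

lemma gb_iso_rev:
  "gb_iso S (\<lambda>f. f \<circ> rev) (swap_sides (path_bimod n w)) (path_bimod n (rev w) :: (_, (nat \<Rightarrow> 'k::field_char_0) list \<Rightarrow> 'k) gbimod)"
  if S: "S \<subseteq> carrier (R_bar n :: ((nat \<Rightarrow> 'k) \<Rightarrow> 'k, (nat \<Rightarrow> 'k) \<Rightarrow> 'k) gbimod)" and n: "n \<ge> 1"
proof -
  let ?X = "pcoords n (Suc (length w)) :: ((nat \<Rightarrow> 'k) list \<Rightarrow> 'k) set"
  have D: "rev P \<in> fold_paths n u \<longleftrightarrow> P \<in> fold_paths n (rev u)" for P :: "(nat \<Rightarrow> 'k) list" and u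
    using fold_paths_rev[of P n "rev u"] fold_paths_rev[of "rev P" n u] by auto
  have sub: "\<exists>y \<in> ?X. \<forall>P \<in> fold_paths n u. x (rev P) = y P" if x: "x \<in> ?X" and u: "length u = length w" for x u
  proof -
    obtain l j where lj: "l < Suc (length w)" "j \<in> {1..n + 1}" "x = (\<lambda>P. (P ! l) j)" using x by (rule pcoordsE)
    have "rev P ! l = P ! (length w - l)" if "P \<in> fold_paths n u" for P :: "(nat \<Rightarrow> 'k) list"
      using fold_paths_length[OF that] lj(1) u by (simp add: rev_nth)
    then show ?thesis using lj(2,3) by (intro bexI[OF _ pcoordsI[of "length w - l" _ j]]) simp_all
  qed
  have ext0_rev: "ext0 (fold_paths n u) f \<circ> rev = ext0 (fold_paths n (rev u)) g"
    if "\<forall>P \<in> fold_paths n (rev u). f (rev P) = g P" for f g :: "(nat \<Rightarrow> 'k) list \<Rightarrow> 'k" and u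
    using that by (auto simp: ext0_def fun_eq_iff D)
  have car: "f \<circ> rev \<in> carrier (path_bimod n (rev u))" if f: "f \<in> carrier (path_bimod n u)" and u: "length u = length w"
    for f :: "(nat \<Rightarrow> 'k) list \<Rightarrow> 'k" and u
  proof -
    obtain f' where f': "f' \<in> polys ?X" "f = ext0 (fold_paths n u) f'"
      using f u by (auto simp: path_bimod_carrier)
    obtain g where g: "g \<in> polys ?X" "\<forall>P \<in> fold_paths n (rev u). f' (rev P) = g P"
      using polys_subst[where \<pi> = rev and D = "fold_paths n (rev u)" and Y = ?X, OF f'(1)] sub[of _ "rev u"] u by auto
    show ?thesis unfolding f'(2) ext0_rev[OF g(2)] using g(1) u by (simp add: path_bimod_carrier)
  qed
  have hom: "f \<circ> rev \<in> hcomp (path_bimod n (rev u)) d" if f: "f \<in> hcomp (path_bimod n u) d" and u: "length u = length w"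
    for f :: "(nat \<Rightarrow> 'k) list \<Rightarrow> 'k" and u d
  proof -
    from f consider "f = (\<lambda>_. 0)" | f' e where "f = ext0 (fold_paths n u) f'" "d = 2 * int e" "hpoly ?X e f'"
      using u by (auto simp: path_bimod_def)
    then show ?thesis
    proof cases
      case 1
      then show ?thesis by (simp add: path_bimod_def comp_def)
    next
      case 2
      obtain g where g: "hpoly ?X e g" "\<forall>P \<in> fold_paths n (rev u). f' (rev P) = g P"
        using hpoly_subst[where \<pi> = rev and D = "fold_paths n (rev u)" and Y = ?X, OF 2(3)] sub[of _ "rev u"] u by auto
      show ?thesis unfolding 2(1) ext0_rev[OF g(2)] using g(1) u 2(2) by (auto simp: path_bimod_def)
    qed
  qed
  have rr: "(f \<circ> rev) \<circ> rev = f" for f :: "(nat \<Rightarrow> 'k) list \<Rightarrow> 'k" by (simp add: fun_eq_iff)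
  have out: "f (rev P) = 0" if "f \<in> carrier (path_bimod n w)" "P \<notin> fold_paths n (rev w)" for f and P :: "(nat \<Rightarrow> 'k) list"
    using that by (auto simp: path_bimod_carrier ext0_def D)
  have ends: "last (rev P) = hd P" "hd (rev P) = last P" if "P \<in> fold_paths n (rev w)" for P :: "(nat \<Rightarrow> 'k) list"
    using fold_paths_nonempty[OF that] by (simp_all add: last_rev hd_rev)
  interpret fun_model n "pcoords n (Suc (length w))" "fold_paths n w :: (nat \<Rightarrow> 'k) list set" hd last
    by (rule fun_model_path_bimod)
  interpret sw: fun_model n "pcoords n (Suc (length w))" "fold_paths n w :: (nat \<Rightarrow> 'k) list set" last hd
    by (rule swap)
  have Z: "hd ` fold_paths n w \<subseteq> weyl_union n" "last ` fold_paths n w \<subseteq> (weyl_union n :: (nat \<Rightarrow> 'k) set)"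
    by (auto simp: weyl_union_eq[OF n] fold_paths_ends)
  show ?thesis
    unfolding gb_iso_def swap_sides_simps
  proof (intro conjI ballI allI)
    show "bij_betw (\<lambda>f. f \<circ> rev) (carrier (path_bimod n w)) (carrier (path_bimod n (rev w) :: (_, (nat \<Rightarrow> 'k) list \<Rightarrow> 'k) gbimod))"
      by (rule bij_betwI[where g = "\<lambda>f. f \<circ> rev"]) (use car[of _ w] car[of _ "rev w"] rr in auto)
    show "(\<lambda>f. f \<circ> rev) ` hcomp (path_bimod n w) d = hcomp (path_bimod n (rev w) :: (_, (nat \<Rightarrow> 'k) list \<Rightarrow> 'k) gbimod) d" for d
    proof (intro equalityI subsetI)
      fix f :: "(nat \<Rightarrow> 'k) list \<Rightarrow> 'k"
      assume "f \<in> (\<lambda>f. f \<circ> rev) ` hcomp (path_bimod n w) d"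
      then show "f \<in> hcomp (path_bimod n (rev w)) d" using hom[of _ w] by auto
    next
      fix f :: "(nat \<Rightarrow> 'k) list \<Rightarrow> 'k"
      assume "f \<in> hcomp (path_bimod n (rev w)) d"
      then have "f \<circ> rev \<in> hcomp (path_bimod n w) d" using hom[of f "rev w"] by simp
      from imageI[OF this, of "\<lambda>f. f \<circ> rev"]
      show "f \<in> (\<lambda>f. f \<circ> rev) ` hcomp (path_bimod n w) d" by (simp only: rr)
    qed
    show "hcomp (path_bimod n w) d \<subseteq> (carrier (path_bimod n w) :: ((nat \<Rightarrow> 'k) list \<Rightarrow> 'k) set)" for d
      unfolding path_bimod_def by (rule hcomp_subset)
    fix s f
    assume s: "s \<in> S" and f: "f \<in> (carrier (path_bimod n w) :: ((nat \<Rightarrow> 'k) list \<Rightarrow> 'k) set)"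
    have s': "s \<in> ext0 (weyl_union n) ` polys (coords n)" using s S by auto
    show "rsmult (path_bimod n w) f s \<in> carrier (path_bimod n w)" "smult (path_bimod n w) s f \<in> carrier (path_bimod n w)"
      using smult_closed[OF s' Z(1), of f] sw.smult_closed[OF s' Z(2), of f] f unfolding path_bimod_def by simp_all
    show "rsmult (path_bimod n w) f s \<circ> rev = smult (path_bimod n (rev w)) s (f \<circ> rev)"
      "smult (path_bimod n w) s f \<circ> rev = rsmult (path_bimod n (rev w)) (f \<circ> rev) s"
    proof -
      have "s (last (rev P)) * f (rev P) = s (hd P) * f (rev P)" "s (hd (rev P)) * f (rev P) = s (last P) * f (rev P)" for P
        using ends[of P] out[OF f, of P] by (cases "P \<in> fold_paths n (rev w)"; simp)+
      then show "rsmult (path_bimod n w) f s \<circ> rev = smult (path_bimod n (rev w)) s (f \<circ> rev)"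
        "smult (path_bimod n w) s f \<circ> rev = rsmult (path_bimod n (rev w)) (f \<circ> rev) s"
        by (simp_all only: path_bimod_def comp_def fun_bimod_simps)
    qed
  qed (auto simp: path_bimod_def zero_in_ext0_polys ext0_polys_closed fun_eq_iff)
qed

text \<open>
  The alternating vector is a common point.
\<close>

lemma cone_starts_Int:
  assumes "n \<ge> 1" "set u \<subseteq> {1..n}" "set v \<subseteq> {1..n}"
  shows "cone (starts n u \<inter> starts n v :: (nat \<Rightarrow> 'k::field_char_0) set)"
proof -
  obtain x :: "nat \<Rightarrow> 'k" where "x \<in> two_valued n" "\<And>i. i \<in> {1..n} \<Longrightarrow> x i \<noteq> x (Suc i)"
    using alternating_point[OF assms(1)] by blast
  then have "x \<in> starts n u \<inter> starts n v" using alternating_in_starts assms(2,3) by blast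
  moreover have "(\<lambda>_. 0) \<notin> (starts n u :: (nat \<Rightarrow> 'k) set)"
    using starts_subset[of n u] by (auto simp: two_valued_def)
  ultimately show ?thesis unfolding cone_def using starts_scale by auto
qed

lemma cone_starts:
  assumes "n \<ge> 1" "set w \<subseteq> {1..n}"
  shows "cone (starts n w :: (nat \<Rightarrow> 'k::field_char_0) set)"
  using cone_starts_Int[OF assms(1,2,2)] by simp

lemma same_line:
  assumes x: "x \<in> two_valued n" and z: "z \<in> two_valued n"
    and ab: "a \<in> {1..n + 1}" "b \<in> {1..n + 1}" "x a \<noteq> x b" "z a \<noteq> z b"
    and same: "\<And>j. j \<in> {1..n + 1} \<Longrightarrow> z j = (if x j = x a then z a else z b)"
  shows "\<exists>c. c \<noteq> 0 \<and> x = (\<lambda>j. c * (z j :: 'k::field_char_0))"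
proof -
  define c where "c = (x a - x b) / (z a - z b)"
  have "c * (z a - z b) = x a - x b" "c \<noteq> 0" using ab(3,4) by (simp_all add: c_def)
  then have c: "c \<noteq> 0" "c * z a - c * z b = x a - x b" by (simp_all add: right_diff_distrib)
  define y where "y j = x j - c * z j" for j
  have "y \<in> geom_rep n"
    using x z by (auto simp: two_valued_def geom_rep_def y_def sum_subtractf simp flip: sum_distrib_left
        simp del: sum.cl_ivl_Suc)
  moreover have "y j = y a" if "j \<in> {1..n + 1}" for j
  proof (cases "x j = x a")
    case True
    then show ?thesis using same[OF that] by (simp add: y_def)
  next
    case False
    then have "x j = x b" using two_valuedD[OF x ab(1,2) that ab(3)] by simp
    moreover have "z j = z b" using same[OF that] False by simp
    ultimately show ?thesis using c(2) by (simp add: y_def algebra_simps)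
  qed
  ultimately have "y = (\<lambda>_. 0)" by (rule geom_rep_constant_zero)
  then have "x = (\<lambda>j. c * z j)" by (simp add: y_def fun_eq_iff)
  then show ?thesis using c(1) by blast
qed

lemma separate_from_cone:
  assumes x: "x \<in> two_valued n" "x \<notin> Y" and Y: "Y \<subseteq> two_valued n"
      "\<And>z c. z \<in> Y \<Longrightarrow> c \<noteq> 0 \<Longrightarrow> (\<lambda>j. c * z j) \<in> (Y :: (nat \<Rightarrow> 'k::field_char_0) set)"
  obtains f where "f \<in> polys (coords n)" "f x \<noteq> 0" "\<And>z. z \<in> Y \<Longrightarrow> f z = 0"
proof -
  have xg: "x \<in> geom_rep n" "x \<noteq> (\<lambda>_. 0)" using x by (auto simp: two_valued_def)
  have "\<exists>b \<in> {1..n + 1}. x b \<noteq> x 1"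
    using geom_rep_constant_zero[OF xg(1), of "x 1"] xg(2) by blast
  then obtain b where ab: "1 \<in> {1..n + 1}" "b \<in> {1..n + 1}" "x 1 \<noteq> x b" by force
  \<comment> \<open>Nonzero exactly at those vectors of \<open>Z\<close> whose two blocks are those of \<open>x\<close>.\<close>
  define f :: "(nat \<Rightarrow> 'k) \<Rightarrow> 'k" where
    "f z = (z 1 - z b) * (\<Prod>j \<in> {1..n + 1}. z j - z (if x j = x 1 then b else 1))" for z
  have "f \<in> polys (coords n)"
    unfolding f_def using ab
    by (intro polys_mult polys_prod polys_diff polys_coord coordsI) auto
  moreover have "f x \<noteq> 0"
  proof -
    have "x j - x (if x j = x 1 then b else 1) \<noteq> 0" for j using ab(3) by auto
    then show ?thesis using ab(3) by (simp add: f_def del: prod.cl_ivl_Suc)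
  qed
  moreover have "f z = 0" if z: "z \<in> Y" for z
  proof (rule ccontr)
    assume "f z \<noteq> 0"
    then have nz: "z 1 \<noteq> z b" "\<And>j. j \<in> {1..n + 1} \<Longrightarrow> z j \<noteq> z (if x j = x 1 then b else 1)"
      by (auto simp: f_def simp del: prod.cl_ivl_Suc)
    have zt: "z \<in> two_valued n" using z Y(1) by blast
    have "z j = (if x j = x 1 then z 1 else z b)" if "j \<in> {1..n + 1}" for j
      using nz(2)[OF that] two_valuedD[OF zt ab(1,2) that nz(1)] by auto
    from same_line[OF x(1) zt ab nz(1) this] obtain c where "c \<noteq> 0" "x = (\<lambda>j. c * z j)" by blast
    then have "x \<in> Y" using Y(2)[OF z, of c] by simp
    then show False using x(2) by simp
  qed
  ultimately show ?thesis by (rule that)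
qed

text \<open>
  As the path bimodule contains the constant function \<open>1\<close>, a function annihilates it precisely when it vanishes at
  all starting points. The zero locus of these functions is no larger, since the lines of \<open>Z\<close> are
  separated by polynomials.
\<close>

lemma left_variety_eq:
  fixes B :: "'k::field_char_0 weyl_bimod"
  assumes iso: "gb_iso (carrier (R_bar n)) \<phi> B (path_bimod n w)" and n: "n \<ge> 1"
    and w: "w \<noteq> []" "set w \<subseteq> {1..n}"
  shows "left_variety n B = W_seq n w"
proof -
  note D = gb_isoD[OF iso]
  let ?Z = "weyl_union n :: (nat \<Rightarrow> 'k) set"
  have one: "ext0 (fold_paths n w) (\<lambda>_. 1) \<in> carrier (path_bimod n w)"
    by (simp add: path_bimod_carrier polys_const)
  have ann: "(\<forall>b \<in> carrier B. smult B f b = \<zero>\<^bsub>B\<^esub>) \<longleftrightarrow> (\<forall>x \<in> starts n w. f x = 0)"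
    if f: "f \<in> carrier (R_bar n)" for f
  proof
    assume *: "\<forall>b \<in> carrier B. smult B f b = \<zero>\<^bsub>B\<^esub>"
    obtain b where b: "b \<in> carrier B" "\<phi> b = ext0 (fold_paths n w) (\<lambda>_. 1)"
      using gb_iso_inv(1,2)[OF iso one] by blast
    have "(\<lambda>P. f (hd P) * ext0 (fold_paths n w) (\<lambda>_. 1) P) = (\<lambda>_. 0)"
      using D(5) D(10)[OF f b(1)] * b by (simp add: path_bimod_def)
    then have "f (hd P) = 0" if "P \<in> fold_paths n w" for P
      using fun_cong[of _ _ P] that by (fastforce simp: ext0_in)
    then show "\<forall>x \<in> starts n w. f x = 0" by (auto simp: starts_def)
  next
    assume *: "\<forall>x \<in> starts n w. f x = 0"
    show "\<forall>b \<in> carrier B. smult B f b = \<zero>\<^bsub>B\<^esub>"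
    proof
      fix b assume b: "b \<in> carrier B"
      obtain g where g: "\<phi> b = ext0 (fold_paths n w) g" using D(6)[OF b] by (auto simp: path_bimod_carrier)
      have "\<phi> (smult B f b) = (\<lambda>P. f (hd P) * ext0 (fold_paths n w) g P)"
        using D(10)[OF f b] by (simp add: path_bimod_def g)
      also have "\<dots> = (\<lambda>_. 0)" using * by (auto simp: ext0_def starts_def fun_eq_iff)
      also have "\<dots> = \<phi> \<zero>\<^bsub>B\<^esub>" using D(5) by (simp add: path_bimod_def)
      finally show "smult B f b = \<zero>\<^bsub>B\<^esub>" using D(2,4) D(9)[OF f b] by (auto simp: inj_on_def)
    qed
  qed
  have "x \<in> left_variety n B \<longleftrightarrow> x \<in> insert (\<lambda>_. 0) (starts n w)" for x
  proof
    assume x: "x \<in> left_variety n B"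
    then have xZ: "x \<in> insert (\<lambda>_. 0) (two_valued n)" using weyl_union_eq[OF n] by (auto simp: left_variety_def)
    show "x \<in> insert (\<lambda>_. 0) (starts n w)"
    proof (rule ccontr)
      assume c: "x \<notin> insert (\<lambda>_. 0) (starts n w)"
      then have "x \<in> two_valued n" "x \<notin> starts n w" using xZ by auto
      then obtain f where f: "f \<in> polys (coords n)" "f x \<noteq> 0" "\<And>z. z \<in> starts n w \<Longrightarrow> f z = 0"
        using separate_from_cone[of x n "starts n w"] starts_subset starts_scale by blast
      let ?f = "ext0 ?Z f"
      have fc: "?f \<in> carrier (R_bar n)" using f(1) by simp
      have "\<forall>z \<in> starts n w. ?f z = 0" using f(3) by (simp add: ext0_def)
      then have "?f x = 0" using x ann[OF fc] fc unfolding left_variety_def by blast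
      then show False using f(2) x by (simp add: ext0_def left_variety_def)
    qed
  next
    assume x: "x \<in> insert (\<lambda>_. 0) (starts n w)"
    have "f x = 0" if f: "f \<in> carrier (R_bar n)" and z: "\<forall>x \<in> starts n w. f x = 0" for f
    proof -
      obtain f' where f': "f' \<in> polys (coords n)" "f = ext0 ?Z f'" using f by auto
      have sub: "insert (\<lambda>_. 0) (starts n w) \<subseteq> ?Z" using weyl_union_eq[OF n] starts_subset by auto
      have "f' y = 0" if "y \<in> starts n w" for y
      proof -
        have "y \<in> ?Z" using sub that by blast
        then show ?thesis using z[rule_format, OF that] f'(2) by (simp add: ext0_in)
      qed
      then have "f' x = 0"
        using polys_eq_on_cone[OF cone_starts[OF n w(2)] f'(1) polys_const[of 0] _ x] by simp
      then show ?thesis by (simp add: f'(2) ext0_def)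
    qed
    moreover have "x \<in> ?Z" using x weyl_union_eq[OF n] starts_subset by auto
    ultimately show "x \<in> left_variety n B" using ann unfolding left_variety_def by blast
  qed
  then have "left_variety n B = insert (\<lambda>_. 0) (starts n w)" by (rule Set.set_eqI)
  then show ?thesis using W_seq_eq[OF w, where 'k = 'k] by simp
qed

lemma right_variety_swap: "right_variety n B = left_variety n (swap_sides B)"
  by (simp add: right_variety_def left_variety_def)

lemma swap_iso:
  assumes iso: "gb_iso (carrier (R_bar n)) \<phi> (B :: 'k::field_char_0 weyl_bimod) (path_bimod n w)" and n: "n \<ge> 1"
  shows "gb_iso (carrier (R_bar n)) ((\<lambda>f. f \<circ> rev) \<circ> \<phi>) (swap_sides B) (path_bimod n (rev w))"
  by (rule gb_iso_trans[OF gb_iso_swap_sides[OF iso] gb_iso_rev[OF subset_refl n]])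

lemma right_variety_eq:
  fixes B :: "'k::field_char_0 weyl_bimod"
  assumes iso: "gb_iso (carrier (R_bar n)) \<phi> B (path_bimod n w)" and n: "n \<ge> 1"
    and w: "w \<noteq> []" "set w \<subseteq> {1..n}"
  shows "right_variety n B = W_seq n (rev w)"
  unfolding right_variety_swap by (rule left_variety_eq[OF swap_iso[OF iso n] n]) (use w in auto)

section \<open>Products of path bimodules\<close>

lemma path_bimod_graded:
  assumes "n \<ge> 1"
  shows "graded_bimodule (R_bar n) (path_bimod n w :: (_, (nat \<Rightarrow> 'k::field_char_0) list \<Rightarrow> 'k) gbimod)"
proof -
  interpret fun_model n "pcoords n (Suc (length w))" "fold_paths n w :: (nat \<Rightarrow> 'k) list set" hd last
    by (rule fun_model_path_bimod)
  show ?thesis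
    unfolding path_bimod_def
    by (rule graded_fun_bimod) (auto simp: weyl_union_eq[OF assms] fold_paths_ends)
qed

lemma R_bar_hcomp_subset: "hcomp (R_bar n) d \<subseteq> carrier (R_bar n)"
  using zero_in_ext0_polys by (auto intro: polys.homog)

lemma invariants_scalars:
  assumes "s \<in> invariants n i"
  shows "\<exists>s' \<in> polys (coords n). \<forall>x \<in> transverse_union n (simple_refl i). s x = s' x"
  using assms by (auto simp: invariants_def ext0_def)

lemma starts_single:
  assumes "i \<in> {1..n}"
  shows "starts n [i] = {x \<in> two_valued n. x i \<noteq> x (Suc i)}"
  using two_valued_simple_act[OF _ assms] by (auto simp: starts_Cons[OF assms] starts_Nil)

lemma fold_paths_single:
  "P \<in> fold_paths n [i] \<longleftrightarrow>
     (\<exists>x y. P = [x, y] \<and> x \<in> two_valued n \<and> y \<in> two_valued n \<and> fold_step i x y)"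
  by (auto simp: fold_paths_def length_Suc_conv)

text \<open>
  For a single letter the fibre product consists of the pairs of nonzero points of \<open>V\<^sub>i\<close> that \<open>s\<^sub>i\<close>-invariant functions
  do not distinguish, which are the paths with one step.
\<close>

lemma B_simple_iso:
  assumes i: "i \<in> {1..n}"
  shows "\<exists>\<chi>. gb_iso (carrier (R_bar n)) \<chi> (B_simple n i :: 'k::field_char_0 weyl_bimod) (path_bimod n [i])"
proof -
  have n: "n \<ge> 1" using i by auto
  let ?Y = "starts n [i] :: (nat \<Rightarrow> 'k) set"
  let ?V = "transverse_union n (simple_refl i) :: (nat \<Rightarrow> 'k) set"
  have Y: "cone ?Y" by (rule cone_starts[OF n]) (use i in simp)
  have V: "?V = insert (\<lambda>_. 0) ?Y" unfolding transverse_union_eq[OF i] starts_single[OF i] ..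
  have VZ: "?V \<subseteq> weyl_union n" unfolding V weyl_union_eq[OF n] by (rule insert_mono[OF starts_subset])
  have inv_iso: "gb_iso (invariants n i) (res_map ?Y) (coord_bimod n ?V) (fun_bimod (coords n) ?Y id id)"
    by (rule coord_bimod_iso[OF Y V invariants_scalars])
  have R_iso: "gb_iso (carrier (R_bar n)) (res_map ?Y) (coord_bimod n ?V) (fun_bimod (coords n) ?Y id id)"
    by (rule coord_bimod_iso[OF Y V bimod_scalars[OF _ VZ]])
  interpret m: fun_model n "pcoords n (Suc (length [i]))" "fold_paths n [i] :: (nat \<Rightarrow> 'k) list set" hd last
    by (rule fun_model_path_bimod)
  interpret f: fibre_tensor n "pcoords n (Suc (length [i]))" "fold_paths n [i] :: (nat \<Rightarrow> 'k) list set" hd last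
    "coord_bimod n ?V" "coord_bimod n ?V" "invariants n i" "res_map ?Y" "res_map ?Y"
    "coords n" ?Y id id "coords n" ?Y id id hd last
  proof unfold_locales
    fix P :: "(nat \<Rightarrow> 'k) list" assume P: "P \<in> fold_paths n [i]"
    then obtain x y where xy: "P = [x, y]" "x \<in> two_valued n" "y \<in> two_valued n" "fold_step i x y"
      using fold_paths_single by blast
    show "hd P \<in> ?Y" "last P \<in> ?Y"
      using xy by (auto simp: starts_single[OF i] fold_step_def)
    fix s :: "(nat \<Rightarrow> 'k) \<Rightarrow> 'k" assume "s \<in> invariants n i"
    then have "s (simple_act i x) = s x"
      using V xy by (auto simp: invariants_def starts_single[OF i] fold_step_def)
    then show "s (id (hd P)) = s (id (last P))" using xy by (auto simp: fold_step_def)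
  next
    show "\<exists>y \<in> pcoords n (Suc (length [i])). \<forall>p \<in> fold_paths n [i]. x (hd p) = y p"
      if "x \<in> coords n" for x :: "(nat \<Rightarrow> 'k) \<Rightarrow> 'k" by (rule m.left_coords[OF that])
    show "\<exists>y \<in> pcoords n (Suc (length [i])). \<forall>p \<in> fold_paths n [i]. x (last p) = y p"
      if "x \<in> coords n" for x :: "(nat \<Rightarrow> 'k) \<Rightarrow> 'k" by (rule m.right_coords[OF that])
    fix y :: "(nat \<Rightarrow> 'k) list \<Rightarrow> 'k" assume y: "y \<in> pcoords n (Suc (length [i]))"
    obtain l j where lj: "l < Suc (length [i])" "j \<in> {1..n + 1}" "y = (\<lambda>P. (P ! l) j)" using y by (rule pcoordsE)
    consider "l = 0" | "l = 1" using lj(1) by fastforce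
    then show "(\<exists>x \<in> coords n. \<forall>p \<in> fold_paths n [i]. x (hd p) = y p) \<or>
      (\<exists>x \<in> coords n. \<forall>p \<in> fold_paths n [i]. x (last p) = y p)"
    proof cases
      case 1
      then show ?thesis
        by (intro disjI1 bexI[OF _ coordsI[OF lj(2)]]) (simp add: lj(3) fold_paths_hd[of _ n "[i]"])
    next
      case 2
      then show ?thesis
        by (intro disjI2 bexI[OF _ coordsI[OF lj(2)]]) (simp add: lj(3) fold_paths_last[of _ n "[i]"])
    qed
  qed (use R_iso gb_isoD(9-12)[OF inv_iso] in simp_all)
  define al :: "(nat \<Rightarrow> 'k) \<Rightarrow> 'k" where "al x = x i - x (Suc i)" for x
  have i': "i \<in> {1..n + 1}" "Suc i \<in> {1..n + 1}" using i by auto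
  have al: "al \<in> polys (coords n)"
    unfolding al_def by (rule polys_diff[OF polys_coord[OF coordsI[OF i'(1)]] polys_coord[OF coordsI[OF i'(2)]]])
  \<comment> \<open>\<open>1\<close> and \<open>\<alpha>\<close> generate \<open>R\<^sub>i\<close> over its invariants; they are independent at the two points that
    follow a given first point, where \<open>\<alpha>\<close> has opposite nonzero values.\<close>
  define c where "c t = ext0 ?Y (if t then al else (\<lambda>_. 1))" for t :: bool
  have ker: "z \<in> f.K" if z: "z \<in> carrier f.G" "f.ev z = (\<lambda>_. 0)" for z
  proof (rule f.kernel_left_basis[where I = UNIV and c = c])
    show "finite (UNIV :: bool set)" by simp
    show "c t \<in> ext0 ?Y ` polys (coords n)" for t using al by (cases t) (simp_all add: c_def polys_const)
    show "\<exists>s. (\<forall>t \<in> UNIV. s t \<in> invariants n i) \<and> g = (\<lambda>q. \<Sum>t\<in>UNIV. s t (id q) * c t q)"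
      if g: "g \<in> ext0 ?Y ` polys (coords n)" for g
    proof -
      obtain g' where g': "g' \<in> polys (coords n)" "g = ext0 ?Y g'" using g by blast
      from simple_decomposition[OF i g'(1)] obtain s0 s1 where s: "s0 \<in> polys (coords n)" "s1 \<in> polys (coords n)"
        "\<forall>x. s0 (simple_act i x) = s0 x \<and> s1 (simple_act i x) = s1 x \<and> g' x = s0 x + (x i - x (Suc i)) * s1 x"
        by blast
      have stab: "simple_act i x \<in> ?V" if x: "x \<in> ?V" for x
      proof (cases "x = (\<lambda>_. 0)")
        case True
        then have "simple_act i x = (\<lambda>_. 0)" by (simp add: simple_act_apply fun_eq_iff)
        then show ?thesis using V by simp
      next
        case False
        then show ?thesis using x two_valued_simple_act[OF _ i, of x] unfolding V starts_single[OF i] by auto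
      qed
      have inv: "ext0 ?V h \<in> invariants n i" if "h \<in> polys (coords n)" "\<And>x. h (simple_act i x) = h x" for h
        using that stab by (auto simp: invariants_def ext0_in)
      define u where "u t = ext0 ?V (if t then s1 else s0)" for t :: bool
      have "g = (\<lambda>q. \<Sum>t\<in>UNIV. u t (id q) * c t q)"
        using s(3) V by (auto simp: u_def c_def g'(2) ext0_def UNIV_bool al_def fun_eq_iff)
      moreover have "u t \<in> invariants n i" for t using inv[of s0] inv[of s1] s by (cases t) (simp_all add: u_def)
      ultimately show ?thesis by (intro exI[of _ u]) simp
    qed
    fix q \<gamma> and t :: bool
    assume q: "q \<in> ?Y" and *: "\<And>p. p \<in> fold_paths n [i] \<Longrightarrow> hd p = q \<Longrightarrow> (\<Sum>t\<in>UNIV. \<gamma> t * c t (last p)) = 0"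
    have q2: "q \<in> two_valued n" "q i \<noteq> q (Suc i)" using q by (simp_all add: starts_single[OF i])
    then have sq: "simple_act i q \<in> two_valued n" "simple_act i q \<in> ?Y"
      using two_valued_simple_act[OF q2(1) i] by (simp_all add: starts_single[OF i])
    have "[q, q] \<in> fold_paths n [i]" "[q, simple_act i q] \<in> fold_paths n [i]"
      using q2 sq(1) unfolding fold_paths_single by (auto simp: fold_step_def)
    from *[OF this(1)] *[OF this(2)] have 1: "\<gamma> False + \<gamma> True * al q = 0" and 2: "\<gamma> False - \<gamma> True * al q = 0"
      using q sq(2) by (simp_all add: UNIV_bool c_def ext0_in al_def algebra_simps)
    have "2 * (\<gamma> True * al q) = (\<gamma> False + \<gamma> True * al q) - (\<gamma> False - \<gamma> True * al q)" by simp
    also have "\<dots> = 0" by (simp only: 1 2) simp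
    finally have T: "\<gamma> True = 0" using q2(2) by (simp add: al_def)
    then show "\<gamma> t = 0" using 1 by (cases t) simp_all
  qed (use z in simp_all)
  from f.tensor_iso[OF ker] show ?thesis by (simp only: B_simple_def path_bimod_def)
qed

lemma left_basisD:
  assumes "left_basis n w I b"
  shows "finite I" "\<And>i. i \<in> I \<Longrightarrow> b i \<in> carrier (path_bimod n w)"
    "\<And>f. f \<in> carrier (path_bimod n w) \<Longrightarrow> \<exists>s. (\<forall>i \<in> I. s i \<in> polys (coords n)) \<and>
        (\<forall>P \<in> fold_paths n w. f P = (\<Sum>i\<in>I. s i (hd P) * b i P))"
    "\<And>y \<gamma> i. y \<in> starts n w \<Longrightarrow>
        (\<And>P. P \<in> fold_paths n w \<Longrightarrow> hd P = y \<Longrightarrow> (\<Sum>i\<in>I. \<gamma> i * b i P) = 0) \<Longrightarrow> i \<in> I \<Longrightarrow> \<gamma> i = 0"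
  using assms unfolding left_basis_def by (simp, blast, blast, blast)

text \<open>
  Let \<open>Y\<close> be the set of points that are both ends of paths for \<open>u\<close> and starting points of paths for \<open>v\<close>. The first
  tensor product restricts the paths for \<open>u\<close> to those ending in \<open>Y\<close>; here a basis of \<open>B\<close> over its ends
  is used, because the generator \<open>1\<close> of the functions on \<open>Y\<close> is not independent along paths that
  end elsewhere. The second one joins paths; here every first half has a continuation, and a basis of \<open>B'\<close>
  over its starting points serves.
\<close>

lemma star_iso:
  fixes B B' :: "'k::field_char_0 weyl_bimod"
  assumes isoB: "gb_iso (carrier (R_bar n)) \<phi> B (path_bimod n u)"
    and isoB': "gb_iso (carrier (R_bar n)) \<psi> B' (path_bimod n v)"
    and n: "n \<ge> 1" and u: "u \<noteq> []" "set u \<subseteq> {1..n}" and v: "v \<noteq> []" "set v \<subseteq> {1..n}"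
  shows "\<exists>\<chi>. gb_iso (carrier (R_bar n)) \<chi> (star n B B') (path_bimod n (u @ v))"
proof -
  let ?Z = "weyl_union n :: (nat \<Rightarrow> 'k) set"
  define Y where "Y = (starts n (rev u) \<inter> starts n v :: (nat \<Rightarrow> 'k) set)"
  define V where "V = right_variety n B \<inter> left_variety n B'"
  have Y: "cone Y" unfolding Y_def by (rule cone_starts_Int[OF n]) (use u v in simp_all)
  have Wu: "W_seq n (rev u) = insert (\<lambda>_. 0) (starts n (rev u) :: (nat \<Rightarrow> 'k) set)"
    by (rule W_seq_eq) (use u in simp_all)
  have Wv: "W_seq n v = insert (\<lambda>_. 0) (starts n v :: (nat \<Rightarrow> 'k) set)"
    by (rule W_seq_eq[OF v])
  have "V = insert (\<lambda>_. 0) (starts n (rev u)) \<inter> insert (\<lambda>_. 0) (starts n v)"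
    unfolding V_def right_variety_eq[OF isoB n u] left_variety_eq[OF isoB' n v]
    Wu Wv ..
  then have V: "V = insert (\<lambda>_. 0) Y" by (auto simp: Y_def)
  have YZ: "Y \<subseteq> ?Z" using weyl_union_eq[OF n] starts_subset[of n v] by (auto simp: Y_def)
  have VZ: "V \<subseteq> ?Z" using weyl_union_eq[OF n] YZ V by auto
  have V_iso: "gb_iso (carrier (R_bar n)) (res_map Y) (coord_bimod n V) (fun_bimod (coords n) Y id id)"
    by (rule coord_bimod_iso[OF Y V bimod_scalars[OF _ VZ]])
  let ?X1 = "pcoords n (Suc (length u)) :: ((nat \<Rightarrow> 'k) list \<Rightarrow> 'k) set"
  let ?D1 = "{P \<in> fold_paths n u. last P \<in> Y}"
  have Zpaths: "hd P \<in> ?Z" "last P \<in> ?Z" if "P \<in> fold_paths n w" for P w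
    using fold_paths_ends[OF that] weyl_union_eq[OF n] by auto
  have RZ: "ext0 ?Z g \<in> carrier (R_bar n)" if "g \<in> polys (coords n)" for g using that by simp
  interpret m1: fun_model n ?X1 ?D1 hd last
  proof (rule fun_model_paths)
    fix P c assume P: "P \<in> ?D1" "c \<noteq> (0 :: 'k)"
    have "last (map (\<lambda>x j. c * x j) P) = (\<lambda>j. c * last P j)"
      using fold_paths_nonempty[of P n u] P by (simp add: last_map)
    then show "map (\<lambda>x j. c * x j) P \<in> ?D1" using P Y fold_paths_scale[of P n u c] by (auto simp: cone_def)
  qed auto
  interpret mu: fun_model n ?X1 "fold_paths n u :: (nat \<Rightarrow> 'k) list set" hd last by (rule fun_model_path_bimod)
  interpret f1: fibre_tensor n ?X1 ?D1 hd last B "coord_bimod n V" "carrier (R_bar n)" \<phi> "res_map Y"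
    ?X1 "fold_paths n u" hd last "coords n" Y id id "\<lambda>P. P" last
  proof unfold_locales
    show "gb_iso (carrier (R_bar n)) \<phi> B (fun_bimod ?X1 (fold_paths n u) hd last)"
      using isoB by (simp only: path_bimod_def)
    show "\<exists>y \<in> ?X1. \<forall>p \<in> ?D1. x p = y p" if "x \<in> ?X1" for x using that by blast
    show "\<exists>y \<in> ?X1. \<forall>p \<in> ?D1. x (last p) = y p" if "x \<in> coords n" for x :: "(nat \<Rightarrow> 'k) \<Rightarrow> 'k"
      by (rule m1.right_coords[OF that])
    show "(\<exists>x \<in> ?X1. \<forall>p \<in> ?D1. x p = y p) \<or> (\<exists>x \<in> coords n. \<forall>p \<in> ?D1. x (last p) = y p)" if "y \<in> ?X1" for y
      using that by blast
    fix s :: "(nat \<Rightarrow> 'k) \<Rightarrow> 'k" and m assume s: "s \<in> carrier (R_bar n)" and m: "m \<in> carrier B"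
    show "rsmult B m s \<in> carrier B" by (rule gb_isoD(11)[OF isoB s m])
    show "\<phi> (rsmult B m s) = (\<lambda>q. s (last q) * \<phi> m q)"
      using gb_isoD(12)[OF isoB s m] by (simp add: path_bimod_def)
  qed (use V_iso gb_isoD(9-12)[OF V_iso] in simp_all)
  \<comment> \<open>Reversed paths turn a left basis for \<open>rev u\<close> into a right basis for \<open>u\<close>.\<close>
  obtain I :: "bool list set" and b :: "bool list \<Rightarrow> (nat \<Rightarrow> 'k) list \<Rightarrow> 'k" where Ib: "left_basis n (rev u) I b"
    using left_basis_exists[of "rev u" n] u by auto
  note LB = left_basisD[OF Ib]
  have rev_iso: "gb_iso (carrier (R_bar n)) (\<lambda>f. f \<circ> rev) (swap_sides (path_bimod n w)) (path_bimod n (rev w) :: (_, (nat \<Rightarrow> 'k) list \<Rightarrow> 'k) gbimod)" for w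
    by (rule gb_iso_rev[OF subset_refl n])
  have rev_car: "f \<circ> rev \<in> carrier (path_bimod n (rev w))" if "f \<in> carrier (path_bimod n w)" for f :: "(nat \<Rightarrow> 'k) list \<Rightarrow> 'k" and w
    using gb_isoD(6)[OF rev_iso[of w]] that by simp
  have ker1: "z \<in> f1.K" if z: "z \<in> carrier f1.G" "f1.ev z = (\<lambda>_. 0)" for z
  proof (rule f1.kernel_right_basis[where I = I and c = "\<lambda>i. b i \<circ> rev"])
    show "finite I" by (rule LB(1))
    show "b i \<circ> rev \<in> ext0 (fold_paths n u) ` polys ?X1" if "i \<in> I" for i
      using rev_car[OF LB(2)[OF that]] by (simp add: path_bimod_carrier)
    show "\<exists>s. (\<forall>i \<in> I. s i \<in> carrier (R_bar n)) \<and> f = (\<lambda>q. \<Sum>i\<in>I. s i (last q) * (b i \<circ> rev) q)"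
      if f: "f \<in> ext0 (fold_paths n u) ` polys ?X1" for f
    proof -
      have "f \<circ> rev \<in> carrier (path_bimod n (rev u))" using f by (intro rev_car) (simp add: path_bimod_carrier)
      from LB(3)[OF this] obtain s where s: "\<forall>i \<in> I. s i \<in> polys (coords n)"
        "\<forall>P \<in> fold_paths n (rev u). (f \<circ> rev) P = (\<Sum>i\<in>I. s i (hd P) * b i P)" by blast
      have "f q = (\<Sum>i\<in>I. ext0 ?Z (s i) (last q) * (b i \<circ> rev) q)" for q
      proof (cases "q \<in> fold_paths n u")
        case True
        have "f q = (\<Sum>i\<in>I. s i (hd (rev q)) * b i (rev q))"
          using s(2)[rule_format, OF fold_paths_rev[OF True]] by simp
        then show ?thesis using True Zpaths(2)[OF True] fold_paths_nonempty[OF True]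
          by (simp add: hd_rev ext0_in)
      next
        case False
        then have "rev q \<notin> fold_paths n (rev u)" using fold_paths_rev[of "rev q" n "rev u"] by auto
        then have "b i (rev q) = 0" if "i \<in> I" for i
          using LB(2)[OF that] by (auto simp: path_bimod_carrier ext0_def)
        then show ?thesis using False f by (auto simp: ext0_def)
      qed
      then show ?thesis using s(1) by (intro exI[of _ "\<lambda>i. ext0 ?Z (s i)"]) auto
    qed
    fix q \<gamma> i
    assume q: "q \<in> Y" and i: "i \<in> I"
      and *: "\<And>p. p \<in> ?D1 \<Longrightarrow> last p = q \<Longrightarrow> (\<Sum>i\<in>I. \<gamma> i * (b i \<circ> rev) p) = 0"
    show "\<gamma> i = 0"
    proof (rule LB(4)[OF _ _ i])
      show "q \<in> starts n (rev u)" using q by (simp add: Y_def)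
      fix P assume P: "P \<in> fold_paths n (rev u)" "hd P = q"
      have "rev P \<in> ?D1" "last (rev P) = q"
        using fold_paths_rev[OF P(1)] fold_paths_nonempty[OF P(1)] P(2) q by (auto simp: last_rev)
      from *[OF this] show "(\<Sum>i\<in>I. \<gamma> i * b i P) = 0" by simp
    qed
  qed (use z in simp_all)
  from f1.tensor_iso[OF ker1] obtain \<chi>1 where iso1:
    "gb_iso (carrier (R_bar n)) \<chi>1 (tensor (carrier (R_bar n)) B (coord_bimod n V)) (fun_bimod ?X1 ?D1 hd last)" by blast
  let ?X = "pcoords n (Suc (length (u @ v))) :: ((nat \<Rightarrow> 'k) list \<Rightarrow> 'k) set"
  let ?X2 = "pcoords n (Suc (length v)) :: ((nat \<Rightarrow> 'k) list \<Rightarrow> 'k) set"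
  let ?D = "fold_paths n (u @ v) :: (nat \<Rightarrow> 'k) list set"
  let ?p1 = "take (Suc (length u))" and ?p2 = "drop (length u)"
  have pD: "?p1 P \<in> fold_paths n u" "?p2 P \<in> fold_paths n v" "last (?p1 P) = hd (?p2 P)"
    "?p1 P \<in> ?D1" if "P \<in> ?D" for P
  proof -
    show *: "?p1 P \<in> fold_paths n u" "?p2 P \<in> fold_paths n v" "last (?p1 P) = hd (?p2 P)"
      using fold_paths_append[OF that] .
    have "last (?p1 P) \<in> starts n (rev u)" using *(1) by (auto simp: ends_eq_starts_rev[symmetric])
    moreover have "hd (?p2 P) \<in> starts n v" using *(2) by (simp add: starts_def)
    ultimately show "?p1 P \<in> ?D1" using * by (simp add: Y_def)
  qed
  interpret m: fun_model n ?X ?D hd last by (rule fun_model_path_bimod)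
  interpret f2: fibre_tensor n ?X ?D hd last "tensor (carrier (R_bar n)) B (coord_bimod n V)" B'
    "carrier (R_bar n)" \<chi>1 \<psi> ?X1 ?D1 hd last ?X2 "fold_paths n v" hd last ?p1 ?p2
  proof unfold_locales
    show "gb_iso (carrier (R_bar n)) \<chi>1 (tensor (carrier (R_bar n)) B (coord_bimod n V)) (fun_bimod ?X1 ?D1 hd last)"
      by (rule iso1)
    show "gb_iso (carrier (R_bar n)) \<psi> B' (fun_bimod ?X2 (fold_paths n v) hd last)"
      using isoB' by (simp only: path_bimod_def)
    fix P assume P: "P \<in> ?D"
    show "?p1 P \<in> ?D1" "?p2 P \<in> fold_paths n v" using pD[OF P] by auto
    show "hd P = hd (?p1 P)" by (cases P) simp_all
    show "last P = last (?p2 P)" using fold_paths_length[OF P] by simp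
    show "s (last (?p1 P)) = s (hd (?p2 P))" for s using pD(3)[OF P] by simp
  next
    fix s :: "(nat \<Rightarrow> 'k) \<Rightarrow> 'k" and m assume s: "s \<in> carrier (R_bar n)" and m: "m \<in> carrier (tensor (carrier (R_bar n)) B (coord_bimod n V))"
    show "rsmult (tensor (carrier (R_bar n)) B (coord_bimod n V)) m s \<in> carrier (tensor (carrier (R_bar n)) B (coord_bimod n V))"
      by (rule gb_isoD(11)[OF iso1 s m])
    show "\<chi>1 (rsmult (tensor (carrier (R_bar n)) B (coord_bimod n V)) m s) = (\<lambda>q. s (last q) * \<chi>1 m q)"
      using gb_isoD(12)[OF iso1 s m] by simp
  next
    fix s :: "(nat \<Rightarrow> 'k) \<Rightarrow> 'k" and m assume s: "s \<in> carrier (R_bar n)" and m: "m \<in> carrier B'"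
    show "smult B' s m \<in> carrier B'" by (rule gb_isoD(9)[OF isoB' s m])
    show "\<psi> (smult B' s m) = (\<lambda>q. s (hd q) * \<psi> m q)"
      using gb_isoD(10)[OF isoB' s m] by (simp add: path_bimod_def)
  next
    fix x assume x: "x \<in> ?X1"
    obtain l j where lj: "l < Suc (length u)" "j \<in> {1..n + 1}" "x = (\<lambda>P. (P ! l) j)" using x by (rule pcoordsE)
    show "\<exists>y \<in> ?X. \<forall>P \<in> ?D. x (?p1 P) = y P"
      by (rule bexI[OF _ pcoordsI[of l _ j]]) (use lj in auto)
  next
    fix x assume x: "x \<in> ?X2"
    obtain l j where lj: "l < Suc (length v)" "j \<in> {1..n + 1}" "x = (\<lambda>P. (P ! l) j)" using x by (rule pcoordsE)
    have "?p2 P ! l = P ! (length u + l)" if "P \<in> ?D" for P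
      using fold_paths_length[OF that] by (intro nth_drop) simp
    then show "\<exists>y \<in> ?X. \<forall>P \<in> ?D. x (?p2 P) = y P"
      by (intro bexI[OF _ pcoordsI[of "length u + l" _ j]]) (use lj in auto)
  next
    fix y assume y: "y \<in> ?X"
    obtain l j where lj: "l < Suc (length (u @ v))" "j \<in> {1..n + 1}" "y = (\<lambda>P. (P ! l) j)" using y by (rule pcoordsE)
    show "(\<exists>x \<in> ?X1. \<forall>P \<in> ?D. x (?p1 P) = y P) \<or> (\<exists>x \<in> ?X2. \<forall>P \<in> ?D. x (?p2 P) = y P)"
    proof (cases "l < Suc (length u)")
      case True
      then show ?thesis using lj by (intro disjI1 bexI[OF _ pcoordsI[OF True lj(2)]]) auto
    next
      case False
      have "?p2 P ! (l - length u) = P ! l" if "P \<in> ?D" for P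
        using fold_paths_length[OF that] False by simp
      then show ?thesis using lj False
        by (intro disjI2 bexI[OF _ pcoordsI[of "l - length u" _ j]]) auto
    qed
  qed
  obtain J :: "bool list set" and c :: "bool list \<Rightarrow> (nat \<Rightarrow> 'k) list \<Rightarrow> 'k" where Jc: "left_basis n v J c"
    using left_basis_exists[OF v(2)] by blast
  note LC = left_basisD[OF Jc]
  have ker2: "z \<in> f2.K" if z: "z \<in> carrier f2.G" "f2.ev z = (\<lambda>_. 0)" for z
  proof (rule f2.kernel_left_basis[where I = J and c = c])
    show "finite J" by (rule LC(1))
    show "c i \<in> ext0 (fold_paths n v) ` polys ?X2" if "i \<in> J" for i
      using LC(2)[OF that] by (simp add: path_bimod_carrier)
    show "\<exists>s. (\<forall>i \<in> J. s i \<in> carrier (R_bar n)) \<and> g = (\<lambda>q. \<Sum>i\<in>J. s i (hd q) * c i q)"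
      if g: "g \<in> ext0 (fold_paths n v) ` polys ?X2" for g
    proof -
      have "g \<in> carrier (path_bimod n v)" using g by (simp add: path_bimod_carrier)
      from LC(3)[OF this] obtain s where s: "\<forall>i \<in> J. s i \<in> polys (coords n)"
        "\<forall>P \<in> fold_paths n v. g P = (\<Sum>i\<in>J. s i (hd P) * c i P)" by blast
      have "g q = (\<Sum>i\<in>J. ext0 ?Z (s i) (hd q) * c i q)" for q
      proof (cases "q \<in> fold_paths n v")
        case True
        then show ?thesis using s(2) Zpaths(1)[OF True] by (simp add: ext0_in)
      next
        case False
        then have "c i q = 0" if "i \<in> J" for i
          using LC(2)[OF that] by (auto simp: path_bimod_carrier ext0_def)
        then show ?thesis using False g by (auto simp: ext0_def)
      qed
      then show ?thesis using s(1) by (intro exI[of _ "\<lambda>i. ext0 ?Z (s i)"]) auto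
    qed
    fix q \<gamma> i
    assume q: "q \<in> ?D1" and i: "i \<in> J"
      and *: "\<And>p. p \<in> ?D \<Longrightarrow> ?p1 p = q \<Longrightarrow> (\<Sum>i\<in>J. \<gamma> i * c i (?p2 p)) = 0"
    show "\<gamma> i = 0"
    proof (rule LC(4)[OF _ _ i])
      show "last q \<in> starts n v" using q by (simp add: Y_def)
      fix P assume P: "P \<in> fold_paths n v" "hd P = last q"
      have qp: "q \<in> fold_paths n u" using q by simp
      note J = fold_paths_join[OF qp P(1) P(2)[symmetric]]
      show "(\<Sum>i\<in>J. \<gamma> i * c i P) = 0" using *[OF J(1,2)] J(3) by simp
    qed
  qed (use z in simp_all)
  from f2.tensor_iso[OF ker2] show ?thesis by (simp only: star_def V_def path_bimod_def)
qed

lemma associated_iso: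
  assumes "associated n w (B :: 'k::field_char_0 weyl_bimod)" "n \<ge> 1" "set w \<subseteq> {1..n}"
  shows "w \<noteq> [] \<and> (\<exists>\<phi>. gb_iso (carrier (R_bar n)) \<phi> B (path_bimod n w))"
  using assms(1,3)
proof induction
  case (single i)
  then show ?case using B_simple_iso[of i n] by simp
next
  case (product u B v B')
  then have u: "u \<noteq> []" "set u \<subseteq> {1..n}" and v: "v \<noteq> []" "set v \<subseteq> {1..n}" by auto
  obtain \<phi> where "gb_iso (carrier (R_bar n)) \<phi> B (path_bimod n u)" using product u by blast
  moreover obtain \<psi> where "gb_iso (carrier (R_bar n)) \<psi> B' (path_bimod n v)" using product v by blast
  ultimately show ?case using star_iso[OF _ _ assms(2) u v] u(1) by simp
qed

lemma associated_B_seq: "w \<noteq> [] \<Longrightarrow> associated n w (B_seq n w)"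
proof (induction w rule: induct_list012)
  case (3 i j js)
  then show ?case using associated.product[OF associated.single[of n i], of "j # js"] by simp
qed (simp_all add: associated.single)

text \<open>
  Two sets of coefficients of an element agree at all starting points, by independence there, hence also at the
  origin. The action of the quotient is the one on functions, carried over to \<open>B\<close>.
\<close>

lemma left_free:
  fixes B :: "'k::field_char_0 weyl_bimod"
  assumes iso: "gb_iso (carrier (R_bar n)) \<phi> B (path_bimod n w)" and n: "n \<ge> 1"
    and w: "w \<noteq> []" "set w \<subseteq> {1..n}"
  shows "left_free_over n (W_seq n w) B"
proof -
  note D = gb_isoD[OF iso] and Inv = gb_iso_inv[OF iso]
  let ?W = "W_seq n w :: (nat \<Rightarrow> 'k) set"
  let ?X = "pcoords n (Suc (length w)) :: ((nat \<Rightarrow> 'k) list \<Rightarrow> 'k) set"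
  let ?D = "fold_paths n w :: (nat \<Rightarrow> 'k) list set"
  have W: "?W = insert (\<lambda>_. 0) (starts n w)" by (rule W_seq_eq[OF w])
  define \<theta> where "\<theta> = inv_into (carrier B) \<phi>"
  define act where "act g b = \<theta> (\<lambda>P. g (hd P) * \<phi> b P)" for g :: "(nat \<Rightarrow> 'k) \<Rightarrow> 'k" and b
  define M where "M = B\<lparr>smult := act\<rparr>"
  have M [simp]: "carrier M = carrier B" "\<zero>\<^bsub>M\<^esub> = \<zero>\<^bsub>B\<^esub>" "add M = add B" "smult M = act"
    by (simp_all add: M_def)
  interpret T: fun_model n ?X ?D hd last by (rule fun_model_path_bimod)
  have hdW: "hd ` ?D \<subseteq> ?W" by (auto simp: W starts_def)
  have modT: "module (coord_ring n ?W) (path_bimod n w)"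
    unfolding path_bimod_def by (rule T.left_module[OF hdW])
  have out: "\<phi> b P = 0" if "b \<in> carrier B" "P \<notin> ?D" for b P
    using D(6)[OF that(1)] that(2) by (auto simp: path_bimod_carrier ext0_def)
  have closed: "(\<lambda>P. g (hd P) * \<phi> b P) \<in> carrier (path_bimod n w)"
    if "g \<in> carrier (coord_ring n ?W)" "b \<in> carrier B" for g b
    using T.smult_closed[OF _ hdW, of g "\<phi> b"] that D(6)[OF that(2)] by (simp add: path_bimod_def)
  have act: "act g b \<in> carrier B" "\<phi> (act g b) = (\<lambda>P. g (hd P) * \<phi> b P)"
    if "g \<in> carrier (coord_ring n ?W)" "b \<in> carrier B" for g b
    using Inv(1,2)[OF closed[OF that]] by (simp_all add: act_def \<theta>_def)
  have factors: "smult B f b = act (restr ?W f) b" if f: "f \<in> carrier (R_bar n)" and b: "b \<in> carrier B" for f b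
  proof -
    have "\<phi> (smult B f b) = (\<lambda>P. f (hd P) * \<phi> b P)" using D(10)[OF f b] by (simp add: path_bimod_def)
    also have "\<dots> = (\<lambda>P. restr ?W f (hd P) * \<phi> b P)"
    proof
      fix P show "f (hd P) * \<phi> b P = restr ?W f (hd P) * \<phi> b P"
      proof (cases "P \<in> ?D")
        case True
        then have "hd P \<in> ?W" using hdW by blast
        then show ?thesis by (simp add: restr_def)
      qed (simp add: out[OF b])
    qed
    finally have "act (restr ?W f) b = \<theta> (\<phi> (smult B f b))" by (simp add: act_def)
    then show ?thesis using Inv(3)[OF D(9)[OF f b]] by (simp add: \<theta>_def)
  qed
  have modM: "module (coord_ring n ?W) M"
    by (rule module_transfer[OF modT, where \<phi> = \<phi>]) (use D(1,4,5,7,8) act in \<open>simp_all add: path_bimod_def\<close>)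
  obtain I :: "bool list set" and b :: "bool list \<Rightarrow> (nat \<Rightarrow> 'k) list \<Rightarrow> 'k" where Ib: "left_basis n w I b"
    using left_basis_exists[OF w(2)] by blast
  note LB = left_basisD[OF Ib]
  define e where "e i = \<theta> (b i)" for i
  have e: "e i \<in> carrier B" "\<phi> (e i) = b i" if "i \<in> I" for i
    using Inv(1,2)[OF LB(2)[OF that]] by (simp_all add: e_def \<theta>_def)
  obtain y0 :: "nat \<Rightarrow> 'k" where y0: "y0 \<in> starts n w" using cone_starts[OF n w(2)] unfolding cone_def by blast
  \<comment> \<open>A repeated basis function would satisfy the relation \<open>b i - b j = 0\<close>, which independence
    excludes as there is a nonzero starting point.\<close>
  have inj: "inj_on e I"
  proof (rule inj_onI, rule ccontr)
    fix i j assume ij: "i \<in> I" "j \<in> I" "e i = e j" "i \<noteq> j"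
    then have bb: "b i = b j" using e(2) by metis
    define \<gamma> where "\<gamma> k = (if k = i then 1 else if k = j then -1 else 0 :: 'k)" for k
    have "(\<Sum>k\<in>I. \<gamma> k * b k P) = 0" for P
    proof -
      have "(\<Sum>k\<in>I. \<gamma> k * b k P) = (\<Sum>k\<in>{i, j}. \<gamma> k * b k P)"
        using ij LB(1) by (intro sum.mono_neutral_right) (auto simp: \<gamma>_def)
      then show ?thesis using ij(4) bb by (simp add: \<gamma>_def)
    qed
    from LB(4)[OF y0 this ij(1)] show False by (simp add: \<gamma>_def)
  qed
  have fs: "\<phi> (finsum M (\<lambda>x. smult M (c x) x) A) P = (\<Sum>x\<in>A. c x (hd P) * \<phi> x P)"
    if A: "finite A" "A \<subseteq> carrier B" and c: "\<And>x. c x \<in> carrier (coord_ring n ?W)" for A P and c :: "_ \<Rightarrow> _ \<Rightarrow> 'k"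
  proof -
    have cA: "(\<lambda>x. smult M (c x) x) \<in> A \<rightarrow> carrier M" using act(1)[OF c] A(2) by auto
    have "\<phi> (finsum M (\<lambda>x. smult M (c x) x) A) = finsum (path_bimod n w) (\<lambda>x. \<phi> (smult M (c x) x)) A"
      by (rule finsum_transfer[OF module.axioms(2)[OF modM] module.axioms(2)[OF modT] A(1) cA])
        (use D(3,5,8) in \<open>simp_all\<close>)
    also have "\<dots> = (\<lambda>P. \<Sum>x\<in>A. \<phi> (smult M (c x) x) P)"
      unfolding path_bimod_def
    proof (rule finsum_fun_bimod[OF A(1)])
      fix x assume "x \<in> A"
      then show "\<phi> (smult M (c x) x) \<in> carrier (fun_bimod ?X ?D hd last)"
        using D(6)[of "smult M (c x) x"] cA by (auto simp: path_bimod_def)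
    qed
    also have "\<dots> = (\<lambda>P. \<Sum>x\<in>A. c x (hd P) * \<phi> x P)"
      using act(2)[OF c] A(2) by (intro ext sum.cong) auto
    finally show ?thesis by simp
  qed
  have eI: "e ` I \<subseteq> carrier M" using e(1) by auto
  have comb: "\<phi> (finsum M (\<lambda>x. smult M (c x) x) {x. c x \<noteq> \<zero>\<^bsub>coord_ring n ?W\<^esub>}) P = (\<Sum>i\<in>I. c (e i) (hd P) * b i P)"
    if c: "\<And>x. c x \<in> carrier (coord_ring n ?W)" "\<And>x. x \<notin> e ` I \<Longrightarrow> c x = \<zero>\<^bsub>coord_ring n ?W\<^esub>" for c P
  proof -
    let ?A = "{x. c x \<noteq> \<zero>\<^bsub>coord_ring n ?W\<^esub>}"
    have sub: "?A \<subseteq> e ` I" using c(2) by blast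
    have fin: "finite ?A" by (rule finite_subset[OF sub]) (use LB(1) in simp)
    have "\<phi> (finsum M (\<lambda>x. smult M (c x) x) ?A) P = (\<Sum>x\<in>?A. c x (hd P) * \<phi> x P)"
      by (rule fs[OF fin _ c(1)]) (use sub eI in auto)
    also have "\<dots> = (\<Sum>x\<in>e ` I. c x (hd P) * \<phi> x P)"
      using sub LB(1) by (intro sum.mono_neutral_left) auto
    also have "\<dots> = (\<Sum>i\<in>I. c (e i) (hd P) * b i P)"
      using e(2) by (simp add: sum.reindex[OF inj])
    finally show ?thesis .
  qed
  have "\<exists>!c. (\<forall>x. c x \<in> carrier (coord_ring n ?W)) \<and> (\<forall>x. x \<notin> e ` I \<longrightarrow> c x = \<zero>\<^bsub>coord_ring n ?W\<^esub>) \<and>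
      finite {x. c x \<noteq> \<zero>\<^bsub>coord_ring n ?W\<^esub>} \<and>
      m = finsum M (\<lambda>x. smult M (c x) x) {x. c x \<noteq> \<zero>\<^bsub>coord_ring n ?W\<^esub>}" if m: "m \<in> carrier M" for m
  proof -
    have mB: "m \<in> carrier B" using m by simp
    obtain s where s: "\<forall>i \<in> I. s i \<in> polys (coords n)" "\<forall>P \<in> ?D. \<phi> m P = (\<Sum>i\<in>I. s i (hd P) * b i P)"
      using LB(3)[OF D(6)[OF mB]] by blast
    define c where "c x = (if x \<in> e ` I then ext0 ?W (s (inv_into I e x)) else (\<lambda>_. 0))" for x
    have c: "c x \<in> carrier (coord_ring n ?W)" "x \<notin> e ` I \<Longrightarrow> c x = \<zero>\<^bsub>coord_ring n ?W\<^esub>" for x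
      using s(1) zero_in_ext0_polys inv_into_into[of x e I] by (auto simp: c_def)
    have finc: "finite {x. c x \<noteq> \<zero>\<^bsub>coord_ring n ?W\<^esub>}"
      by (rule finite_subset[of _ "e ` I"]) (use c(2) LB(1) in auto)
    have finM: "finsum M (\<lambda>x. smult M (d x) x) {x. d x \<noteq> \<zero>\<^bsub>coord_ring n ?W\<^esub>} \<in> carrier B"
      if d: "\<And>x. d x \<in> carrier (coord_ring n ?W)" "\<And>x. x \<notin> e ` I \<Longrightarrow> d x = \<zero>\<^bsub>coord_ring n ?W\<^esub>" for d
    proof -
      interpret M: module "coord_ring n ?W" M by (rule modM)
      have "(\<lambda>x. smult M (d x) x) \<in> {x. d x \<noteq> \<zero>\<^bsub>coord_ring n ?W\<^esub>} \<rightarrow> carrier M"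
      proof (rule funcsetI)
        fix x assume "x \<in> {x. d x \<noteq> \<zero>\<^bsub>coord_ring n ?W\<^esub>}"
        then have "x \<in> e ` I" using d(2) by blast
        then have "x \<in> carrier B" using eI by auto
        then show "smult M (d x) x \<in> carrier M" using act(1)[OF d(1)] by simp
      qed
      then show ?thesis using M.finsum_closed by simp
    qed
    have val: "\<phi> m P = (\<Sum>i\<in>I. c (e i) (hd P) * b i P)" for P
    proof (cases "P \<in> ?D")
      case True
      then have "hd P \<in> ?W" using hdW by blast
      then show ?thesis using s(2) True by (simp add: c_def inj ext0_in)
    next
      case False
      then have "b i P = 0" if "i \<in> I" for i using out[OF e(1)[OF that] False] e(2)[OF that] by simp
      then show ?thesis using out[OF mB False] by simp
    qed
    show ?thesis
    proof (rule ex1I[of _ c], intro conjI allI impI)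
      show "c x \<in> carrier (coord_ring n ?W)" for x by (rule c(1))
      show "c x = \<zero>\<^bsub>coord_ring n ?W\<^esub>" if "x \<notin> e ` I" for x by (rule c(2)[OF that])
      show "finite {x. c x \<noteq> \<zero>\<^bsub>coord_ring n ?W\<^esub>}" by (rule finc)
      have "\<phi> m = \<phi> (finsum M (\<lambda>x. smult M (c x) x) {x. c x \<noteq> \<zero>\<^bsub>coord_ring n ?W\<^esub>})"
      proof
        fix P
        show "\<phi> m P = \<phi> (finsum M (\<lambda>x. smult M (c x) x) {x. c x \<noteq> \<zero>\<^bsub>coord_ring n ?W\<^esub>}) P"
          unfolding val by (rule comb[OF c, symmetric])
      qed
      then show "m = finsum M (\<lambda>x. smult M (c x) x) {x. c x \<noteq> \<zero>\<^bsub>coord_ring n ?W\<^esub>}"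
        by (rule inj_onD[OF D(2) _ mB finM[OF c]])
    next
      fix d assume d: "(\<forall>x. d x \<in> carrier (coord_ring n ?W)) \<and> (\<forall>x. x \<notin> e ` I \<longrightarrow> d x = \<zero>\<^bsub>coord_ring n ?W\<^esub>) \<and>
        finite {x. d x \<noteq> \<zero>\<^bsub>coord_ring n ?W\<^esub>} \<and>
        m = finsum M (\<lambda>x. smult M (d x) x) {x. d x \<noteq> \<zero>\<^bsub>coord_ring n ?W\<^esub>}"
      then have d': "\<And>x. d x \<in> carrier (coord_ring n ?W)" "\<And>x. x \<notin> e ` I \<Longrightarrow> d x = \<zero>\<^bsub>coord_ring n ?W\<^esub>" by blast+
      have vald: "\<phi> m P = (\<Sum>i\<in>I. d (e i) (hd P) * b i P)" for P
      proof -
        have "\<phi> (finsum M (\<lambda>x. smult M (d x) x) {x. d x \<noteq> \<zero>\<^bsub>coord_ring n ?W\<^esub>}) P = (\<Sum>i\<in>I. d (e i) (hd P) * b i P)"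
          by (rule comb[OF d'])
        then show ?thesis using d[THEN conjunct2, THEN conjunct2, THEN conjunct2] by (simp only:)
      qed
      have eq: "d (e i) y = c (e i) y" if i: "i \<in> I" and y: "y \<in> starts n w" for i y
      proof -
        have "d (e i) y - c (e i) y = 0"
        proof (rule LB(4)[where \<gamma> = "\<lambda>i. d (e i) y - c (e i) y", OF y _ i])
          fix P assume P: "P \<in> ?D" "hd P = y"
          show "(\<Sum>i\<in>I. (d (e i) y - c (e i) y) * b i P) = 0"
            using val[of P] vald[of P] P(2) by (simp add: left_diff_distrib sum_subtractf)
        qed
        then show ?thesis by simp
      qed
      show "d = c"
      proof
        fix x show "d x = c x"
        proof (cases "x \<in> e ` I")
          case True
          then obtain i where i: "i \<in> I" "x = e i" by blast
          obtain d1 c1 where dc: "d1 \<in> polys (coords n)" "d x = ext0 ?W d1" "c1 \<in> polys (coords n)" "c x = ext0 ?W c1"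
            using d'(1)[of x] c(1)[of x] by auto
          have "d1 y = c1 y" if "y \<in> starts n w" for y
            using eq[OF i(1) that] that by (simp add: i(2)[symmetric] dc W ext0_in)
          then have "d1 y = c1 y" if "y \<in> ?W" for y
            using polys_eq_on_cone[OF cone_starts[OF n w(2)] dc(1,3)] that unfolding W by blast
          then show ?thesis unfolding dc(2,4) by (rule ext0_cong)
        next
          case False
          then show ?thesis using c(2) d'(2) by simp
        qed
      qed
    qed
  qed
  then have "free_module (coord_ring n ?W) M"
    unfolding free_module_def by (intro conjI exI[of _ "e ` I"] ballI modM eI)
  then show ?thesis
    unfolding left_free_over_def M_def using factors by (intro exI[of _ act] conjI ballI)
qed

theorem theorem2p15:
  fixes n :: nat and w :: "nat list"
  assumes "n \<ge> 1" and "w \<noteq> []" and "set w \<subseteq> {1..n}"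
  shows "(\<forall>B B' :: 'k::field_char_0 weyl_bimod.
            associated n w B \<longrightarrow> associated n w B' \<longrightarrow> gbimod_isomorphic (R_bar n) B B') \<and>
         left_free_over n (W_seq n w) (B_seq n w :: 'k weyl_bimod) \<and>
         right_free_over n (W_seq n (rev w)) (B_seq n w :: 'k weyl_bimod)"
proof (intro conjI allI impI)
  fix B B' :: "'k weyl_bimod"
  assume "associated n w B" "associated n w B'"
  then obtain \<phi> \<phi>' where "gb_iso (carrier (R_bar n)) \<phi> B (path_bimod n w)"
    "gb_iso (carrier (R_bar n)) \<phi>' B' (path_bimod n w)"
    using associated_iso assms(1,3) by blast
  then show "gbimod_isomorphic (R_bar n) B B'"
    by (rule gb_iso_isomorphic[OF _ _ path_bimod_graded[OF assms(1)] R_bar_hcomp_subset])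
next
  obtain \<phi> where iso: "gb_iso (carrier (R_bar n)) \<phi> (B_seq n w :: 'k weyl_bimod) (path_bimod n w)"
    using associated_iso[OF associated_B_seq] assms by blast
  show "left_free_over n (W_seq n w) (B_seq n w :: 'k weyl_bimod)"
    by (rule left_free[OF iso assms])
  show "right_free_over n (W_seq n (rev w)) (B_seq n w :: 'k weyl_bimod)"
    unfolding right_free_over_def
    by (rule left_free[OF swap_iso[OF iso assms(1)] assms(1)]) (use assms in auto)
qed

end
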